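(* Let $W:\mathbb{R}^d\to\mathcal{M}_n(\mathbb{C})$ be a matrix $A_2$ weight, let $\mathscr{D}$ be a dyadic grid in $\mathbb{R}^d$, let $B:\mathbb{R}^d\to\mathcal{M}_n(\mathbb{C})$ be locally integrable, and let $\pi_B$ be the dyadic paraproduct with respect to $\mathscr{D}$. Then $$\|\pi_B\|_{L^2(W)\to L^2(W)}\lesssim\big(\log\|W\|_{A_2}\big)^{1/2}\,\|W\|_{A_2}^{3/2}\,\|B\|_*^{1/2},$$ where $$\|B\|_*:=\sup_{J\in\mathscr{D}}\frac1{|J|}\sum_{\varepsilon\in\mathrm{Sig}_d}\sum_{I\in\mathscr{D}(J)}\|V_IB_I^\varepsilon V_I^{-1}\|^2,\qquad V_I=(m_IW)^{1/2}.$$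
   Context: $n,d\ge 1$ are integers; $\mathcal{M}_n(\mathbb{C})$ is the algebra of $n\times n$ complex matrices with operator norm $\|\cdot\|$; $|\cdot|$ is the Euclidean norm on $\mathbb{C}^n$; $m_IF$ is the (entrywise) average of $F$ over the cube $I$. $X\lesssim Y$ means $X\le cY$ with a constant $c>0$ independent of $W$ and $B$. For a.e. positive definite $W:\mathbb{R}^d\to\mathcal{M}_n(\mathbb{C})$, $L^2(W)$ is the space of measurable $\vec f:\mathbb{R}^d\to\mathbb{C}^n$ with $\|\vec f\|_{L^2(W)}^2=\int_{\mathbb{R}^d}|W^{1/2}\vec f|^2\,dx<\infty$. $W$ is a matrix $A_2$ weight if $$\|W\|_{A_2}:=\sup_{I\text{ cube}}\frac1{|I|}\int_I\frac1{|I|}\int_I\|W^{1/2}(x)W^{-1/2}(t)\|^{2}\,dt\,dx<\infty.$$ $\mathscr{D}(J)=\{I\in\mathscr{D}:I\subseteq J\}$. Haar functions: for an interval $I$ with left and right halves $I_\ell,I_r$, $h_I^1=|I|^{-1/2}\chi_I$ and $h_I^0=|I|^{-1/2}(\chi_{I_\ell}-\chi_{I_r})$; for a cube $I=I_1\times\cdots\times I_d$ and $\varepsilon\in\{0,1\}^d$, $h_I^\varepsilon=\prod_{i=1}^d h_{I_i}^{\varepsilon_i}$. $\mathrm{Sig}_d=\{0,1\}^d\setminus\{(1,\dots,1)\}$. $B_I^\varepsilon=\int B\,h_I^\varepsilon\,dx$ (entrywise) is the matrix of Haar coefficients of $B$. The paraproduct is $\pi_B\vec f=\sum_{\varepsilon\in\mathrm{Sig}_d}\sum_{I\in\mathscr{D}}B_I^\varepsilon(m_I\vec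 f)h_I^\varepsilon$.
   Formalization: The factor log‖W‖_{A2} is read as max(1, log‖W‖_{A2}), since the literal bound fails for W = Id, where the logarithm is 0 but the paraproduct need not vanish; for ‖W‖_{A2} ≥ e the two agree. *)

theory Defs
  imports "HOL-Analysis.Analysis"
begin

section \<open>Matrices\<close>

definition op_norm :: "complex^'n^'n \<Rightarrow> real" where
  "op_norm A = onorm ((*v) A)"

definition hermitian :: "complex^'n^'n \<Rightarrow> bool" where
  "hermitian A \<longleftrightarrow> (\<forall>i j. A $ i $ j = cnj (A $ j $ i))"

(* On complex^'n the library's real inner product is the real part of the usual Hermitian
   form; for Hermitian A the quadratic form below is therefore the usual (real-valued) one. *)
definition pos_def :: "complex^'n^'n \<Rightarrow> bool" where
  "pos_def A \<longleftrightarrow> hermitian A \<and> (\<forall>v. v \<noteq> 0 \<longrightarrow> 0 < v \<bullet> (A *v v))"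

definition pos_semidef :: "complex^'n^'n \<Rightarrow> bool" where
  "pos_semidef A \<longleftrightarrow> hermitian A \<and> (\<forall>v. 0 \<le> v \<bullet> (A *v v))"

(* Only meaningful for positive semidefinite A, where the root exists and is unique. *)
definition msqrt :: "complex^'n^'n \<Rightarrow> complex^'n^'n" where
  "msqrt A = (THE S. pos_semidef S \<and> S ** S = A)"


section \<open>Cubes, averages and dyadic grids\<close>

definition hcube :: "real^'d \<Rightarrow> real \<Rightarrow> (real^'d) set" where
  "hcube a l = {x. \<forall>i. a $ i \<le> x $ i \<and> x $ i < a $ i + l}"

definition cubes :: "(real^'d) set set" where
  "cubes = {hcube a l | a l. 0 < l}"

definition avg :: "(real^'d) set \<Rightarrow> (real^'d \<Rightarrow> 'b::euclidean_space) \<Rightarrow> 'b" where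
  "avg I F = (1 / measure lebesgue I) *\<^sub>R (LINT x:I|lebesgue. F x)"

definition locally_integrable :: "(real^'d \<Rightarrow> 'b::euclidean_space) \<Rightarrow> bool" where
  "locally_integrable F \<longleftrightarrow> (\<forall>K. compact K \<longrightarrow> set_integrable lebesgue K F)"

definition dyadic_grid :: "(real^'d) set set \<Rightarrow> bool" where
  "dyadic_grid D \<longleftrightarrow>
     (\<forall>I\<in>D. \<exists>a. \<exists>k::int. I = hcube a (2 powi k)) \<and>
     (\<forall>k::int. partition_on UNIV {I\<in>D. \<exists>a. I = hcube a (2 powi k)}) \<and>
     (\<forall>I\<in>D. \<forall>J\<in>D. I \<inter> J = {} \<or> I \<subseteq> J \<or> J \<subseteq> I)"


section \<open>Haar functions\<close>

(* Signatures in {0,1}^d are functions 'd => bool, with True for 1; an interval is given as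
   a set of reals, and a cube by its set of points, its i-th side being the i-th projection. *)

definition left_half :: "real set \<Rightarrow> real set" where
  "left_half J = {x\<in>J. x < (Inf J + Sup J) / 2}"

definition right_half :: "real set \<Rightarrow> real set" where
  "right_half J = {x\<in>J. (Inf J + Sup J) / 2 \<le> x}"

definition haar_interval :: "bool \<Rightarrow> real set \<Rightarrow> real \<Rightarrow> real" where
  "haar_interval e J x =
     (if e then indicator J x / sqrt (measure lebesgue J)
      else (indicator (left_half J) x - indicator (right_half J) x) / sqrt (measure lebesgue J))"

definition haar :: "('d::finite \<Rightarrow> bool) \<Rightarrow> (real^'d) set \<Rightarrow> real^'d \<Rightarrow> real" where
  "haar \<epsilon> I x = (\<Prod>i\<in>UNIV. haar_interval (\<epsilon> i) ((\<lambda>y. y $ i) ` I) (x $ i))"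

definition Sig :: "('d::finite \<Rightarrow> bool) set" where
  "Sig = UNIV - {\<lambda>_. True}"

definition haar_coeff ::
    "(real^'d \<Rightarrow> complex^'n^'n) \<Rightarrow> ('d \<Rightarrow> bool) \<Rightarrow> (real^'d) set \<Rightarrow> complex^'n^'n" where
  "haar_coeff B \<epsilon> I = (LINT x|lebesgue. haar \<epsilon> I x *\<^sub>R B x)"


section \<open>Matrix weights\<close>

definition esqrt :: "ennreal \<Rightarrow> ennreal" where
  "esqrt x = (if x = \<infinity> then \<infinity> else ennreal (sqrt (enn2real x)))"

definition A2_const :: "(real^'d \<Rightarrow> complex^'n^'n) \<Rightarrow> ennreal" where
  "A2_const W = (SUP I\<in>cubes.
     (\<integral>\<^sup>+x\<in>I. ((\<integral>\<^sup>+t\<in>I. ennreal ((op_norm (msqrt (W x) ** matrix_inv (msqrt (W t))))\<^sup>2) \<partial>lebesgue)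
        / emeasure lebesgue I) \<partial>lebesgue) / emeasure lebesgue I)"

(* Local integrability of W is not assumed: it follows from finiteness of A2_const W. *)
definition matrix_A2_weight :: "(real^'d \<Rightarrow> complex^'n^'n) \<Rightarrow> bool" where
  "matrix_A2_weight W \<longleftrightarrow>
     W \<in> borel_measurable lebesgue \<and> (AE x in lebesgue. pos_def (W x)) \<and> A2_const W < \<infinity>"

definition wL2_norm ::
    "(real^'d \<Rightarrow> complex^'n^'n) \<Rightarrow> (real^'d \<Rightarrow> complex^'n) \<Rightarrow> ennreal" where
  "wL2_norm W f = esqrt (\<integral>\<^sup>+x. ennreal ((norm (msqrt (W x) *v f x))\<^sup>2) \<partial>lebesgue)"

definition wL2 :: "(real^'d \<Rightarrow> complex^'n^'n) \<Rightarrow> (real^'d \<Rightarrow> complex^'n) set" where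
  "wL2 W = {f. f \<in> borel_measurable lebesgue \<and> wL2_norm W f < \<infinity>}"

(* With W = I one has A2_const W = 1 and ln 1 = 0, while the paraproduct need not vanish; so,
   as is customary in such estimates, the logarithm is understood as bounded below by 1. *)
definition log_ge1 :: "real \<Rightarrow> real" where
  "log_ge1 x = max 1 (ln x)"


section \<open>The paraproduct\<close>

definition paraproduct_sum ::
    "(('d::finite \<Rightarrow> bool) \<times> (real^'d) set) set \<Rightarrow> (real^'d \<Rightarrow> complex^'n^'n) \<Rightarrow>
     (real^'d \<Rightarrow> complex^'n) \<Rightarrow> real^'d \<Rightarrow> complex^'n" where
  "paraproduct_sum F B f x =
     (\<Sum>(\<epsilon>, I)\<in>F. haar \<epsilon> I x *\<^sub>R (haar_coeff B \<epsilon> I *v avg I f))"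

(* g represents the paraproduct of f: the series converges to g unconditionally in L^2(W). *)
definition is_paraproduct ::
    "(real^'d) set set \<Rightarrow> (real^'d \<Rightarrow> complex^'n^'n) \<Rightarrow> (real^'d \<Rightarrow> complex^'n^'n) \<Rightarrow>
     (real^'d \<Rightarrow> complex^'n) \<Rightarrow> (real^'d \<Rightarrow> complex^'n) \<Rightarrow> bool" where
  "is_paraproduct D W B f g \<longleftrightarrow> g \<in> wL2 W \<and>
     ((\<lambda>F. wL2_norm W (\<lambda>x. g x - paraproduct_sum F B f x)) \<longlongrightarrow> 0)
       (finite_subsets_at_top (Sig \<times> D))"

(* The value is infinite (infimum of the empty set) if the paraproduct is not defined on
   all of L^2(W) or is unbounded. *)
definition paraproduct_norm ::
    "(real^'d) set set \<Rightarrow> (real^'d \<Rightarrow> complex^'n^'n) \<Rightarrow> (real^'d \<Rightarrow> complex^'n^'n) \<Rightarrow> ennreal" where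
  "paraproduct_norm D W B =
     Inf {C. C < \<infinity> \<and> (\<forall>f\<in>wL2 W. \<exists>g. is_paraproduct D W B f g \<and> wL2_norm W g \<le> C * wL2_norm W f)}"

definition star_norm ::
    "(real^'d) set set \<Rightarrow> (real^'d \<Rightarrow> complex^'n^'n) \<Rightarrow> (real^'d \<Rightarrow> complex^'n^'n) \<Rightarrow> ennreal" where
  "star_norm D W B = (SUP J\<in>D.
     (\<Sum>\<epsilon>\<in>Sig. \<Sum>\<^sub>\<infinity>I\<in>{I\<in>D. I \<subseteq> J}.
        ennreal ((op_norm (msqrt (avg I W) ** haar_coeff B \<epsilon> I ** matrix_inv (msqrt (avg I W))))\<^sup>2))
      / emeasure lebesgue J)"

end

theory Submission
  imports Defs
begin

text \<open>
  Write U for the pointwise inverse of W, and W_I, U_I, f_I for averages over a cube I; log A stands for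
  max 1 (ln A). The estimate is the product of two bounds.

  Embedding. If the nonnegative numbers l_I satisfy the Carleson condition \<Sum>_{J \<subseteq> I} l_J \<le> Q |I|, then
  \<Sum> l_I <U_I^{-1} f_I, f_I> \<le> 16 A Q ||f||^2, the norm being that of L^2(W) and A the constant in
  U_I^{-1} \<le> W_I \<le> A U_I^{-1}. With l_I = \<Sum> ||V_I B_I V_I^{-1}||^2 this yields
  \<Sum> |V_I B_I f_I|^2 \<le> 16 A^2 ||B||_* ||f||^2, the loss of the second factor A being the price for
  passing from V_I^2 = W_I to U_I^{-1}.

  Synthesis. For a finite sum s = \<Sum> a_I h_I of vector multiples of Haar functions,
  ||s||^2 \<le> C A (log A) \<Sum> |V_I a_I|^2. Together the two bounds give the power 3/2 of A, the power 1/2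
  of its logarithm, and the unconditional convergence of the paraproduct series. Here A is at most the
  A2 constant times the size n of the matrices.

  Both bounds are proved by Bellman functions on the tree of dyadic cubes (lemma telescope). For the
  embedding the Bellman function is <P_I^{-1} f_I, f_I>, where P_I is U_I enlarged by a multiple of the
  Carleson sum \<Sum>_{J \<subseteq> I} l_J U_J / |I|. This matrix lies between U_I and 2 U_I, because the Carleson
  condition forces \<Sum>_{J \<subseteq> I} l_J <U_J v, v> \<le> 4 A Q |I| <U_I v, v> (lemma carleson_weight, itself a
  Bellman argument), and each cube contributes a definite multiple of l_I <U_I^{-1} f_I, f_I> because the
  increment of the matrix at I is a scalar multiple of U_I (lemma carleson_embedding).

  The synthesis bound is dual to the square function estimate
  \<Sum> <W_I^{-1} g_I, g_I> \<le> C A (log A) ||g||^2 in L^2(U) for the Haar coefficients g_I of g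
  (lemmas square_function_le and haar_poly_norm_le). A coefficient is a combination of the averages of g
  over the children of I. Comparing them with W_c W_I^{-1} X_I, where X_I is the average of g, leaves two
  parts. The first telescopes. The second is at most alpha_I <W_I^{-1} X_I, X_I> with
  alpha_I = C |I| (log det W_I - average of log det W_c over the children). The numbers alpha_I are again a
  Carleson sequence, with constant at most a multiple of log det (W_I U_I) \<le> n log A, which is where the
  logarithm comes from; the embedding theorem for the weight W finishes the proof.

  The convexity that these arguments need comes from the variational formula for the inverse of a
  positive definite form (lemma quad_inv_ge) and from simultaneous diagonalization of two forms
  (lemma relative_eigenvalues).
\<close>

section \<open>Hermitian matrices and their square roots\<close>

definition adj :: "complex^'n^'n \<Rightarrow> complex^'n^'n" where
  "adj A = (\<chi> i j. cnj (A $ j $ i))"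

lemma adj_nth [simp]: "adj A $ i $ j = cnj (A $ j $ i)"
  by (simp add: adj_def)

lemma hermitian_adj: "hermitian A \<longleftrightarrow> adj A = A"
  unfolding hermitian_def vec_eq_iff adj_nth by metis

lemma adj_adj [simp]: "adj (adj A) = A"
  by (simp add: vec_eq_iff)

lemma adj_mult: "adj (A ** B) = adj B ** adj A"
  by (simp add: vec_eq_iff matrix_matrix_mult_def mult.commute)

lemma inner_eq_Re: "x \<bullet> y = Re (\<Sum>i\<in>UNIV. x $ i * cnj (y $ i))" for x y :: "complex^'n"
  by (simp add: inner_vec_def inner_complex_def)

lemma adj_inner: "(A *v x) \<bullet> y = x \<bullet> (adj A *v y)"
proof -
  have "(\<Sum>i\<in>UNIV. (A *v x) $ i * cnj (y $ i)) = (\<Sum>i\<in>UNIV. \<Sum>j\<in>UNIV. A$i$j * x$j * cnj (y $ i))"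
    by (simp add: matrix_vector_mult_def sum_distrib_right)
  also have "\<dots> = (\<Sum>j\<in>UNIV. \<Sum>i\<in>UNIV. A$i$j * x$j * cnj (y $ i))"
    by (rule sum.swap)
  also have "\<dots> = (\<Sum>j\<in>UNIV. x $ j * cnj ((adj A *v y) $ j))"
    by (intro sum.cong refl) (simp add: matrix_vector_mult_def sum_distrib_left algebra_simps)
  finally show ?thesis unfolding inner_eq_Re by (rule arg_cong)
qed

lemma herm_inner: "hermitian A \<Longrightarrow> (A *v x) \<bullet> y = x \<bullet> (A *v y)"
  by (simp add: adj_inner hermitian_adj)

lemma mv_scaleR [simp]: "A *v (r *\<^sub>R x) = r *\<^sub>R (A *v x)" for A :: "complex^'n^'n"
  using linear_scale[OF matrix_vector_mul_linear] by blast

lemma scaleR_mv [simp]: "(r *\<^sub>R A) *v x = r *\<^sub>R (A *v x)" for A :: "complex^'n^'n"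
  by (simp add: vec_eq_iff matrix_vector_mult_def scaleR_sum_right)

lemma scaleR_nth: "(r *\<^sub>R x) $ i = of_real r * x $ i" for x :: "complex^'n"
  by (subst vector_scaleR_component) (rule scaleR_conv_of_real)

lemma mv_axis_nth: "(M *v axis i 1) $ k = M $ k $ i" for M :: "complex^'n^'n"
proof -
  have "M $ k $ j * axis i 1 $ j = (if j = i then M $ k $ j else 0)" for j by (simp add: axis_def)
  then show ?thesis by (simp add: matrix_vector_mult_def)
qed

lemma sum_mv: "(\<Sum>i\<in>S. f i) *v x = (\<Sum>i\<in>S. f i *v x)" for f :: "'a \<Rightarrow> complex^'n^'n"
  by (induction S rule: infinite_finite_induct) (simp_all add: matrix_vector_mult_add_rdistrib)

text \<open>The unit vector that maximizes the quadratic form on the subspace is an eigenvector: the first variation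
  of the quotient in the direction of A x - \<mu> x is a positive multiple of the squared length of that vector. Only real
  orthogonality enters, so that real subspaces are the natural setting.\<close>

lemma rayleigh_eigenvector:
  fixes E :: "(complex^'n) set"
  assumes H: "hermitian A" and E: "subspace E" and inv: "\<And>x. x \<in> E \<Longrightarrow> A *v x \<in> E"
    and z: "z \<in> E" "z \<noteq> 0"
  shows "\<exists>x\<in>E. \<exists>\<mu>. norm x = 1 \<and> A *v x = \<mu> *\<^sub>R x"
proof -
  have cl: "closed E" using E by (rule closed_subspace)
  have cp: "compact (sphere 0 1 \<inter> E)" using cl by (intro compact_Int_closed) auto
  have "(1 / norm z) *\<^sub>R z \<in> sphere 0 1 \<inter> E" using z E by (auto simp: subspace_scale)
  then have ne: "sphere 0 1 \<inter> E \<noteq> {}" by blast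
  have "continuous_on (sphere 0 1 \<inter> E) (\<lambda>x. x \<bullet> (A *v x))"
    by (intro continuous_intros)
  from continuous_attains_sup[OF cp ne this] obtain x where
    x: "norm x = 1" "x \<in> E" and mx: "\<And>y. y \<in> E \<Longrightarrow> norm y = 1 \<Longrightarrow> y \<bullet> (A *v y) \<le> x \<bullet> (A *v x)"
    by auto
  define \<mu> where "\<mu> = x \<bullet> (A *v x)"
  have le: "y \<bullet> (A *v y) \<le> \<mu> * (y \<bullet> y)" if "y \<in> E" for y
  proof (cases "y = 0")
    case False
    define u where "u = (1 / norm y) *\<^sub>R y"
    have "u \<in> E" "norm u = 1" using that E False by (auto simp: subspace_scale u_def)
    then have "u \<bullet> (A *v u) \<le> \<mu>" using mx \<mu>_def by simp
    moreover have "u \<bullet> (A *v u) = (y \<bullet> (A *v y)) / (norm y)^2"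
      by (simp add: u_def power2_eq_square)
    ultimately show ?thesis using False by (simp add: field_simps power2_norm_eq_inner)
  qed simp
  define w where "w = A *v x - \<mu> *\<^sub>R x"
  have wE: "w \<in> E" unfolding w_def using x inv E by (auto intro: subspace_diff subspace_scale)
  define C where "C = \<bar>\<mu> * (w \<bullet> w) - w \<bullet> (A *v w)\<bar> + 1"
  have C: "C > 0" by (simp add: C_def)
  have xx: "x \<bullet> x = 1" using x by (simp add: norm_eq_1)
  have ineq: "2 * t * (w \<bullet> w) \<le> t^2 * C" for t
  proof -
    have "x + t *\<^sub>R w \<in> E" using x wE E by (auto intro: subspace_add subspace_scale)
    from le[OF this]
    have "\<mu> + 2 * t * (w \<bullet> (A *v x)) + t^2 * (w \<bullet> (A *v w))
        \<le> \<mu> * (1 + 2 * t * (w \<bullet> x) + t^2 * (w \<bullet> w))"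
      using herm_inner[OF H, of x w] xx
      by (simp add: matrix_vector_right_distrib inner_add_left inner_add_right \<mu>_def
          inner_commute power2_eq_square algebra_simps)
    then have "2 * t * (w \<bullet> (A *v x) - \<mu> * (w \<bullet> x)) \<le> t^2 * (\<mu> * (w \<bullet> w) - w \<bullet> (A *v w))"
      by (simp add: algebra_simps)
    also have "\<dots> \<le> t^2 * C" unfolding C_def by (intro mult_left_mono) auto
    finally show ?thesis by (simp add: w_def inner_diff_right inner_diff_left)
  qed
  have "w \<bullet> w \<le> 0"
  proof (rule ccontr)
    assume "\<not> w \<bullet> w \<le> 0"
    then have p: "w \<bullet> w > 0" by linarith
    have "2 * (w \<bullet> w / C) * (w \<bullet> w) \<le> (w \<bullet> w / C)^2 * C" by (rule ineq)
    then have "2 * (w \<bullet> w)^2 \<le> (w \<bullet> w)^2" using C by (simp add: field_simps power2_eq_square)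
    then show False using p by simp
  qed
  then have "w = 0" using inner_gt_zero_iff[of w] by linarith
  then show ?thesis using x w_def by auto
qed

definition diag :: "('n \<Rightarrow> real) \<Rightarrow> complex^'n^'n" where
  "diag l = (\<chi> i j. if i = j then of_real (l i) else 0)"

lemma diag_mv: "diag l *v x = (\<chi> i. l i *\<^sub>R x $ i)"
  by (simp add: diag_def vec_eq_iff matrix_vector_mult_def scaleR_conv_of_real if_distrib[of "\<lambda>c. c * _"] cong: if_cong)

lemma adj_diag [simp]: "adj (diag l) = diag l"
  by (auto simp: vec_eq_iff diag_def)

lemma diag_mult: "diag a ** diag b = diag (\<lambda>i. a i * b i)"
  by (auto simp: matrix_eq diag_mv matrix_vector_mul_assoc[symmetric])

lemma mult_diag_nth: "(P ** diag l) $ i $ j = P $ i $ j * of_real (l j)"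
proof -
  have "P $ i $ k * (if k = j then c else 0) = (if k = j then P $ i $ j * c else 0)" for k and c :: complex
    by simp
  then show ?thesis by (simp add: matrix_matrix_mult_def diag_def cong: if_cong)
qed

lemma det_diag: "det (diag l) = (\<Prod>i\<in>UNIV. of_real (l i))"
  by (subst det_diagonal) (auto simp: diag_def)

lemma matrix_inv_works:
  fixes A :: "complex^'n^'n"
  assumes "invertible A"
  shows "A ** matrix_inv A = mat 1" "matrix_inv A ** A = mat 1"
  using someI_ex[OF assms[unfolded invertible_def]] unfolding matrix_inv_def by auto

lemma matrix_inv_eqI:
  fixes A :: "complex^'n^'n"
  assumes "A ** B = mat 1"
  shows "matrix_inv A = B" "invertible A"
proof -
  have B: "B ** A = mat 1" using assms matrix_left_right_inverse by blast
  then show i: "invertible A" using assms unfolding invertible_def by blast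
  have "matrix_inv A = matrix_inv A ** (A ** B)" by (simp add: assms)
  also have "\<dots> = B" by (simp add: matrix_mul_assoc matrix_inv_works[OF i])
  finally show "matrix_inv A = B" .
qed

lemma inj_invertible:
  fixes A :: "complex^'n^'n"
  assumes "\<And>x. A *v x = 0 \<Longrightarrow> x = 0"
  shows "invertible A"
  using assms matrix_left_invertible_ker[of A] invertible_left_inverse[of A] by blast

text \<open>The eigenvectors are found one index at a time. If an index outside K is left, the matrix whose rows are
  the conjugates of the vectors already found, and zero elsewhere, is singular; its kernel is a nonzero
  subspace that A leaves invariant.\<close>

lemma orthonormal_eigenvectors:
  fixes A :: "complex^'n^'n" and K :: "'n set"
  assumes H: "hermitian A"
  shows "\<exists>v l. (\<forall>i\<in>K. \<forall>j\<in>K. (\<Sum>k\<in>UNIV. v j $ k * cnj (v i $ k)) = (if i = j then 1 else 0)) \<and>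
           (\<forall>i\<in>K. A *v v i = (l i :: real) *\<^sub>R v i)"
  using finite[of K]
proof (induction K rule: finite_induct)
  case empty show ?case by simp
next
  case (insert k K)
  then obtain v l where on: "\<And>i j. i\<in>K \<Longrightarrow> j\<in>K \<Longrightarrow> (\<Sum>k\<in>UNIV. v j $ k * cnj (v i $ k)) = (if i = j then 1 else 0)"
    and ev: "\<And>i. i\<in>K \<Longrightarrow> A *v v i = (l i :: real) *\<^sub>R v i" by blast
  define M :: "complex^'n^'n" where "M = (\<chi> i j. if i \<in> K then cnj (v i $ j) else 0)"
  have "row k M = 0" using insert by (simp add: row_def M_def vec_eq_iff)
  then have "det M = 0" by (rule det_zero_row)
  then have "\<not> invertible M" by (simp add: invertible_det_nz)
  then obtain z where z: "M *v z = 0" "z \<noteq> 0" using inj_invertible by blast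
  define E where "E = {x. M *v x = 0}"
  have E_iff: "x \<in> E \<longleftrightarrow> (\<forall>i\<in>K. (\<Sum>k\<in>UNIV. x $ k * cnj (v i $ k)) = 0)" for x
  proof -
    have "M *v x = (\<chi> i. if i \<in> K then (\<Sum>k\<in>UNIV. x $ k * cnj (v i $ k)) else 0)"
      by (auto simp: vec_eq_iff M_def matrix_vector_mult_def mult.commute)
    then show ?thesis by (auto simp: E_def vec_eq_iff)
  qed
  have sub: "subspace E" unfolding E_def subspace_def by (simp add: matrix_vector_right_distrib)
  have inv: "A *v x \<in> E" if "x \<in> E" for x
  proof -
    have "(\<Sum>k\<in>UNIV. (A *v x) $ k * cnj (v i $ k)) = 0" if i: "i \<in> K" for i
    proof -
      have "(\<Sum>k\<in>UNIV. (A *v x) $ k * cnj (v i $ k)) = (\<Sum>k\<in>UNIV. \<Sum>j\<in>UNIV. A$k$j * x$j * cnj (v i $ k))"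
        by (simp add: matrix_vector_mult_def sum_distrib_right)
      also have "\<dots> = (\<Sum>j\<in>UNIV. \<Sum>k\<in>UNIV. A$k$j * x$j * cnj (v i $ k))" by (rule sum.swap)
      also have "\<dots> = (\<Sum>j\<in>UNIV. \<Sum>k\<in>UNIV. x$j * cnj (A$j$k * v i $ k))"
      proof -
        have "cnj (A$j$k) = A$k$j" for j k using H by (metis hermitian_def)
        then show ?thesis by (simp add: mult_ac)
      qed
      also have "\<dots> = (\<Sum>j\<in>UNIV. x$j * cnj ((A *v v i) $ j))"
        by (simp add: matrix_vector_mult_def sum_distrib_left)
      also have "\<dots> = l i * (\<Sum>j\<in>UNIV. x$j * cnj (v i $ j))"
        by (simp add: ev[OF i] scaleR_nth sum_distrib_left mult_ac del: vector_scaleR_component)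
      finally show ?thesis using \<open>x \<in> E\<close> i E_iff by simp
    qed
    then show ?thesis using E_iff by blast
  qed
  from rayleigh_eigenvector[OF H sub inv, of z] z obtain x \<mu> where
    x: "x \<in> E" "norm x = 1" "A *v x = \<mu> *\<^sub>R x" unfolding E_def by auto
  have x1: "(\<Sum>k\<in>UNIV. x $ k * cnj (x $ k)) = 1"
  proof -
    have "(\<Sum>k\<in>UNIV. x $ k * cnj (x $ k)) = of_real (\<Sum>k\<in>UNIV. (norm (x$k))^2)"
      by (simp only: of_real_sum complex_norm_square)
    also have "(\<Sum>k\<in>UNIV. (norm (x$k))^2) = (norm x)^2"
      by (simp add: norm_vec_def L2_set_def sum_nonneg)
    finally show ?thesis using x by simp
  qed
  have x0: "(\<Sum>k\<in>UNIV. x $ k * cnj (v i $ k)) = 0" if "i \<in> K" for i using x E_iff that by blast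
  have x0': "(\<Sum>k\<in>UNIV. v i $ k * cnj (x $ k)) = 0" if "i \<in> K" for i
  proof -
    have "(\<Sum>k\<in>UNIV. v i $ k * cnj (x $ k)) = cnj (\<Sum>k\<in>UNIV. x $ k * cnj (v i $ k))"
      by (simp add: mult.commute)
    then show ?thesis by (simp add: x0[OF that])
  qed
  show ?case
    apply (rule exI[of _ "v(k := x)"], rule exI[of _ "l(k := \<mu>)"])
    using on ev x1 x0 x0' x(3) insert(2) by auto
qed

theorem spectral_theorem:
  fixes A :: "complex^'n^'n"
  assumes H: "hermitian A"
  shows "\<exists>P l. adj P ** P = mat 1 \<and> P ** adj P = mat 1 \<and> A = P ** diag l ** adj P"
proof -
  obtain v :: "'n \<Rightarrow> complex^'n" and l where on: "\<And>i j. (\<Sum>k\<in>UNIV. v j $ k * cnj (v i $ k)) = (if i = j then 1 else 0)"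
    and ev: "\<And>i. A *v v i = (l i :: real) *\<^sub>R v i" using orthonormal_eigenvectors[OF H, of UNIV] by auto
  define P :: "complex^'n^'n" where "P = (\<chi> i j. v j $ i)"
  have 1: "adj P ** P = mat 1"
    using on by (simp add: vec_eq_iff P_def matrix_matrix_mult_def mat_def mult.commute)
  then have 2: "P ** adj P = mat 1" using matrix_left_right_inverse by blast
  have "A ** P = P ** diag l"
  proof -
    have "(A ** P) $ i $ j = (P ** diag l) $ i $ j" for i j
    proof -
      have "(A ** P) $ i $ j = (A *v v j) $ i"
        by (simp add: P_def matrix_matrix_mult_def matrix_vector_mult_def)
      also have "\<dots> = (P ** diag l) $ i $ j"
        unfolding mult_diag_nth ev scaleR_nth by (simp add: P_def)
      finally show ?thesis .
    qed
    then show ?thesis by (simp add: vec_eq_iff)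
  qed
  then have "A = P ** diag l ** adj P" by (metis 2 matrix_mul_assoc matrix_mul_rid)
  then show ?thesis using 1 2 by blast
qed

lemma pos_def_herm: "pos_def A \<Longrightarrow> hermitian A" by (simp add: pos_def_def)
lemma pos_def_pos: "pos_def A \<Longrightarrow> x \<noteq> 0 \<Longrightarrow> 0 < x \<bullet> (A *v x)" by (simp add: pos_def_def)
lemma pos_def_nonneg: "pos_def A \<Longrightarrow> 0 \<le> x \<bullet> (A *v x)"
  by (cases "x = 0") (auto dest: pos_def_pos[of A x])
lemma pos_def_inner: "pos_def A \<Longrightarrow> (A *v x) \<bullet> y = x \<bullet> (A *v y)"
  by (simp add: pos_def_herm herm_inner)

lemma pos_def_invertible: "pos_def A \<Longrightarrow> invertible A"
  by (rule inj_invertible) (metis inner_zero_right less_irrefl pos_def_pos)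

lemma pos_def_inv_mv [simp]:
  assumes "pos_def A" shows "A *v (matrix_inv A *v x) = x" "matrix_inv A *v (A *v x) = x"
  using matrix_inv_works[OF pos_def_invertible[OF assms]] by (simp_all add: matrix_vector_mul_assoc)

lemma pos_def_matrix_inv:
  assumes A: "pos_def A" shows "pos_def (matrix_inv A)"
proof -
  note w = matrix_inv_works[OF pos_def_invertible[OF A]]
  have "adj (matrix_inv A) ** A = adj (A ** matrix_inv A)"
    using pos_def_herm[OF A] by (simp add: adj_mult hermitian_adj)
  also have "\<dots> = mat 1" by (auto simp: w vec_eq_iff mat_def)
  finally have "adj (matrix_inv A) ** A ** matrix_inv A = matrix_inv A" by simp
  then have h: "hermitian (matrix_inv A)" by (simp add: w matrix_mul_assoc[symmetric] hermitian_adj)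
  have "0 < v \<bullet> (matrix_inv A *v v)" if "v \<noteq> 0" for v
  proof -
    have "matrix_inv A *v v \<noteq> 0" using that pos_def_inv_mv(1)[OF A, of v] by auto
    from pos_def_pos[OF A this] show ?thesis using A by (simp add: inner_commute)
  qed
  then show ?thesis using h by (simp add: pos_def_def)
qed

lemma matrix_inv_inv: "pos_def A \<Longrightarrow> matrix_inv (matrix_inv A) = A"
  by (rule matrix_inv_eqI) (simp add: matrix_inv_works pos_def_invertible)

text \<open>Existence comes from the spectral theorem. A second root R agrees with it on each eigenvector v: the vector
  u = R v - sqrt l v satisfies R u = - sqrt l u, which is impossible for a semidefinite R unless u = 0.\<close>

lemma msqrt_works:
  fixes A :: "complex^'n^'n"
  assumes A: "pos_def A"
  shows "pos_semidef (msqrt A)" "msqrt A ** msqrt A = A"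
proof -
  obtain P l where P: "adj P ** P = mat 1" "P ** adj P = mat 1" and Al: "A = P ** diag l ** adj P"
    using spectral_theorem[OF pos_def_herm[OF A]] by blast
  define v where "v = (\<lambda>i. P *v axis i 1)"
  have aP: "adj P *v (P *v x) = x" for x by (simp add: matrix_vector_mul_assoc P)
  have Pa: "P *v (adj P *v x) = x" for x by (simp add: matrix_vector_mul_assoc P)
  have dax: "diag m *v axis i 1 = m i *\<^sub>R axis i 1" for m i
    by (auto simp: diag_mv vec_eq_iff axis_def)
  have Av: "A *v v i = l i *\<^sub>R v i" for i
    by (simp add: v_def Al matrix_vector_mul_assoc[symmetric] aP dax)
  have v0: "v i \<noteq> 0" for i
  proof
    assume "v i = 0" then have "adj P *v v i = 0" by simp
    then show False by (simp add: v_def aP axis_eq_0_iff)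
  qed
  have lpos: "l i > 0" for i
  proof -
    have "0 < v i \<bullet> (l i *\<^sub>R v i)" using pos_def_pos[OF A v0[of i]] by (simp add: Av)
    then show ?thesis using inner_ge_zero[of "v i"]
      by (auto simp: zero_less_mult_iff)
  qed
  define S where "S = P ** diag (\<lambda>i. sqrt (l i)) ** adj P"
  have SS: "S ** S = A"
  proof -
    have "S ** S = P ** (diag (\<lambda>i. sqrt (l i)) ** (adj P ** P) ** diag (\<lambda>i. sqrt (l i))) ** adj P"
      unfolding S_def by (simp only: matrix_mul_assoc)
    also have "\<dots> = A" using lpos by (simp add: P diag_mult Al less_imp_le)
    finally show ?thesis .
  qed
  have Sh: "hermitian S" unfolding S_def hermitian_adj by (simp add: adj_mult matrix_mul_assoc)
  have Sp: "pos_semidef S"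
  proof -
    have "0 \<le> x \<bullet> (S *v x)" for x
    proof -
      have "x \<bullet> (S *v x) = (adj P *v x) \<bullet> (diag (\<lambda>i. sqrt (l i)) *v (adj P *v x))"
        unfolding S_def by (simp add: adj_inner matrix_vector_mul_assoc matrix_mul_assoc)
      also have "\<dots> \<ge> 0" using lpos by (simp add: diag_mv inner_vec_def sum_nonneg less_imp_le)
      finally show ?thesis by simp
    qed
    then show ?thesis using Sh by (simp add: pos_semidef_def)
  qed
  have uniq: "R = S" if R: "pos_semidef R" "R ** R = A" for R
  proof -
    have Rv: "R *v v i = sqrt (l i) *\<^sub>R v i" for i
    proof -
      define u where "u = R *v v i - sqrt (l i) *\<^sub>R v i"
      have "R *v (R *v v i) = l i *\<^sub>R v i" using Av R(2) by (simp add: matrix_vector_mul_assoc)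
      then have "R *v u = - sqrt (l i) *\<^sub>R u" using lpos[of i]
        by (simp add: u_def matrix_vector_mult_diff_distrib algebra_simps less_imp_le)
      moreover have "0 \<le> u \<bullet> (R *v u)" using R by (simp add: pos_semidef_def)
      ultimately have "sqrt (l i) * (u \<bullet> u) \<le> 0" by simp
      then have "u = 0" using lpos[of i]
        by (metis inner_gt_zero_iff mult_pos_pos not_le real_sqrt_gt_zero)
      then show ?thesis by (simp add: u_def)
    qed
    have Sv: "S *v v i = sqrt (l i) *\<^sub>R v i" for i
      by (simp add: v_def S_def matrix_vector_mul_assoc[symmetric] aP dax)
    have "(R ** P) *v axis i 1 = (S ** P) *v axis i 1" for i
      using Rv[of i] Sv[of i] by (simp add: v_def matrix_vector_mul_assoc)
    then have "(R ** P) $ k $ i = (S ** P) $ k $ i" for i k unfolding mv_axis_nth[symmetric] by simp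
    then have "R ** P = S ** P" by (simp add: vec_eq_iff)
    then have "R ** P ** adj P = S ** P ** adj P" by simp
    then show ?thesis by (simp add: P matrix_mul_assoc[symmetric])
  qed
  have "msqrt A = S" unfolding msqrt_def by (rule the_equality) (use Sp SS uniq in blast)+
  then show "pos_semidef (msqrt A)" "msqrt A ** msqrt A = A" using Sp SS by auto
qed

lemma adj_msqrt: "pos_def A \<Longrightarrow> adj (msqrt A) = msqrt A"
  using msqrt_works[of A] by (simp add: pos_semidef_def hermitian_adj)

lemma norm_msqrt: "pos_def A \<Longrightarrow> (norm (msqrt A *v x))^2 = x \<bullet> (A *v x)"
  by (simp add: power2_norm_eq_inner adj_inner adj_msqrt matrix_vector_mul_assoc msqrt_works)

lemma invertible_msqrt:
  assumes "pos_def A" shows "invertible (msqrt A)"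
proof (rule inj_invertible)
  fix x assume "msqrt A *v x = 0"
  then have "x \<bullet> (A *v x) = 0" using norm_msqrt[OF assms, of x] by simp
  then show "x = 0" using pos_def_pos[OF assms, of x] by auto
qed

text \<open>Conjugation by the inverse square root of W turns W into the identity; the spectral theorem then
  diagonalizes the transformed V.\<close>

lemma simultaneous_diagonalization:
  fixes W V :: "complex^'n^'n"
  assumes W: "pos_def W" and V: "hermitian V"
  shows "\<exists>R l. invertible R \<and> W = adj R ** R \<and> V = adj R ** diag l ** R"
proof -
  define S where "S = msqrt W"
  define T where "T = matrix_inv S"
  note Si = invertible_msqrt[OF W, folded S_def]
  have ST: "S ** T = mat 1" "T ** S = mat 1" unfolding T_def using matrix_inv_works[OF Si] by auto
  have aS: "adj S = S" by (simp add: S_def adj_msqrt W)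
  have a1: "adj (mat 1) = (mat 1 :: complex^'n^'n)" by (auto simp: vec_eq_iff mat_def)
  have "adj T ** S = mat 1" using arg_cong[OF ST(1), of adj] by (simp add: adj_mult aS a1)
  then have aT: "adj T = T" by (metis ST(1) matrix_mul_assoc matrix_mul_lid matrix_mul_rid)
  have "hermitian (T ** V ** T)" using V by (simp add: hermitian_adj adj_mult aT matrix_mul_assoc)
  from spectral_theorem[OF this] obtain P l where
    P: "adj P ** P = mat 1" "P ** adj P = mat 1" "T ** V ** T = P ** diag l ** adj P" by blast
  define R where "R = adj P ** S"
  have "adj R ** R = S ** (P ** adj P) ** S" by (simp add: R_def adj_mult aS matrix_mul_assoc)
  also have "\<dots> = W" by (simp add: P S_def msqrt_works W)
  finally have 1: "W = adj R ** R" ..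
  have "adj R ** diag l ** R = S ** (P ** diag l ** adj P) ** S"
    by (simp add: R_def adj_mult aS matrix_mul_assoc)
  also have "\<dots> = (S ** T) ** V ** (T ** S)" by (simp only: P(3)[symmetric] matrix_mul_assoc)
  also have "\<dots> = V" by (simp add: ST)
  finally have 2: "V = adj R ** diag l ** R" ..
  have "R ** (T ** P) = adj P ** (S ** T) ** P" by (simp add: R_def matrix_mul_assoc)
  then have "R ** (T ** P) = mat 1" by (simp add: ST P)
  then have "invertible R" by (rule matrix_inv_eqI)
  then show ?thesis using 1 2 by blast
qed

section \<open>Quadratic forms and the Bregman divergence of the log-determinant\<close>

definition quad :: "complex^'n^'n \<Rightarrow> complex^'n \<Rightarrow> real" where
  "quad A x = x \<bullet> (A *v x)"

lemma quad_nonneg: "pos_def A \<Longrightarrow> 0 \<le> quad A x"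
  by (simp add: quad_def pos_def_nonneg)

lemma quad_pos: "pos_def A \<Longrightarrow> x \<noteq> 0 \<Longrightarrow> 0 < quad A x"
  by (simp add: quad_def pos_def_pos)

lemma quad_add: "quad (A + B) x = quad A x + quad B x"
  by (simp add: quad_def matrix_vector_mult_add_rdistrib inner_add_right)

lemma quad_scaleR: "quad (r *\<^sub>R A) x = r * quad A x"
  by (simp add: quad_def)

lemma quad_sum: "quad (\<Sum>i\<in>S. f i) x = (\<Sum>i\<in>S. quad (f i) x)"
  by (simp add: quad_def sum_mv inner_sum_right)

lemma quad_zero [simp]: "quad A 0 = 0"
  by (simp add: quad_def)

lemma quad_mult_scaleR: "quad A (r *\<^sub>R x) = r^2 * quad A x"
  by (simp add: quad_def power2_eq_square)

lemma quad_minus: "quad M (- x) = quad M x"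
  using quad_mult_scaleR[of M "-1" x] by simp

lemma quad_inv_self:
  assumes "pos_def P"
  shows "quad P (matrix_inv P *v x) = quad (matrix_inv P) x"
  using assms by (simp add: quad_def inner_commute)

lemma quad_inv_mv:
  assumes "pos_def P"
  shows "quad (matrix_inv P) (P *v x) = quad P x"
  using assms by (simp add: quad_def inner_commute)

text \<open>The inverse form is the supremum of 2 <x,y> - <P y,y> over all y, attained at y = P^{-1} x. Joint convexity
  of <P^{-1} x,x> in P and x is immediate from this, since for fixed y the expression is linear in P and x.\<close>

lemma quad_inv_ge:
  assumes P: "pos_def P"
  shows "2 * (x \<bullet> y) - quad P y \<le> quad (matrix_inv P) x"
proof -
  note Pi = pos_def_matrix_inv[OF P]
  have "0 \<le> quad (matrix_inv P) (x - P *v y)" by (rule quad_nonneg[OF Pi])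
  also have "\<dots> = quad (matrix_inv P) x - 2 * (x \<bullet> y) + quad P y"
    using P pos_def_inner[OF Pi, of x "P *v y"] pos_def_inner[OF P, of y "matrix_inv P *v x"]
    by (simp add: quad_def matrix_vector_mult_diff_distrib inner_diff_left inner_diff_right inner_commute)
  finally show ?thesis by simp
qed

lemma quad_inv_antimono:
  assumes P: "pos_def P" and P': "pos_def P'" and K: "K > 0" and le: "\<And>z. quad P z \<le> K * quad P' z"
  shows "quad (matrix_inv P') x \<le> K * quad (matrix_inv P) x"
proof -
  define y where "y = matrix_inv P' *v x"
  have xy: "x \<bullet> y = quad (matrix_inv P') x" by (simp add: y_def quad_def)
  have q: "quad P' y = quad (matrix_inv P') x" unfolding y_def by (rule quad_inv_self[OF P'])
  have "2 * (x \<bullet> ((1/K) *\<^sub>R y)) - quad P ((1/K) *\<^sub>R y) \<le> quad (matrix_inv P) x"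
    by (rule quad_inv_ge[OF P])
  moreover have "quad P y \<le> K * quad P' y" by (rule le)
  then have "quad P ((1/K) *\<^sub>R y) \<le> quad (matrix_inv P') x / K"
    using K by (simp add: quad_mult_scaleR q power2_eq_square field_simps)
  ultimately have "quad (matrix_inv P') x / K \<le> quad (matrix_inv P) x" using K by (simp add: xy)
  then show ?thesis using K by (simp add: field_simps)
qed

text \<open>That is, (P + N) P^{-1} (P + N) \<le> 4 P whenever 0 \<le> N \<le> P. The forms need not commute; the cross term
  N P^{-1} N is bounded by P through the Cauchy-Schwarz inequality for N.\<close>

lemma quad_inv_perturb:
  assumes P: "pos_def P" and N: "hermitian N" and N0: "\<And>z. 0 \<le> quad N z" and N1: "\<And>z. quad N z \<le> quad P z"
  shows "quad (matrix_inv P) ((P + N) *v y) \<le> 4 * quad P y"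
proof -
  define u where "u = matrix_inv P *v (N *v y)"
  have Pu: "P *v u = N *v y" using P by (simp add: u_def)
  define t where "t = u \<bullet> (N *v y)"
  have t: "quad P u = t" by (simp add: quad_def Pu t_def)
  have "0 \<le> quad N (u - y)" by (rule N0)
  also have "\<dots> = quad N u - 2 * t + quad N y"
    using herm_inner[OF N, of u y] herm_inner[OF N, of y u]
    by (simp add: quad_def t_def matrix_vector_mult_diff_distrib inner_diff_left inner_diff_right inner_commute)
  finally have "2 * t \<le> t + quad P y" using N1[of u] N1[of y] t by linarith
  moreover have "(P + N) *v y = P *v (y + u)"
    by (simp add: matrix_vector_mult_add_rdistrib matrix_vector_right_distrib Pu)
  then have "quad (matrix_inv P) ((P + N) *v y) = quad P (y + u)" by (simp add: quad_inv_mv[OF P])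
  moreover have "quad P (y + u) = quad P y + 2 * quad N y + t"
    using pos_def_inner[OF P, of u y] t
    by (simp add: quad_def matrix_vector_right_distrib inner_add_left inner_add_right Pu inner_commute)
  ultimately show ?thesis using N1[of y] by linarith
qed

lemma amgm3: fixes a b :: real assumes "a > 0" "b > 0" shows "3 - a - b \<le> 1 / (a * b)"
proof -
  define s where "s = a + b"
  have s: "s > 0" using assms by (simp add: s_def)
  have ab: "4 * (a * b) \<le> s^2" using zero_le_power2[of "a - b"] by (simp add: s_def power2_eq_square algebra_simps)
  have "0 \<le> (s - 2)^2 * (s + 1)" using s by simp
  also have "\<dots> = 4 - (3 - s) * s^2" by (simp add: power2_eq_square algebra_simps)
  finally have "3 - s \<le> 4 / s^2" using s by (simp add: field_simps)
  also have "\<dots> \<le> 4 / (4 * (a * b))" using ab assms s by (intro divide_left_mono) auto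
  finally show ?thesis by (simp add: s_def)
qed

text \<open>The function <R^{-1} v,v> / b is jointly convex in R and b. With y = R0^{-1} v and q = <R0^{-1} v,v> the
  left hand side is its tangent plane at (R0, b').\<close>

lemma quad_inv_over_tangent:
  assumes R: "pos_def R" and q0: "v \<bullet> y = q" "q > 0" and b: "b > 0" "b' > 0"
  shows "q / b' * (3 - quad R y / q - b / b') \<le> quad (matrix_inv R) v / b"
proof -
  have "y \<noteq> 0" using q0 by auto
  then have r: "quad R y > 0" by (rule quad_pos[OF R])
  have "2 * (v \<bullet> ((q / quad R y) *\<^sub>R y)) - quad R ((q / quad R y) *\<^sub>R y) \<le> quad (matrix_inv R) v"
    by (rule quad_inv_ge[OF R])
  then have 1: "q * q / quad R y \<le> quad (matrix_inv R) v"
    using r by (simp add: quad_mult_scaleR q0 power2_eq_square)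
  have "q / b' * (3 - quad R y / q - b / b') \<le> q / b' * (1 / (quad R y / q * (b / b')))"
    using r q0 b by (intro mult_left_mono amgm3) auto
  also have "\<dots> = (q * q / quad R y) / b" using r q0 b by (simp add: field_simps)
  also have "\<dots> \<le> quad (matrix_inv R) v / b" using 1 b by (intro divide_right_mono) auto
  finally show ?thesis .
qed

lemma quad_add_le: "pos_def M \<Longrightarrow> quad M (x + y) \<le> 2 * quad M x + 2 * quad M y"
proof -
  assume M: "pos_def M"
  have "0 \<le> quad M (x - y)" by (rule quad_nonneg[OF M])
  then show ?thesis using pos_def_inner[OF M, of x y]
    by (simp add: quad_def matrix_vector_mult_diff_distrib matrix_vector_right_distrib
        inner_add_left inner_add_right inner_diff_left inner_diff_right inner_commute)
qed

text \<open>The Cauchy-Schwarz inequality, applied in the Hilbert norm of the form M.\<close>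

lemma quad_sum_le:
  assumes M: "pos_def M" and m: "\<And>c. c \<in> S \<Longrightarrow> 0 \<le> m c" and e: "(\<Sum>c\<in>S. (e c)^2 * m c) \<le> 1"
  shows "quad M (\<Sum>c\<in>S. (e c * m c) *\<^sub>R a c) \<le> (\<Sum>c\<in>S. m c * quad M (a c))"
proof -
  define n where "n = (\<lambda>x. norm (msqrt M *v x))"
  have q: "quad M x = (n x)^2" for x by (simp add: quad_def n_def norm_msqrt[OF M])
  have "n (\<Sum>c\<in>S. (e c * m c) *\<^sub>R a c) \<le> (\<Sum>c\<in>S. \<bar>e c * m c\<bar> * n (a c))"
    unfolding n_def linear_sum[OF matrix_vector_mul_linear]
    by (rule order_trans[OF norm_sum]) simp
  also have "\<dots> = (\<Sum>c\<in>S. (\<bar>e c\<bar> * sqrt (m c)) * (sqrt (m c) * n (a c)))"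
    using m by (intro sum.cong refl) (simp add: abs_mult)
  finally have "(n (\<Sum>c\<in>S. (e c * m c) *\<^sub>R a c))^2 \<le> (\<Sum>c\<in>S. (\<bar>e c\<bar> * sqrt (m c)) * (sqrt (m c) * n (a c)))^2"
    by (intro power_mono) (auto simp: n_def)
  also have "\<dots> \<le> (\<Sum>c\<in>S. (\<bar>e c\<bar> * sqrt (m c))^2) * (\<Sum>c\<in>S. (sqrt (m c) * n (a c))^2)"
    by (rule Cauchy_Schwarz_ineq_sum)
  also have "\<dots> = (\<Sum>c\<in>S. (e c)^2 * m c) * (\<Sum>c\<in>S. m c * quad M (a c))"
    using m by (simp add: power_mult_distrib q)
  also have "\<dots> \<le> 1 * (\<Sum>c\<in>S. m c * quad M (a c))"
    using e m by (intro mult_right_mono sum_nonneg mult_nonneg_nonneg) (auto simp: q)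
  finally show ?thesis by (simp add: q)
qed

definition ldet :: "complex^'n^'n \<Rightarrow> real" where
  "ldet A = ln (cmod (det A))"

lemma det_adj: "det (adj A) = cnj (det A)" for A :: "complex^'n^'n"
proof -
  have "adj A = transpose (\<chi> i j. cnj (A $ i $ j))" by (simp add: vec_eq_iff transpose_def)
  then have "det (adj A) = det (\<chi> i j. cnj (A $ i $ j))" by (simp add: det_transpose)
  also have "\<dots> = cnj (det A)" by (simp add: det_def)
  finally show ?thesis .
qed

lemma ldet_inv: "pos_def A \<Longrightarrow> ldet (matrix_inv A) = - ldet A"
proof -
  assume "pos_def A"
  then have i: "invertible A" by (rule pos_def_invertible)
  then have "det A * det (matrix_inv A) = 1" by (simp add: det_mul[symmetric] matrix_inv_works)
  then have "cmod (det A) * cmod (det (matrix_inv A)) = 1" by (metis norm_mult norm_one)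
  then have "cmod (det (matrix_inv A)) = inverse (cmod (det A))" by (metis inverse_unique)
  then show ?thesis by (simp add: ldet_def ln_inverse)
qed

lemma quad_adj_mult: "quad (adj R ** M ** R) z = quad M (R *v z)"
  by (simp add: quad_def matrix_vector_mul_assoc[symmetric] adj_inner)

lemma quad_diag: "quad (diag l) u = (\<Sum>i\<in>UNIV. l i * (cmod (u $ i))^2)"
  by (simp add: quad_def diag_mv inner_vec_def power2_norm_eq_inner)

text \<open>Two positive definite forms are diagonal in a common basis; all the functionals of a pair
  of forms that are compared below are read off from the eigenvalues of the second form relative
  to the first.\<close>

lemma relative_eigenvalues:
  fixes W V :: "complex^'n^'n"
  assumes W: "pos_def W" and V: "pos_def V"
  obtains R :: "complex^'n^'n" and l :: "'n \<Rightarrow> real" where "invertible R" "\<And>i. 0 < l i"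
    "\<And>z. quad W z = (\<Sum>i\<in>UNIV. (cmod ((R *v z) $ i))^2)"
    "\<And>z. quad V z = (\<Sum>i\<in>UNIV. l i * (cmod ((R *v z) $ i))^2)"
    "\<And>z. quad (matrix_inv W) ((V - W) *v z) = (\<Sum>i\<in>UNIV. (l i - 1)^2 * (cmod ((R *v z) $ i))^2)"
    "ldet V = ldet W + (\<Sum>i\<in>UNIV. ln (l i))"
    "Re (trace (matrix_inv W ** V)) = (\<Sum>i\<in>UNIV. l i)"
proof -
  obtain R l where R: "invertible R" and WR: "W = adj R ** R" and VR: "V = adj R ** diag l ** R"
    using simultaneous_diagonalization[OF W pos_def_herm[OF V]] by blast
  define T where "T = matrix_inv R"
  have RT: "R ** T = mat 1" "T ** R = mat 1" unfolding T_def using matrix_inv_works[OF R] by auto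
  have a1: "adj (mat 1) = (mat 1 :: complex^'n^'n)" by (auto simp: vec_eq_iff mat_def)
  have aRT: "adj R ** adj T = mat 1" "adj T ** adj R = mat 1" using RT by (simp_all add: adj_mult[symmetric] a1)
  have "W ** (T ** adj T) = adj R ** (R ** T) ** adj T" by (simp add: WR matrix_mul_assoc)
  then have Wi: "matrix_inv W = T ** adj T" by (intro matrix_inv_eqI) (simp add: RT aRT)
  have d1: "diag (\<lambda>i. 1) = mat 1" by (auto simp: vec_eq_iff diag_def mat_def)
  have qW: "quad W z = (\<Sum>i\<in>UNIV. (cmod ((R *v z) $ i))^2)" for z
    using quad_adj_mult[of R "diag (\<lambda>i. 1)" z] by (simp add: d1 WR quad_diag[of "\<lambda>_. 1", unfolded d1])
  have qV: "quad V z = (\<Sum>i\<in>UNIV. l i * (cmod ((R *v z) $ i))^2)" for z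
    by (simp add: VR quad_adj_mult quad_diag)
  have lpos: "0 < l i" for i
  proof -
    define z where "z = T *v axis i 1"
    have Rz: "R *v z = axis i 1" by (simp add: z_def matrix_vector_mul_assoc RT)
    then have "z \<noteq> 0" by auto
    then have "0 < quad V z" by (rule quad_pos[OF V])
    also have "quad V z = (\<Sum>j\<in>UNIV. if j = i then l i else 0)"
      unfolding qV Rz by (intro sum.cong refl) (auto simp: axis_def)
    finally show ?thesis by simp
  qed
  have qVW: "quad (matrix_inv W) ((V - W) *v z) = (\<Sum>i\<in>UNIV. (l i - 1)^2 * (cmod ((R *v z) $ i))^2)" for z
  proof -
    have "(V - W) *v z = adj R *v (diag l *v (R *v z) - R *v z)"
      by (simp add: VR WR matrix_vector_mult_diff_rdistrib matrix_vector_mult_diff_distrib matrix_vector_mul_assoc matrix_mul_assoc)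
    also have "diag l *v (R *v z) - R *v z = diag (\<lambda>i. l i - 1) *v (R *v z)"
      by (simp add: diag_mv vec_eq_iff algebra_simps)
    finally have e: "(V - W) *v z = adj R *v (diag (\<lambda>i. l i - 1) *v (R *v z))" .
    have "quad (matrix_inv W) (adj R *v x) = x \<bullet> x" for x
    proof -
      have "matrix_inv W *v (adj R *v x) = T *v x"
        by (simp add: Wi matrix_vector_mul_assoc matrix_mul_assoc[symmetric] aRT)
      then show ?thesis by (simp add: quad_def adj_inner matrix_vector_mul_assoc RT)
    qed
    then have "quad (matrix_inv W) ((V - W) *v z) = quad (mat 1) (diag (\<lambda>i. l i - 1) *v (R *v z))"
      by (simp add: e quad_def)
    also have "\<dots> = (\<Sum>i\<in>UNIV. (l i - 1)^2 * (cmod ((R *v z) $ i))^2)"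
      unfolding d1[symmetric] quad_diag by (simp add: diag_mv power_mult_distrib)
    finally show ?thesis .
  qed
  have dR: "det R \<noteq> 0" using R by (simp add: invertible_det_nz)
  have ld: "ldet V = ldet W + (\<Sum>i\<in>UNIV. ln (l i))"
  proof -
    have "cmod (det V) = cmod (det W) * (\<Prod>i\<in>UNIV. l i)"
      using lpos by (simp add: VR WR det_mul det_diag norm_mult prod_norm[symmetric] less_imp_le)
    moreover have W0: "cmod (det W) > 0" using dR by (simp add: WR det_mul det_adj norm_mult)
    moreover have "(\<Prod>i\<in>UNIV. l i) > 0" using lpos by (simp add: prod_pos)
    ultimately have "ldet V = ldet W + ln (\<Prod>i\<in>UNIV. l i)" unfolding ldet_def using W0 by (metis ln_mult_pos)
    also have "ln (\<Prod>i\<in>UNIV. l i) = (\<Sum>i\<in>UNIV. ln (l i))" by (rule ln_prod) (simp_all add: less_imp_neq[OF lpos, symmetric] lpos)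
    finally show ?thesis .
  qed
  have tr: "Re (trace (matrix_inv W ** V)) = (\<Sum>i\<in>UNIV. l i)"
  proof -
    have "matrix_inv W ** V = T ** (adj T ** adj R) ** diag l ** R" by (simp add: Wi VR matrix_mul_assoc)
    then have "trace (matrix_inv W ** V) = trace ((T ** diag l) ** R)" by (simp add: aRT)
    also have "\<dots> = trace (diag l)" by (subst trace_mul_sym) (simp add: matrix_mul_assoc RT)
    also have "\<dots> = of_real (\<Sum>i\<in>UNIV. l i)" by (simp add: trace_def diag_def)
    finally show ?thesis by simp
  qed
  show ?thesis by (rule that[OF R lpos qW qV qVW ld tr])
qed

text \<open>The elementary inequality ln x \<le> x - 1 applied to the square root already contains the
  quadratic gain that is needed.\<close>

lemma ln_le_quadratic:
  fixes x K :: real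
  assumes "0 < x" "x \<le> K"
  shows "(x - 1)^2 \<le> (sqrt K + 1)^2 * (x - 1 - ln x)"
proof -
  define s where "s = sqrt x"
  have s: "s > 0" "x = s^2" "s \<le> sqrt K" using assms by (auto simp: s_def)
  have "ln x = 2 * ln s" using s by (simp add: ln_realpow)
  also have "\<dots> \<le> 2 * (s - 1)" using s ln_le_minus_one[of s] by simp
  finally have "(s - 1)^2 \<le> x - 1 - ln x" using s(2) by (simp add: power2_eq_square algebra_simps)
  moreover have "(s + 1)^2 \<le> (sqrt K + 1)^2" using s by (intro power_mono) auto
  ultimately have "(s + 1)^2 * (s - 1)^2 \<le> (sqrt K + 1)^2 * (x - 1 - ln x)"
    by (intro mult_mono) auto
  moreover have "(x - 1)^2 = (s + 1)^2 * (s - 1)^2" by (simp add: s(2) power2_eq_square algebra_simps)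
  ultimately show ?thesis by simp
qed

text \<open>The Bregman divergence of the convex function - log det, evaluated at V with base point W.\<close>

definition bregman :: "complex^'n^'n \<Rightarrow> complex^'n^'n \<Rightarrow> real" where
  "bregman W V = ldet W - ldet V + Re (trace (matrix_inv W ** V)) - real CARD('n)"

text \<open>In terms of the eigenvalues l of V relative to W, the divergence is \<Sum> (l - 1 - ln l), while the form on the
  left is at most \<Sum> (l - 1)^2 times that of W. The bound K keeps the eigenvalues in the range where the
  first sum dominates the second.\<close>

lemma quad_diff_le_bregman:
  fixes W V :: "complex^'n^'n"
  assumes W: "pos_def W" and V: "pos_def V" and le: "\<And>z. quad V z \<le> K * quad W z"
  shows "quad (matrix_inv W) ((V - W) *v z) \<le> (sqrt K + 1)^2 * bregman W V * quad W z"
    and "0 \<le> bregman W V"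
proof -
  obtain R :: "complex^'n^'n" and l where R: "invertible R" and l: "\<And>i. 0 < l i"
    and qW: "\<And>z. quad W z = (\<Sum>i\<in>UNIV. (cmod ((R *v z) $ i))^2)"
    and qV: "\<And>z. quad V z = (\<Sum>i\<in>UNIV. l i * (cmod ((R *v z) $ i))^2)"
    and qVW: "\<And>z. quad (matrix_inv W) ((V - W) *v z) = (\<Sum>i\<in>UNIV. (l i - 1)^2 * (cmod ((R *v z) $ i))^2)"
    and ld: "ldet V = ldet W + (\<Sum>i\<in>UNIV. ln (l i))"
    and tr: "Re (trace (matrix_inv W ** V)) = (\<Sum>i\<in>UNIV. l i)"
    by (rule relative_eigenvalues[OF W V]) blast
  have b: "bregman W V = (\<Sum>i\<in>UNIV. l i - 1 - ln (l i))"
    by (simp add: bregman_def ld tr sum_subtractf)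
  have n: "0 \<le> l i - 1 - ln (l i)" for i using ln_le_minus_one[OF l[of i]] by simp
  show "0 \<le> bregman W V" unfolding b by (intro sum_nonneg n)
  have lK: "l i \<le> K" for i
  proof -
    define z where "z = matrix_inv R *v axis i 1"
    have Rz: "R *v z = axis i 1" by (simp add: z_def matrix_vector_mul_assoc matrix_inv_works[OF R])
    have "quad V z = (\<Sum>j\<in>UNIV. if j = i then l i else 0)"
      unfolding qV Rz by (intro sum.cong refl) (auto simp: axis_def)
    moreover have "quad W z = (\<Sum>j\<in>UNIV. if j = i then 1 else 0)"
      unfolding qW Rz by (intro sum.cong refl) (auto simp: axis_def)
    ultimately show ?thesis using le[of z] by simp
  qed
  have "(l i - 1)^2 \<le> (sqrt K + 1)^2 * bregman W V" for i
  proof -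
    have "(l i - 1)^2 \<le> (sqrt K + 1)^2 * (l i - 1 - ln (l i))" by (rule ln_le_quadratic[OF l lK])
    also have "\<dots> \<le> (sqrt K + 1)^2 * bregman W V"
      unfolding b by (intro mult_left_mono member_le_sum n) auto
    finally show ?thesis .
  qed
  then have "(\<Sum>i\<in>UNIV. (l i - 1)^2 * (cmod ((R *v z) $ i))^2) \<le> (\<Sum>i\<in>UNIV. ((sqrt K + 1)^2 * bregman W V) * (cmod ((R *v z) $ i))^2)"
    by (intro sum_mono mult_right_mono) auto
  then show "quad (matrix_inv W) ((V - W) *v z) \<le> (sqrt K + 1)^2 * bregman W V * quad W z"
    unfolding qVW qW by (simp add: sum_distrib_left)
qed

text \<open>The eigenvalues of U relative to W^{-1} are at least 1.\<close>

lemma ldet_inv_le: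
  fixes W U :: "complex^'n^'n"
  assumes W: "pos_def W" and U: "pos_def U" and le: "\<And>z. quad (matrix_inv W) z \<le> quad U z"
  shows "0 \<le> ldet W + ldet U" and "real CARD('n) \<le> Re (trace (W ** U))"
proof -
  obtain R :: "complex^'n^'n" and l where R: "invertible R" and l: "\<And>i. 0 < l i"
    and qW: "\<And>z. quad (matrix_inv W) z = (\<Sum>i\<in>UNIV. (cmod ((R *v z) $ i))^2)"
    and qV: "\<And>z. quad U z = (\<Sum>i\<in>UNIV. l i * (cmod ((R *v z) $ i))^2)"
    and ld: "ldet U = ldet (matrix_inv W) + (\<Sum>i\<in>UNIV. ln (l i))"
    and tr: "Re (trace (matrix_inv (matrix_inv W) ** U)) = (\<Sum>i\<in>UNIV. l i)"
    by (rule relative_eigenvalues[OF pos_def_matrix_inv[OF W] U]) blast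
  have l1: "1 \<le> l i" for i
  proof -
    define z where "z = matrix_inv R *v axis i 1"
    have Rz: "R *v z = axis i 1" by (simp add: z_def matrix_vector_mul_assoc matrix_inv_works[OF R])
    have "quad U z = (\<Sum>j\<in>UNIV. if j = i then l i else 0)"
      unfolding qV Rz by (intro sum.cong refl) (auto simp: axis_def)
    moreover have "quad (matrix_inv W) z = (\<Sum>j\<in>UNIV. if j = i then 1 else 0)"
      unfolding qW Rz by (intro sum.cong refl) (auto simp: axis_def)
    ultimately show ?thesis using le[of z] by simp
  qed
  show "0 \<le> ldet W + ldet U" using l1 by (simp add: ld ldet_inv[OF W] sum_nonneg)
  have "(\<Sum>i\<in>(UNIV::'n set). 1) \<le> (\<Sum>i\<in>UNIV. l i)" by (intro sum_mono l1)
  then show "real CARD('n) \<le> Re (trace (W ** U))" using tr by (simp add: matrix_inv_inv[OF W])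
qed

text \<open>The trace of W U is the sum of the eigenvalues of U relative to W^{-1}. Concavity of the logarithm bounds the
  sum of their logarithms, and each eigenvalue is at most the sum.\<close>

lemma trace_bounds:
  fixes W U :: "complex^'n^'n"
  assumes W: "pos_def W" and U: "pos_def U" and A: "A > 0" and le: "Re (trace (W ** U)) \<le> real CARD('n) * A"
  shows "ldet W + ldet U \<le> real CARD('n) * ln A"
    and "quad W z \<le> real CARD('n) * A * quad (matrix_inv U) z"
proof -
  obtain R :: "complex^'n^'n" and l where R: "invertible R" and l: "\<And>i. 0 < l i"
    and qW: "\<And>z. quad (matrix_inv W) z = (\<Sum>i\<in>UNIV. (cmod ((R *v z) $ i))^2)"
    and qV: "\<And>z. quad U z = (\<Sum>i\<in>UNIV. l i * (cmod ((R *v z) $ i))^2)"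
    and ld: "ldet U = ldet (matrix_inv W) + (\<Sum>i\<in>UNIV. ln (l i))"
    and tr: "Re (trace (matrix_inv (matrix_inv W) ** U)) = (\<Sum>i\<in>UNIV. l i)"
    by (rule relative_eigenvalues[OF pos_def_matrix_inv[OF W] U]) blast
  have s: "(\<Sum>i\<in>UNIV. l i) \<le> real CARD('n) * A" using le tr by (simp add: matrix_inv_inv[OF W])
  have "ldet W + ldet U = (\<Sum>i\<in>UNIV. ln (l i))" by (simp add: ld ldet_inv[OF W])
  also have "\<dots> \<le> (\<Sum>i\<in>UNIV. ln A + (l i / A - 1))"
  proof (intro sum_mono)
    fix i
    have "ln (l i / A) \<le> l i / A - 1" using l[of i] A by (intro ln_le_minus_one) auto
    then show "ln (l i) \<le> ln A + (l i / A - 1)" using l[of i] A by (simp add: ln_div)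
  qed
  also have "\<dots> = real CARD('n) * ln A + ((\<Sum>i\<in>UNIV. l i) / A - real CARD('n))"
    by (simp add: sum.distrib sum_subtractf sum_divide_distrib)
  also have "\<dots> \<le> real CARD('n) * ln A" using s A by (simp add: field_simps)
  finally show "ldet W + ldet U \<le> real CARD('n) * ln A" .
  have "quad U z \<le> (real CARD('n) * A) * quad (matrix_inv W) z" for z
  proof -
    have "l i \<le> real CARD('n) * A" for i
      by (rule order_trans[OF member_le_sum s]) (auto simp: less_imp_le[OF l])
    then show ?thesis unfolding qV qW sum_distrib_left by (intro sum_mono mult_right_mono) auto
  qed
  from quad_inv_antimono[OF U pos_def_matrix_inv[OF W] _ this, of z]
  show "quad W z \<le> real CARD('n) * A * quad (matrix_inv U) z"
    using A by (simp add: matrix_inv_inv[OF W])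
qed

section \<open>Bellman function arguments on a tree of cubes\<close>

text \<open>The dyadic structure in abstract form. All children have the same measure, so that a chain of descendants
  shrinks geometrically; this makes arguments about finitely many cubes terminate.\<close>

locale cube_tree =
  fixes D :: "'a set set" and ch :: "'a set \<Rightarrow> 'a set set" and m :: "'a set \<Rightarrow> real" and K :: real
  assumes K: "1 < K"
    and ch_finite: "I \<in> D \<Longrightarrow> finite (ch I)"
    and ch_D: "I \<in> D \<Longrightarrow> c \<in> ch I \<Longrightarrow> c \<in> D"
    and ch_sub: "I \<in> D \<Longrightarrow> c \<in> ch I \<Longrightarrow> c \<subseteq> I"
    and ch_m: "I \<in> D \<Longrightarrow> c \<in> ch I \<Longrightarrow> K * m c = m I"
    and m_pos: "I \<in> D \<Longrightarrow> 0 < m I"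
    and m_mono: "I \<in> D \<Longrightarrow> J \<in> D \<Longrightarrow> I \<subseteq> J \<Longrightarrow> m I \<le> m J"
    and m_sum: "I \<in> D \<Longrightarrow> (\<Sum>c\<in>ch I. m c) = m I"
    and ch_cover: "I \<in> D \<Longrightarrow> J \<in> D \<Longrightarrow> J \<subseteq> I \<Longrightarrow> J \<noteq> I \<Longrightarrow> \<exists>!c. c \<in> ch I \<and> J \<subseteq> c"
begin

definition below :: "'a set set \<Rightarrow> ('a set \<Rightarrow> 'b::comm_monoid_add) \<Rightarrow> 'a set \<Rightarrow> 'b" where
  "below F f I = (\<Sum>J\<in>{J\<in>F. J \<subseteq> I}. f J)"

lemma not_sub_child: "I \<in> D \<Longrightarrow> c \<in> ch I \<Longrightarrow> \<not> I \<subseteq> c"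
proof
  assume I: "I \<in> D" "c \<in> ch I" "I \<subseteq> c"
  then have "m I \<le> m c" using m_mono ch_D by blast
  moreover have "K * m c = m I" "m c > 0" using I ch_m m_pos ch_D by blast+
  moreover have "1 * m c < K * m c" using K \<open>m c > 0\<close> by (intro mult_strict_right_mono)
  ultimately show False by simp
qed

lemma below_rec:
  assumes F: "finite F" "F \<subseteq> D" and I: "I \<in> D"
  shows "below F f I = (if I \<in> F then f I else 0) + (\<Sum>c\<in>ch I. below F f c)"
proof -
  define T where "T = (\<Union>c\<in>ch I. {J\<in>F. J \<subseteq> c})"
  have T: "finite T" unfolding T_def using F ch_finite[OF I] by auto
  have nT: "I \<notin> T" using not_sub_child[OF I] by (auto simp: T_def)
  have e: "{J\<in>F. J \<subseteq> I} = (if I \<in> F then {I} else {}) \<union> T"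
  proof -
    have "J \<in> T" if J: "J \<in> F" "J \<subseteq> I" "J \<noteq> I" for J
    proof -
      have "J \<in> D" using J F by blast
      then obtain c where "c \<in> ch I" "J \<subseteq> c" using ch_cover[OF I _ J(2,3)] by blast
      then show ?thesis using J by (auto simp: T_def)
    qed
    moreover have "J \<in> F \<and> J \<subseteq> I" if "J \<in> T" for J using that ch_sub[OF I] by (fastforce simp: T_def)
    ultimately have "J \<in> {J\<in>F. J \<subseteq> I} \<longleftrightarrow> J \<in> (if I \<in> F then {I} else {}) \<union> T" for J
      by (cases "J = I") auto
    then show ?thesis by blast
  qed
  have "below F f I = (if I \<in> F then f I else 0) + sum f T"
    unfolding below_def e using T nT by auto
  moreover have "sum f T = (\<Sum>c\<in>ch I. \<Sum>J\<in>{J\<in>F. J \<subseteq> c}. f J)"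
    unfolding T_def
  proof (rule sum.UNION_disjoint)
    show "finite (ch I)" by (rule ch_finite[OF I])
    show "\<forall>c\<in>ch I. finite {J \<in> F. J \<subseteq> c}" using F by simp
    show "\<forall>c\<in>ch I. \<forall>c'\<in>ch I. c \<noteq> c' \<longrightarrow> {J \<in> F. J \<subseteq> c} \<inter> {J \<in> F. J \<subseteq> c'} = {}"
    proof (intro ballI impI, rule ccontr)
      fix c c' assume c: "c \<in> ch I" "c' \<in> ch I" "c \<noteq> c'" and "{J \<in> F. J \<subseteq> c} \<inter> {J \<in> F. J \<subseteq> c'} \<noteq> {}"
      then obtain J where J: "J \<in> F" "J \<subseteq> c" "J \<subseteq> c'" by blast
      have "J \<subseteq> I" "J \<noteq> I" using J c ch_sub[OF I] not_sub_child[OF I] by blast+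
      then show False using ch_cover[OF I, of J] J c F by blast
    qed
  qed
  ultimately show ?thesis by (simp add: below_def)
qed

lemma below_empty: "(\<And>J. J \<in> F \<Longrightarrow> \<not> J \<subseteq> I) \<Longrightarrow> below F f I = 0"
  unfolding below_def by (rule sum.neutral) blast

text \<open>Going down from a cube one leaves a finite family F after finitely many generations, because every generation
  divides the measure by K. The base case is therefore a cube without members of F below it.\<close>

lemma descend_induct [consumes 3]:
  assumes F: "finite F" "F \<subseteq> D" and I: "I \<in> D"
    and base: "\<And>I. I \<in> D \<Longrightarrow> (\<And>J. J \<in> F \<Longrightarrow> \<not> J \<subseteq> I) \<Longrightarrow> P I"
    and step: "\<And>I. I \<in> D \<Longrightarrow> (\<And>c. c \<in> ch I \<Longrightarrow> P c) \<Longrightarrow> P I"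
  shows "P I"
proof -
  define \<mu> where "\<mu> = Min (insert 1 (m ` F))"
  have \<mu>: "\<mu> > 0" "\<And>J. J \<in> F \<Longrightarrow> \<mu> \<le> m J" unfolding \<mu>_def using F m_pos by auto
  have "\<forall>I\<in>D. m I < \<mu> * K ^ N \<longrightarrow> P I" for N
  proof (induction N)
    case 0
    show ?case
    proof (intro ballI impI)
      fix I assume I: "I \<in> D" "m I < \<mu> * K ^ 0"
      show "P I"
      proof (rule base[OF I(1)])
        fix J assume "J \<in> F"
        then show "\<not> J \<subseteq> I" using m_mono[of J I] F I \<mu>(2)[of J] by auto
      qed
    qed
  next
    case (Suc N)
    show ?case
    proof (intro ballI impI)
      fix I assume I: "I \<in> D" "m I < \<mu> * K ^ Suc N"
      show "P I"
      proof (rule step[OF I(1)])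
        fix c assume c: "c \<in> ch I"
        have "K * m c < K * (\<mu> * K ^ N)" using ch_m[OF I(1) c] I by (simp add: mult_ac)
        then have "m c < \<mu> * K ^ N" using K by simp
        then show "P c" using Suc ch_D[OF I(1) c] by blast
      qed
    qed
  qed
  moreover obtain N where "m I / \<mu> < K ^ N" using real_arch_pow[OF K] by blast
  then have "m I < \<mu> * K ^ N" using \<mu> by (simp add: field_simps)
  ultimately show ?thesis using I by blast
qed

text \<open>The Bellman function principle: a quantity that increases by at least c_I from a cube to the sum over its
  children, and is dominated by an additive quantity, controls the sum of all c_J below a cube.\<close>

lemma telescope:
  fixes \<Phi> c \<mu> :: "'a set \<Rightarrow> real"
  assumes F: "finite F" "F \<subseteq> D" and I: "I \<in> D"
    and le: "\<And>I. I \<in> D \<Longrightarrow> \<Phi> I \<le> \<mu> I" and \<mu>: "\<And>I. I \<in> D \<Longrightarrow> (\<Sum>c\<in>ch I. \<mu> c) \<le> \<mu> I"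
    and step: "\<And>I. I \<in> D \<Longrightarrow> \<Phi> I + (if I \<in> F then c I else 0) \<le> (\<Sum>c\<in>ch I. \<Phi> c)"
  shows "\<Phi> I + below F c I \<le> \<mu> I"
  using F I
proof (induction I rule: descend_induct)
  case (1 I)
  then show ?case using le by (simp add: below_empty)
next
  case (2 I)
  have "\<Phi> I + below F c I \<le> (\<Sum>c\<in>ch I. \<Phi> c) + (\<Sum>d\<in>ch I. below F c d)"
    using step[OF 2(1)] below_rec[OF F 2(1), of c] by simp
  also have "\<dots> = (\<Sum>d\<in>ch I. \<Phi> d + below F c d)" by (simp add: sum.distrib)
  also have "\<dots> \<le> (\<Sum>d\<in>ch I. \<mu> d)" by (intro sum_mono 2)
  also have "\<dots> \<le> \<mu> I" by (rule \<mu>[OF 2(1)])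
  finally show ?case .
qed

lemma below_mono:
  fixes f g :: "'a set \<Rightarrow> real"
  shows "(\<And>J. J \<in> F \<Longrightarrow> f J \<le> g J) \<Longrightarrow> below F f I \<le> below F g I"
  unfolding below_def by (intro sum_mono) auto

lemma below_nonneg:
  fixes f :: "'a set \<Rightarrow> real"
  shows "(\<And>J. J \<in> F \<Longrightarrow> 0 \<le> f J) \<Longrightarrow> 0 \<le> below F f I"
  unfolding below_def by (intro sum_nonneg) auto

lemma below_cmult:
  fixes f :: "'a set \<Rightarrow> real"
  shows "below F (\<lambda>J. r * f J) I = r * below F f I"
  unfolding below_def by (rule sum_distrib_left[symmetric])

lemma below_add:
  fixes f :: "'a set \<Rightarrow> real"
  shows "below F (\<lambda>J. f J + g J) I = below F f I + below F g I"
  unfolding below_def by (rule sum.distrib)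

end

text \<open>The averages of a weight and of its inverse. The last two hypotheses say that U^{-1} \<le> W \<le> A U^{-1} on every
  cube; they are symmetric in W and U (lemma swap).\<close>

locale matrix_weight_tree = cube_tree D ch m K
  for D :: "'a set set" and ch m K +
  fixes W U :: "'a set \<Rightarrow> complex^'n^'n" and A :: real
  assumes A: "0 < A"
    and W_pos: "I \<in> D \<Longrightarrow> pos_def (W I)" and U_pos: "I \<in> D \<Longrightarrow> pos_def (U I)"
    and W_avg: "I \<in> D \<Longrightarrow> m I *\<^sub>R W I = (\<Sum>c\<in>ch I. m c *\<^sub>R W c)"
    and U_avg: "I \<in> D \<Longrightarrow> m I *\<^sub>R U I = (\<Sum>c\<in>ch I. m c *\<^sub>R U c)"
    and inv_U_le: "I \<in> D \<Longrightarrow> quad (matrix_inv (U I)) v \<le> quad (W I) v"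
    and W_le: "I \<in> D \<Longrightarrow> quad (W I) v \<le> A * quad (matrix_inv (U I)) v"
begin

lemma inv_W_le:
  assumes I: "I \<in> D" shows "quad (matrix_inv (W I)) v \<le> quad (U I) v"
  using quad_inv_antimono[OF pos_def_matrix_inv[OF U_pos[OF I]] W_pos[OF I], of 1 v] inv_U_le[OF I]
  by (simp add: matrix_inv_inv[OF U_pos[OF I]])

lemma swap: "matrix_weight_tree D ch m K U W A"
proof unfold_locales
  fix I v assume I: "I \<in> D"
  show "quad (U I) v \<le> A * quad (matrix_inv (W I)) v"
    using quad_inv_antimono[OF W_pos[OF I] pos_def_matrix_inv[OF U_pos[OF I]] A, of v] W_le[OF I]
    by (simp add: matrix_inv_inv[OF U_pos[OF I]])
qed (use A W_pos U_pos W_avg U_avg inv_W_le in auto)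

lemma quad_W_avg:
  assumes "I \<in> D" shows "m I * quad (W I) v = (\<Sum>c\<in>ch I. m c * quad (W c) v)"
  using arg_cong[OF W_avg[OF assms], of "\<lambda>M. quad M v"] by (simp add: quad_sum quad_scaleR)

lemma quad_U_avg:
  assumes "I \<in> D" shows "m I * quad (U I) v = (\<Sum>c\<in>ch I. m c * quad (U c) v)"
  using arg_cong[OF U_avg[OF assms], of "\<lambda>M. quad M v"] by (simp add: quad_sum quad_scaleR)

text \<open>The scalar weight obtained from W and a vector v satisfies the A2 condition, so <W_J v,v> may be replaced by
  <U_J^{-1} v,v> at the cost of the factor A. The Bellman function is <U_I^{-1} v,v> / (1 + M_I), where M_I is
  the normalized Carleson sum: convexity of the quotient turns the jump of M at I into a gain.\<close>

lemma carleson_weight: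
  assumes F: "finite F" "F \<subseteq> D" and I: "I \<in> D" and Q: "0 < Q"
    and l0: "\<And>J. J \<in> D \<Longrightarrow> 0 \<le> l J" and car: "\<And>J. J \<in> D \<Longrightarrow> below F l J \<le> Q * m J"
  shows "below F (\<lambda>J. l J * quad (W J) v) I \<le> 4 * A * Q * (m I * quad (W I) v)"
proof (cases "v = 0")
  case True then show ?thesis by (simp add: below_def)
next
  case v: False
  define q where "q I = quad (matrix_inv (U I)) v" for I
  define M where "M I = below F l I / (Q * m I)" for I
  define \<Phi> where "\<Phi> I = m I * (q I / (1 + M I))" for I
  have M: "0 \<le> M I" "M I \<le> 1" if "I \<in> D" for I
    using car[OF that] m_pos[OF that] Q l0 F by (auto simp: M_def field_simps intro!: below_nonneg divide_nonneg_pos)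
  have q: "0 < q I" if "I \<in> D" for I unfolding q_def
    by (rule quad_pos[OF pos_def_matrix_inv[OF U_pos[OF that]] v])
  have "\<Phi> I + below F (\<lambda>J. l J * q J / (4 * Q)) I \<le> m I * quad (W I) v"
  proof (rule telescope[OF F I])
    fix I assume I: "I \<in> D"
    have "q I / (1 + M I) \<le> q I" using M[OF I] q[OF I] by (simp add: field_simps)
    also have "\<dots> \<le> quad (W I) v" unfolding q_def by (rule inv_U_le[OF I])
    finally show "\<Phi> I \<le> m I * quad (W I) v"
      unfolding \<Phi>_def using m_pos[OF I] by (intro mult_left_mono) auto
    show "(\<Sum>c\<in>ch I. m c * quad (W c) v) \<le> m I * quad (W I) v" by (simp add: quad_W_avg[OF I])
    define lI where "lI = (if I \<in> F then l I else 0)"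
    have lI: "0 \<le> lI" using l0[OF I] by (simp add: lI_def)
    (* the base point of the tangent plane, the same for all children of I *)
    define y where "y = matrix_inv (U I) *v v"
    have vy: "v \<bullet> y = q I" by (simp add: y_def q_def quad_def)
    have qy: "quad (U I) y = q I" unfolding y_def q_def by (rule quad_inv_self[OF U_pos[OF I]])
    define b where "b = 1 + M I"
    have b: "1 \<le> b" "b \<le> 2" using M[OF I] by (auto simp: b_def)
    have rec: "Q * m I * M I = lI + (\<Sum>c\<in>ch I. Q * m c * M c)"
    proof -
      have "Q * m J * M J = below F l J" if "J \<in> D" for J
        using Q m_pos[OF that] by (simp add: M_def)
      then show ?thesis using below_rec[OF F I, of l] I ch_D[OF I] by (simp add: lI_def)
    qed
    have "\<Phi> I + lI * q I / (b^2 * Q) = q I / b * (3 * m I - m I - (m I * b - lI / Q) / b)"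
      using Q b by (simp add: \<Phi>_def b_def[symmetric] field_simps power2_eq_square)
    also have "m I * b - lI / Q = (\<Sum>c\<in>ch I. m c * (1 + M c))"
    proof -
      have "Q * (m I * b - lI / Q) = Q * (\<Sum>c\<in>ch I. m c * (1 + M c))"
      proof -
        have "Q * (m I * b - lI / Q) = Q * m I + (Q * m I * M I - lI)"
          using Q by (simp add: b_def field_simps)
        also have "\<dots> = Q * (\<Sum>c\<in>ch I. m c) + (\<Sum>c\<in>ch I. Q * m c * M c)"
          using rec m_sum[OF I] by simp
        also have "\<dots> = Q * (\<Sum>c\<in>ch I. m c * (1 + M c))"
          by (simp add: distrib_left sum.distrib sum_distrib_left mult_ac)
        finally show ?thesis .
      qed
      then show ?thesis using Q by simp
    qed
    also have "q I / b * (3 * m I - m I - (\<Sum>c\<in>ch I. m c * (1 + M c)) / b)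
       = (\<Sum>c\<in>ch I. m c * (q I / b * (3 - quad (U c) y / q I - (1 + M c) / b)))"
    proof -
      have "m I = (\<Sum>c\<in>ch I. m c * quad (U c) y) / q I"
        using quad_U_avg[OF I, of y] q[OF I] qy by (simp add: field_simps)
      then have "3 * m I - m I - (\<Sum>c\<in>ch I. m c * (1 + M c)) / b =
        3 * (\<Sum>c\<in>ch I. m c) - (\<Sum>c\<in>ch I. m c * quad (U c) y) / q I - (\<Sum>c\<in>ch I. m c * (1 + M c)) / b"
        using m_sum[OF I] by simp
      also have "\<dots> = (\<Sum>c\<in>ch I. m c * (3 - quad (U c) y / q I - (1 + M c) / b))"
        by (simp add: sum_distrib_left sum_divide_distrib sum_subtractf[symmetric] right_diff_distrib mult.commute)
      finally show ?thesis by (simp add: sum_distrib_left mult_ac)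
    qed
    also have "\<dots> \<le> (\<Sum>c\<in>ch I. \<Phi> c)"
    proof (rule sum_mono)
      fix c assume c: "c \<in> ch I"
      have cD: "c \<in> D" by (rule ch_D[OF I c])
      have "q I / b * (3 - quad (U c) y / q I - (1 + M c) / b) \<le> q c / (1 + M c)"
        unfolding q_def[of c]
        by (rule quad_inv_over_tangent[OF U_pos[OF cD] vy q[OF I]]) (use b M[OF cD] in auto)
      then show "m c * (q I / b * (3 - quad (U c) y / q I - (1 + M c) / b)) \<le> \<Phi> c"
        unfolding \<Phi>_def using m_pos[OF cD] by (intro mult_left_mono) auto
    qed
    finally have s: "\<Phi> I + lI * q I / (b^2 * Q) \<le> (\<Sum>c\<in>ch I. \<Phi> c)" .
    (* the denominator 1 + M_I never exceeds 2, whence the factor 4 *)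
    have "b^2 \<le> 2^2" using b by (intro power_mono) auto
    then have "lI * q I / (4 * Q) \<le> lI * q I / (b^2 * Q)"
      using b Q lI q[OF I] by (intro divide_left_mono mult_right_mono mult_nonneg_nonneg mult_pos_pos) auto
    then show "\<Phi> I + (if I \<in> F then l I * q I / (4 * Q) else 0) \<le> (\<Sum>c\<in>ch I. \<Phi> c)"
      using s by (simp add: lI_def split: if_splits)
  qed
  moreover have "0 \<le> \<Phi> I" using m_pos[OF I] q[OF I] M[OF I] by (simp add: \<Phi>_def)
  ultimately have 1: "below F (\<lambda>J. l J * q J / (4 * Q)) I \<le> m I * quad (W I) v" by simp
  have "below F (\<lambda>J. l J * quad (W J) v) I \<le> below F (\<lambda>J. (4 * A * Q) * (l J * q J / (4 * Q))) I"
  proof (rule below_mono)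
    fix J assume "J \<in> F"
    then have J: "J \<in> D" using F by blast
    have "l J * quad (W J) v \<le> l J * (A * q J)" unfolding q_def by (intro mult_left_mono W_le l0 J)
    then show "l J * quad (W J) v \<le> 4 * A * Q * (l J * q J / (4 * Q))" using Q by (simp add: mult_ac)
  qed
  also have "\<dots> \<le> (4 * A * Q) * (m I * quad (W I) v)"
    unfolding below_cmult using 1 A Q by (intro mult_left_mono) auto
  finally show ?thesis .
qed

text \<open>The Bellman function is <P_I^{-1} X_I, X_I> with P = W + N, where N is a small multiple of the Carleson sum of
  the weight and hence bounded by W. At the cube I the matrix P jumps by a multiple of l_I W_I; at
  y = P_I^{-1} X_I this gains a multiple of l_I <W_I y,y>, which is comparable to l_I <W_I^{-1} X_I, X_I>.\<close>

lemma carleson_embedding: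
  assumes F: "finite F" "F \<subseteq> D" and I: "I \<in> D" and Q: "0 < Q"
    and l0: "\<And>J. J \<in> D \<Longrightarrow> 0 \<le> l J" and car: "\<And>J. J \<in> D \<Longrightarrow> below F l J \<le> Q * m J"
    and X: "\<And>I. I \<in> D \<Longrightarrow> m I *\<^sub>R X I = (\<Sum>c\<in>ch I. m c *\<^sub>R X c)"
    and X_le: "\<And>I. I \<in> D \<Longrightarrow> m I * quad (matrix_inv (W I)) (X I) \<le> \<mu> I"
    and \<mu>: "\<And>I. I \<in> D \<Longrightarrow> (\<Sum>c\<in>ch I. \<mu> c) \<le> \<mu> I"
  shows "below F (\<lambda>J. l J * quad (matrix_inv (W J)) (X J)) I \<le> 16 * A * Q * \<mu> I"
proof -
  (* the scale at which carleson_weight gives N \<le> W *)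
  define k where "k = 4 * A * Q"
  have k: "0 < k" using A Q by (simp add: k_def)
  define N where "N I = (1 / (k * m I)) *\<^sub>R below F (\<lambda>J. l J *\<^sub>R W J) I" for I
  define P where "P I = W I + N I" for I
  have qN: "quad (N I) v = below F (\<lambda>J. l J * quad (W J) v) I / (k * m I)" for I v
    by (simp add: N_def below_def quad_sum quad_scaleR)
  have N0: "0 \<le> quad (N I) v" if "I \<in> D" for I v
    unfolding qN using k m_pos[OF that] F l0
    by (intro divide_nonneg_nonneg below_nonneg mult_nonneg_nonneg quad_nonneg W_pos) (auto intro: less_imp_le)
  have N1: "quad (N I) v \<le> quad (W I) v" if "I \<in> D" for I v
    using carleson_weight[OF F that Q l0 car, of v] k m_pos[OF that]
    unfolding qN k_def[symmetric] by (simp add: field_simps)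
  have Nh: "hermitian (N I)" for I
  proof -
    have "cnj (W J $ i $ j) = W J $ j $ i" if "J \<in> D" for J i j
      using pos_def_herm[OF W_pos[OF that]] by (metis hermitian_def)
    then have "adj (N I) = N I" using F
      by (auto simp: vec_eq_iff N_def below_def intro!: sum.cong)
    then show ?thesis by (simp add: hermitian_adj)
  qed
  have Pp: "pos_def (P I)" if "I \<in> D" for I
  proof -
    have "hermitian (P I)" using Nh[of I] pos_def_herm[OF W_pos[OF that]]
      by (auto simp: P_def hermitian_adj vec_eq_iff)
    moreover have "0 < v \<bullet> (P I *v v)" if "v \<noteq> 0" for v
      using quad_pos[OF W_pos[OF \<open>I \<in> D\<close>] that] N0[OF \<open>I \<in> D\<close>, of v]
      by (simp add: P_def quad_add[unfolded quad_def] quad_def)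
    ultimately show ?thesis by (simp add: pos_def_def)
  qed
  define \<Phi> where "\<Phi> I = m I * quad (matrix_inv (P I)) (X I)" for I
  define q where "q J = quad (matrix_inv (W J)) (X J)" for J
  have "\<Phi> I + below F (\<lambda>J. l J * q J / (4 * k)) I \<le> \<mu> I"
  proof (rule telescope[OF F I _ \<mu>])
    fix I assume I: "I \<in> D"
    have "quad (matrix_inv (P I)) (X I) \<le> 1 * quad (matrix_inv (W I)) (X I)"
      by (rule quad_inv_antimono[OF W_pos[OF I] Pp[OF I]]) (use N0[OF I] in \<open>auto simp: P_def quad_add\<close>)
    then have "\<Phi> I \<le> m I * quad (matrix_inv (W I)) (X I)"
      unfolding \<Phi>_def using m_pos[OF I] by (intro mult_left_mono) auto
    then show "\<Phi> I \<le> \<mu> I" using X_le[OF I] by simp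
    define lI where "lI = (if I \<in> F then l I else 0)"
    have lI: "0 \<le> lI" using l0[OF I] by (simp add: lI_def)
    (* the maximizer of the variational formula on I, used as a competitor on each child *)
    define y where "y = matrix_inv (P I) *v X I"
    have Xy: "X I \<bullet> y = quad (matrix_inv (P I)) (X I)" by (simp add: y_def quad_def)
    have Py: "quad (P I) y = quad (matrix_inv (P I)) (X I)" unfolding y_def by (rule quad_inv_self[OF Pp[OF I]])
    have "P I *v y = X I" using Pp[OF I] by (simp add: y_def)
    then have q4: "q I \<le> 4 * quad (W I) y"
      using quad_inv_perturb[OF W_pos[OF I] Nh N0[OF I] N1[OF I], of y] by (simp add: q_def P_def)
    have rec: "m I * quad (P I) y = lI * quad (W I) y / k + (\<Sum>c\<in>ch I. m c * quad (P c) y)"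
    proof -
      have e: "m J * quad (P J) y = m J * quad (W J) y + below F (\<lambda>J. l J * quad (W J) y) J / k" if "J \<in> D" for J
        using m_pos[OF that] k by (simp add: P_def quad_add qN field_simps)
      have "below F (\<lambda>J. l J * quad (W J) y) I = lI * quad (W I) y + (\<Sum>c\<in>ch I. below F (\<lambda>J. l J * quad (W J) y) c)"
        using below_rec[OF F I, of "\<lambda>J. l J * quad (W J) y"] by (simp add: lI_def)
      then show ?thesis using e[OF I] e[OF ch_D[OF I]] quad_W_avg[OF I, of y]
        by (simp add: sum.distrib sum_divide_distrib[symmetric] add_divide_distrib)
    qed
    have Xr: "m I * (X I \<bullet> y) = (\<Sum>c\<in>ch I. m c * (X c \<bullet> y))"
      using arg_cong[OF X[OF I], of "\<lambda>x. x \<bullet> y"] by (simp add: inner_sum_left)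
    have "\<Phi> I + lI * quad (W I) y / k = (\<Sum>c\<in>ch I. m c * (2 * (X c \<bullet> y) - quad (P c) y))"
    proof -
      have "\<Phi> I = 2 * (m I * (X I \<bullet> y)) - m I * quad (P I) y" by (simp add: \<Phi>_def Xy Py)
      also have "\<dots> = 2 * (\<Sum>c\<in>ch I. m c * (X c \<bullet> y)) - (lI * quad (W I) y / k + (\<Sum>c\<in>ch I. m c * quad (P c) y))"
        by (simp only: Xr rec)
      finally show ?thesis by (simp add: right_diff_distrib sum_subtractf sum_distrib_left mult_ac)
    qed
    also have "\<dots> \<le> (\<Sum>c\<in>ch I. \<Phi> c)"
      unfolding \<Phi>_def using m_pos[OF ch_D[OF I]]
      by (intro sum_mono mult_left_mono quad_inv_ge Pp ch_D[OF I]) (auto intro: less_imp_le)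
    finally have "\<Phi> I + lI * quad (W I) y / k \<le> (\<Sum>c\<in>ch I. \<Phi> c)" .
    moreover have "lI * (q I / 4) \<le> lI * quad (W I) y" using q4 lI by (intro mult_left_mono) auto
    then have "lI * (q I / 4) / k \<le> lI * quad (W I) y / k" using k by (intro divide_right_mono) auto
    then have "lI * q I / (4 * k) \<le> lI * quad (W I) y / k" by simp
    ultimately show "\<Phi> I + (if I \<in> F then l I * q I / (4 * k) else 0) \<le> (\<Sum>c\<in>ch I. \<Phi> c)"
      by (simp add: lI_def split: if_splits)
  qed
  moreover have "0 \<le> \<Phi> I"
    using m_pos[OF I] quad_nonneg[OF pos_def_matrix_inv[OF Pp[OF I]]] by (simp add: \<Phi>_def)
  ultimately have 1: "below F (\<lambda>J. l J * q J / (4 * k)) I \<le> \<mu> I" by simp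
  have "below F (\<lambda>J. l J * q J) I = below F (\<lambda>J. (4 * k) * (l J * q J / (4 * k))) I" using k by simp
  also have "\<dots> \<le> (4 * k) * \<mu> I" unfolding below_cmult using 1 k by (intro mult_left_mono) auto
  finally show ?thesis by (simp add: q_def k_def)
qed

text \<open>Up to the normalizing constant, the drop of log det from a cube to its children.\<close>

definition det_gain :: "'a set \<Rightarrow> real" where
  "det_gain I = (sqrt K + 1)^2 * (m I * ldet (W I) - (\<Sum>c\<in>ch I. m c * ldet (W c)))"

lemma W_child_le:
  assumes I: "I \<in> D" and c: "c \<in> ch I" shows "quad (W c) z \<le> K * quad (W I) z"
proof -
  have nonneg: "0 \<le> m d * quad (W d) z" if "d \<in> ch I" for d
    using m_pos[OF ch_D[OF I that]] quad_nonneg[OF W_pos[OF ch_D[OF I that]], of z] by simp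
  have "m c * quad (W c) z \<le> (\<Sum>c\<in>ch I. m c * quad (W c) z)"
    by (rule member_le_sum[OF c _ ch_finite[OF I]]) (use nonneg in blast)
  also have "\<dots> = (K * m c) * quad (W I) z" unfolding ch_m[OF I c] by (rule quad_W_avg[OF I, symmetric])
  also have "\<dots> = m c * (K * quad (W I) z)" by (simp only: mult_ac)
  finally show ?thesis using m_pos[OF ch_D[OF I c]] by simp
qed

lemma trace_W_avg:
  assumes I: "I \<in> D"
  shows "(\<Sum>c\<in>ch I. m c * Re (trace (matrix_inv (W I) ** W c))) = m I * real CARD('n)"
proof -
  define M where "M = matrix_inv (W I)"
  have lin: "Re (trace (M ** (r *\<^sub>R V))) = r * Re (trace (M ** V))" for r V
    by (simp add: trace_def matrix_matrix_mult_def sum_distrib_left scaleR_sum_right)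
  have lin2: "Re (trace (M ** (\<Sum>c\<in>S. f c))) = (\<Sum>c\<in>S. Re (trace (M ** f c)))" for S :: "'a set set" and f
  proof (induction S rule: infinite_finite_induct)
    case (insert x F)
    then show ?case by (simp add: matrix_add_ldistrib trace_add)
  qed (simp_all add: trace_def matrix_matrix_mult_def)
  have "m I * real CARD('n) = Re (trace (M ** (m I *\<^sub>R W I)))"
    unfolding lin by (simp add: M_def matrix_inv_works pos_def_invertible W_pos I trace_I)
  also have "\<dots> = (\<Sum>c\<in>ch I. m c * Re (trace (M ** W c)))" by (simp only: W_avg[OF I] lin lin2)
  finally show ?thesis by (simp add: M_def)
qed

lemma det_gain_eq:
  assumes I: "I \<in> D"
  shows "det_gain I = (\<Sum>c\<in>ch I. m c * ((sqrt K + 1)^2 * bregman (W I) (W c)))"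
proof -
  have "(\<Sum>c\<in>ch I. m c * bregman (W I) (W c)) =
     (\<Sum>c\<in>ch I. m c) * ldet (W I) - (\<Sum>c\<in>ch I. m c * ldet (W c)) +
     (\<Sum>c\<in>ch I. m c * Re (trace (matrix_inv (W I) ** W c))) - (\<Sum>c\<in>ch I. m c) * real CARD('n)"
    by (simp add: bregman_def sum.distrib sum_subtractf distrib_left right_diff_distrib sum_distrib_right)
  also have "\<dots> = m I * ldet (W I) - (\<Sum>c\<in>ch I. m c * ldet (W c))"
    by (simp add: m_sum[OF I] trace_W_avg[OF I])
  finally have "det_gain I = (sqrt K + 1)^2 * (\<Sum>c\<in>ch I. m c * bregman (W I) (W c))"
    by (simp add: det_gain_def)
  then show ?thesis by (simp add: sum_distrib_left mult_ac)
qed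

lemma det_gain_nonneg: assumes I: "I \<in> D" shows "0 \<le> det_gain I"
  unfolding det_gain_eq[OF I]
  using quad_diff_le_bregman(2)[OF W_pos[OF I] W_pos[OF ch_D[OF I]] W_child_le[OF I]] m_pos[OF ch_D[OF I]]
  by (intro sum_nonneg mult_nonneg_nonneg) (auto intro: less_imp_le)

text \<open>The sums telescope to log det W_I on the top cube minus averages of log det W over small cubes. The latter are
  at least - log det U there, and these averages are again controlled from the top by concavity. Thus the
  function - (log det W + log det U), which is at most 0, is a Bellman function.\<close>

lemma det_gain_carleson:
  assumes F: "finite F" "F \<subseteq> D" and I: "I \<in> D" and U0: "\<And>I. I \<in> D \<Longrightarrow> (\<Sum>c\<in>ch I. m c * ldet (U c)) \<le> m I * ldet (U I)"
  shows "below F det_gain I \<le> (sqrt K + 1)^2 * (m I * (ldet (W I) + ldet (U I)))"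
proof -
  have "(sqrt K + 1)^2 * (- m I * (ldet (W I) + ldet (U I))) + below F det_gain I \<le> 0"
  proof (rule telescope[OF F I, where \<mu> = "\<lambda>_. 0"])
    fix I assume I: "I \<in> D"
    have "0 \<le> ldet (W I) + ldet (U I)" by (rule ldet_inv_le(1)[OF W_pos[OF I] U_pos[OF I] inv_W_le[OF I]])
    then show "(sqrt K + 1)^2 * (- m I * (ldet (W I) + ldet (U I))) \<le> 0"
      using m_pos[OF I] by (simp add: mult_nonneg_nonneg)
    have "(if I \<in> F then det_gain I else 0) \<le> det_gain I" using det_gain_nonneg[OF I] by simp
    moreover have "(sqrt K + 1)^2 * (- m I * (ldet (W I) + ldet (U I))) + det_gain I
        = (sqrt K + 1)^2 * (- (\<Sum>c\<in>ch I. m c * ldet (W c)) - m I * ldet (U I))"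
      by (simp add: det_gain_def algebra_simps)
    moreover have "\<dots> \<le> (sqrt K + 1)^2 * (- (\<Sum>c\<in>ch I. m c * ldet (W c)) - (\<Sum>c\<in>ch I. m c * ldet (U c)))"
      using U0[OF I] by (intro mult_left_mono) auto
    moreover have "\<dots> = (\<Sum>c\<in>ch I. (sqrt K + 1)^2 * (- m c * (ldet (W c) + ldet (U c))))"
      by (simp add: right_diff_distrib distrib_left sum_distrib_left sum.distrib sum_negf sum_subtractf)
    ultimately show "(sqrt K + 1)^2 * (- m I * (ldet (W I) + ldet (U I))) + (if I \<in> F then det_gain I else 0)
       \<le> (\<Sum>c\<in>ch I. (sqrt K + 1)^2 * (- m c * (ldet (W c) + ldet (U c))))" by linarith
  qed simp
  then show ?thesis by (simp add: algebra_simps)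
qed

lemma ldet_W_superadd:
  assumes I: "I \<in> D" shows "(\<Sum>c\<in>ch I. m c * ldet (W c)) \<le> m I * ldet (W I)"
proof -
  have "0 \<le> (sqrt K + 1)^2 * (m I * ldet (W I) - (\<Sum>c\<in>ch I. m c * ldet (W c)))"
    using det_gain_nonneg[OF I] by (simp add: det_gain_def)
  moreover have "(sqrt K + 1)^2 > 0" using K by (intro zero_less_power) (simp add: add_pos_pos)
  ultimately show ?thesis by (simp add: zero_le_mult_iff)
qed

text \<open>Let z = W_I^{-1} X_I. Up to the mean zero condition, the coefficient is the sum of the combinations of
  X_c - W_c z and of (W_c - W_I) z over the children. The first part is measured in W_c^{-1} instead of
  W_I^{-1}, and then adds up to the increment of <W^{-1} X, X>; the second part is bounded by the Bregman
  divergences.\<close>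

lemma haar_coefficient_le:
  assumes I: "I \<in> D"
    and X: "m I *\<^sub>R X I = (\<Sum>c\<in>ch I. m c *\<^sub>R X c)"
    and e: "\<And>c. c \<in> ch I \<Longrightarrow> (e c)^2 * m I \<le> 1" and e0: "(\<Sum>c\<in>ch I. e c * m c) = 0"
  shows "quad (matrix_inv (W I)) (\<Sum>c\<in>ch I. (e c * m c) *\<^sub>R X c)
     \<le> 2 * K * ((\<Sum>c\<in>ch I. m c * quad (matrix_inv (W c)) (X c)) - m I * quad (matrix_inv (W I)) (X I))
       + 2 * det_gain I * quad (matrix_inv (W I)) (X I)"
proof -
  note Wi = pos_def_matrix_inv[OF W_pos[OF I]]
  note cD = ch_D[OF I]
  define z where "z = matrix_inv (W I) *v X I"
  define q where "q J = quad (matrix_inv (W J)) (X J)" for J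
  have Xz: "X I \<bullet> z = q I" by (simp add: z_def q_def quad_def)
  have qz: "quad (W I) z = q I" unfolding z_def q_def by (rule quad_inv_self[OF W_pos[OF I]])
  have es: "(\<Sum>c\<in>ch I. (e c)^2 * m c) \<le> 1"
  proof -
    have "(\<Sum>c\<in>ch I. (e c)^2 * m c) \<le> (\<Sum>c\<in>ch I. m c / m I)"
    proof (rule sum_mono)
      fix c assume c: "c \<in> ch I"
      have "(e c)^2 \<le> 1 / m I" using e[OF c] m_pos[OF I] by (simp add: field_simps)
      then have "(e c)^2 * m c \<le> 1 / m I * m c" using m_pos[OF cD[OF c]] by (intro mult_right_mono) auto
      then show "(e c)^2 * m c \<le> m c / m I" by simp
    qed
    also have "\<dots> = 1" using m_sum[OF I] m_pos[OF I] by (simp add: sum_divide_distrib[symmetric])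
    finally show ?thesis .
  qed
  have m0: "0 \<le> m c" if "c \<in> ch I" for c using m_pos[OF cD[OF that]] by simp
  define G1 where "G1 = (\<Sum>c\<in>ch I. (e c * m c) *\<^sub>R (X c - W c *v z))"
  define G2 where "G2 = (\<Sum>c\<in>ch I. (e c * m c) *\<^sub>R ((W c - W I) *v z))"
  have G: "(\<Sum>c\<in>ch I. (e c * m c) *\<^sub>R X c) = G1 + G2"
  proof -
    have "G1 + G2 = (\<Sum>c\<in>ch I. (e c * m c) *\<^sub>R X c) - (\<Sum>c\<in>ch I. e c * m c) *\<^sub>R (W I *v z)"
      unfolding G1_def G2_def by (simp add: sum.distrib[symmetric] sum_subtractf[symmetric] scaleR_sum_left
          matrix_vector_mult_diff_rdistrib scaleR_diff_right)
    then show ?thesis by (simp add: e0)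
  qed
  have 1: "quad (matrix_inv (W I)) G1 \<le> K * ((\<Sum>c\<in>ch I. m c * q c) - m I * q I)"
  proof -
    have "quad (matrix_inv (W I)) G1 \<le> (\<Sum>c\<in>ch I. m c * quad (matrix_inv (W I)) (X c - W c *v z))"
      unfolding G1_def by (rule quad_sum_le[OF Wi m0 es])
    also have "\<dots> \<le> (\<Sum>c\<in>ch I. m c * (K * (q c - 2 * (X c \<bullet> z) + quad (W c) z)))"
    proof (intro sum_mono mult_left_mono m0)
      fix c assume c: "c \<in> ch I"
      note Wc = W_pos[OF cD[OF c]]
      have "quad (matrix_inv (W I)) (X c - W c *v z) \<le> K * quad (matrix_inv (W c)) (X c - W c *v z)"
        by (rule quad_inv_antimono[OF Wc W_pos[OF I] _ W_child_le[OF I c]]) (use K in simp)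
      also have "quad (matrix_inv (W c)) (X c - W c *v z) = q c - 2 * (X c \<bullet> z) + quad (W c) z"
        using Wc pos_def_inner[OF pos_def_matrix_inv[OF Wc], of "X c" "W c *v z"]
          pos_def_inner[OF Wc, of z "matrix_inv (W c) *v X c"]
        by (simp add: q_def quad_def matrix_vector_mult_diff_distrib inner_diff_left inner_diff_right inner_commute)
      finally show "quad (matrix_inv (W I)) (X c - W c *v z) \<le> K * (q c - 2 * (X c \<bullet> z) + quad (W c) z)" .
    qed
    also have "\<dots> = K * ((\<Sum>c\<in>ch I. m c * q c) - 2 * (\<Sum>c\<in>ch I. m c * (X c \<bullet> z)) + (\<Sum>c\<in>ch I. m c * quad (W c) z))"
      by (simp add: sum_distrib_left sum.distrib sum_subtractf distrib_left right_diff_distrib mult_ac)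
    also have "(\<Sum>c\<in>ch I. m c * quad (W c) z) = m I * q I" using quad_W_avg[OF I, of z] qz by simp
    also have "(\<Sum>c\<in>ch I. m c * (X c \<bullet> z)) = m I * q I"
      using arg_cong[OF X, of "\<lambda>x. x \<bullet> z"] by (simp add: inner_sum_left Xz)
    finally show ?thesis by simp
  qed
  have 2: "quad (matrix_inv (W I)) G2 \<le> det_gain I * q I"
  proof -
    have "quad (matrix_inv (W I)) G2 \<le> (\<Sum>c\<in>ch I. m c * quad (matrix_inv (W I)) ((W c - W I) *v z))"
      unfolding G2_def by (rule quad_sum_le[OF Wi m0 es])
    also have "\<dots> \<le> (\<Sum>c\<in>ch I. m c * ((sqrt K + 1)^2 * bregman (W I) (W c) * quad (W I) z))"
      by (intro sum_mono mult_left_mono m0 quad_diff_le_bregman(1) W_pos I cD W_child_le)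
    also have "\<dots> = det_gain I * q I" unfolding det_gain_eq[OF I] qz sum_distrib_right by (simp only: mult.assoc)
    finally show ?thesis .
  qed
  have "quad (matrix_inv (W I)) (G1 + G2) \<le> 2 * quad (matrix_inv (W I)) G1 + 2 * quad (matrix_inv (W I)) G2"
    by (rule quad_add_le[OF Wi])
  then show ?thesis unfolding G q_def[symmetric] using 1 2 by linarith
qed

text \<open>Of the two parts of a coefficient, the first telescopes and the second falls under the embedding theorem for
  the Carleson sequence det_gain.\<close>

lemma square_function_le:
  assumes F: "finite F" "F \<subseteq> D" and I: "I \<in> D" and Q: "0 < Q"
    and ld: "\<And>I. I \<in> D \<Longrightarrow> ldet (W I) + ldet (U I) \<le> Q"
    and X: "\<And>I. I \<in> D \<Longrightarrow> m I *\<^sub>R X I = (\<Sum>c\<in>ch I. m c *\<^sub>R X c)"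
    and X_le: "\<And>I. I \<in> D \<Longrightarrow> m I * quad (matrix_inv (W I)) (X I) \<le> \<mu> I"
    and \<mu>: "\<And>I. I \<in> D \<Longrightarrow> (\<Sum>c\<in>ch I. \<mu> c) \<le> \<mu> I"
    and e: "\<And>I c. I \<in> D \<Longrightarrow> c \<in> ch I \<Longrightarrow> (e I c)^2 * m I \<le> 1"
    and e0: "\<And>I. I \<in> D \<Longrightarrow> (\<Sum>c\<in>ch I. e I c * m c) = 0"
  shows "below F (\<lambda>I. quad (matrix_inv (W I)) (\<Sum>c\<in>ch I. (e I c * m c) *\<^sub>R X c)) I
    \<le> (2 * K + 32 * A * ((sqrt K + 1)^2 * Q)) * \<mu> I"
proof -
  define q where "q J = quad (matrix_inv (W J)) (X J)" for J
  define d where "d I = (\<Sum>c\<in>ch I. m c * q c) - m I * q I" for I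
  have q0: "0 \<le> q J" if "J \<in> D" for J unfolding q_def by (rule quad_nonneg[OF pos_def_matrix_inv[OF W_pos[OF that]]])
  have d0: "0 \<le> d I" if I: "I \<in> D" for I
  proof -
    define z where "z = matrix_inv (W I) *v X I"
    have "m I * q I = 2 * (m I * (X I \<bullet> z)) - m I * quad (W I) z"
      using quad_inv_self[OF W_pos[OF I], of "X I"] by (simp add: z_def q_def quad_def)
    also have "\<dots> = (\<Sum>c\<in>ch I. m c * (2 * (X c \<bullet> z) - quad (W c) z))"
      using arg_cong[OF X[OF I], of "\<lambda>x. x \<bullet> z"]
      by (simp add: quad_W_avg[OF I] inner_sum_left right_diff_distrib sum_subtractf sum_distrib_left mult_ac)
    also have "\<dots> \<le> (\<Sum>c\<in>ch I. m c * q c)"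
      unfolding q_def using m_pos[OF ch_D[OF I]]
      by (intro sum_mono mult_left_mono quad_inv_ge W_pos ch_D[OF I]) (auto intro: less_imp_le)
    finally show ?thesis by (simp add: d_def)
  qed
  have S2: "0 < (sqrt K + 1)^2" using K by (intro zero_less_power) (simp add: add_pos_pos)
  have "below F d I \<le> \<mu> I"
  proof -
    (* m I * q I is itself a Bellman function, and d is its exact increment *)
    have "m I * q I + below F d I \<le> \<mu> I"
    proof (rule telescope[OF F I _ \<mu>])
      fix I assume I: "I \<in> D"
      show "m I * q I \<le> \<mu> I" unfolding q_def by (rule X_le[OF I])
      show "m I * q I + (if I \<in> F then d I else 0) \<le> (\<Sum>c\<in>ch I. m c * q c)"
        using d0[OF I] by (auto simp: d_def)
    qed
    then show ?thesis using m_pos[OF I] q0[OF I] by (smt (verit) mult_nonneg_nonneg)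
  qed
  then have 1: "(2 * K) * below F d I \<le> (2 * K) * \<mu> I" using K by (intro mult_left_mono) auto
  interpret sw: matrix_weight_tree D ch m K U W A by (rule swap)
  have "below F (\<lambda>J. det_gain J * q J) I \<le> 16 * A * ((sqrt K + 1)^2 * Q) * \<mu> I"
    unfolding q_def
  proof (rule carleson_embedding[OF F I _ _ _ X X_le \<mu>])
    show "0 < (sqrt K + 1)^2 * Q" using S2 Q by simp
    fix J assume J: "J \<in> D"
    show "0 \<le> det_gain J" by (rule det_gain_nonneg[OF J])
    have "below F det_gain J \<le> (sqrt K + 1)^2 * (m J * (ldet (W J) + ldet (U J)))"
      by (rule det_gain_carleson[OF F J sw.ldet_W_superadd])
    also have "\<dots> \<le> (sqrt K + 1)^2 * (m J * Q)"
      using S2 m_pos[OF J] ld[OF J] by (intro mult_left_mono) auto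
    finally show "below F det_gain J \<le> (sqrt K + 1)^2 * Q * m J" by (simp add: mult_ac)
  qed
  moreover have "below F (\<lambda>I. quad (matrix_inv (W I)) (\<Sum>c\<in>ch I. (e I c * m c) *\<^sub>R X c)) I
      \<le> below F (\<lambda>I. (2 * K) * d I + 2 * (det_gain I * q I)) I"
  proof (rule below_mono)
    fix J assume "J \<in> F" then have J: "J \<in> D" using F by blast
    show "quad (matrix_inv (W J)) (\<Sum>c\<in>ch J. (e J c * m c) *\<^sub>R X c) \<le> (2 * K) * d J + 2 * (det_gain J * q J)"
      using haar_coefficient_le[OF J X[OF J] e[OF J] e0[OF J]] by (simp add: d_def q_def mult_ac)
  qed
  ultimately show ?thesis using 1 unfolding below_add below_cmult by (simp add: algebra_simps)
qed

end

section \<open>Dyadic grids and Haar functions\<close>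

lemma mem_hcube: "x \<in> hcube a l \<longleftrightarrow> (\<forall>i. a $ i \<le> x $ i \<and> x $ i < a $ i + l)"
  by (simp add: hcube_def)

lemma hcube_corner: "0 < l \<Longrightarrow> a \<in> hcube a l"
  by (simp add: mem_hcube)

lemma hcube_inj: "0 < l \<Longrightarrow> hcube a l = hcube b l \<Longrightarrow> a = b"
  by (metis hcube_corner mem_hcube order_antisym vec_eq_iff)

lemma borel_hcube: "hcube a l \<in> sets borel"
proof -
  have "hcube a l = (\<Inter>i. {x. a $ i \<le> x $ i} \<inter> {x. x $ i < a $ i + l})" by (auto simp: mem_hcube)
  also have "\<dots> \<in> sets borel" by measurable
  finally show ?thesis .
qed

lemma sets_hcube [measurable, simp]: "hcube a l \<in> sets lebesgue"
  by (rule sets_completionI_sets) (simp add: borel_hcube)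

lemma lmeasurable_hcube [simp]: "hcube a l \<in> lmeasurable"
proof (rule bounded_set_imp_lmeasurable)
  have "hcube a l \<subseteq> cbox a (\<chi> i. a $ i + l)" by (auto simp: mem_hcube mem_box_cart less_imp_le)
  then show "bounded (hcube a l)" using bounded_cbox bounded_subset by blast
qed simp

lemma measure_hcube:
  fixes a :: "real^'d" assumes l: "0 < l"
  shows "measure lebesgue (hcube a l) = l ^ CARD('d)"
proof -
  define b where "b = (\<chi> i. a $ i + l)"
  have 1: "hcube a l \<subseteq> cbox a b" by (auto simp: mem_hcube mem_box_cart b_def less_imp_le)
  have 2: "box a b \<subseteq> hcube a l" by (auto simp: mem_hcube mem_box_cart b_def less_imp_le)
  have ne: "cbox a b \<noteq> {}" using l by (auto simp: interval_ne_empty_cart b_def)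
  have c: "measure lebesgue (cbox a b) = l ^ CARD('d)"
    using content_cbox_cart[OF ne] by (simp add: b_def)
  have "measure lebesgue (hcube a l) \<le> measure lebesgue (cbox a b)"
    by (rule measure_mono_fmeasurable[OF 1]) auto
  moreover have "measure lebesgue (box a b) \<le> measure lebesgue (hcube a l)"
    by (rule measure_mono_fmeasurable[OF 2]) auto
  moreover have "measure lebesgue (box a b) = measure lebesgue (cbox a b)"
    by (simp add: measure_lborel_box_eq measure_lborel_cbox_eq)
  ultimately show ?thesis using c by simp
qed

definition corner :: "real^'d \<Rightarrow> real \<Rightarrow> 'd set \<Rightarrow> real^'d" where
  "corner a l S = (\<chi> i. if i \<in> S then a $ i + l / 2 else a $ i)"

text \<open>Children are singled out by their measure rather than by their side, which makes the size relation of the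
  abstract tree hold by definition.\<close>

definition children :: "(real^'d) set set \<Rightarrow> (real^'d) set \<Rightarrow> (real^'d) set set" where
  "children D I = {J\<in>D. J \<subseteq> I \<and> 2 ^ CARD('d) * measure lebesgue J = measure lebesgue I}"

lemma proj_hcube:
  assumes "0 < l" shows "(\<lambda>y. y $ i) ` hcube a l = {a $ i..<a $ i + l}"
proof
  show "(\<lambda>y. y $ i) ` hcube a l \<subseteq> {a $ i..<a $ i + l}" by (auto simp: mem_hcube)
  show "{a $ i..<a $ i + l} \<subseteq> (\<lambda>y. y $ i) ` hcube a l"
  proof
    fix t assume t: "t \<in> {a $ i..<a $ i + l}"
    have "(\<chi> j. if j = i then t else a $ j) \<in> hcube a l" using t assms by (auto simp: mem_hcube)
    then show "t \<in> (\<lambda>y. y $ i) ` hcube a l" by (rule rev_image_eqI) simp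
  qed
qed

text \<open>The second argument tells whether the point lies in the right half of the interval.\<close>

definition haar_sign :: "bool \<Rightarrow> bool \<Rightarrow> real" where
  "haar_sign e r = (if e then 1 else if r then -1 else 1)"

lemma haar_on_child:
  fixes a :: "real^'d"
  assumes l: "0 < l" and x: "x \<in> hcube (corner a l S) (l / 2)"
  shows "haar \<epsilon> (hcube a l) x = (\<Prod>i\<in>UNIV. haar_sign (\<epsilon> i) (i \<in> S) / sqrt l)"
  unfolding haar_def
proof (rule prod.cong[OF refl])
  fix i
  have m: "measure lebesgue {a $ i..<a $ i + l} = l" using l by simp
  have c: "Inf {a $ i..<a $ i + l} = a $ i" "Sup {a $ i..<a $ i + l} = a $ i + l" using l by (auto simp: cInf_atLeastLessThan)
  have xi: "corner a l S $ i \<le> x $ i" "x $ i < corner a l S $ i + l / 2" using x by (auto simp: mem_hcube)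
  show "haar_interval (\<epsilon> i) ((\<lambda>y. y $ i) ` hcube a l) (x $ i) = haar_sign (\<epsilon> i) (i \<in> S) / sqrt l"
    unfolding proj_hcube[OF l] haar_interval_def haar_sign_def m left_half_def right_half_def c
    using xi l by (auto simp: corner_def indicator_def split: if_splits)
qed

lemma haar_outside: "0 < l \<Longrightarrow> x \<notin> hcube a l \<Longrightarrow> haar \<epsilon> (hcube a l) x = 0"
proof -
  assume l: "0 < l" and x: "x \<notin> hcube a l"
  then obtain i where i: "x $ i \<notin> {a $ i..<a $ i + l}" by (auto simp: mem_hcube not_less)
  then have "haar_interval (\<epsilon> i) ((\<lambda>y. y $ i) ` hcube a l) (x $ i) = 0"
    unfolding proj_hcube[OF l] by (auto simp: haar_interval_def left_half_def right_half_def)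
  then show ?thesis unfolding haar_def by (intro prod_zero) auto
qed

text \<open>A Haar function is constant on each child c, which is never empty, so that any of its points serves to
  read off the value.\<close>

definition haar_value :: "('d::finite \<Rightarrow> bool) \<Rightarrow> (real^'d) set \<Rightarrow> (real^'d) set \<Rightarrow> real" where
  "haar_value \<epsilon> I c = haar \<epsilon> I (SOME x. x \<in> c)"

locale dyadic =
  fixes D :: "(real^'d) set set"
  assumes dyadic: "dyadic_grid D"
begin

abbreviation m :: "(real^'d) set \<Rightarrow> real" where "m \<equiv> measure lebesgue"

lemmas grid_parts = dyadic[unfolded dyadic_grid_def, THEN conjunct1]
  dyadic[unfolded dyadic_grid_def, THEN conjunct2, THEN conjunct1]
  dyadic[unfolded dyadic_grid_def, THEN conjunct2, THEN conjunct2]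

lemma cube_ex:
  assumes "I \<in> D" obtains a k where "I = hcube a (2 powi k)"
  using grid_parts(1) assms by metis

lemma nested: "I \<in> D \<Longrightarrow> J \<in> D \<Longrightarrow> I \<inter> J = {} \<or> I \<subseteq> J \<or> J \<subseteq> I"
  using grid_parts(3) by metis

lemma level_ex:
  fixes x :: "real^'d" and k :: int
  obtains b where "hcube b (2 powi k) \<in> D" "x \<in> hcube b (2 powi k)"
proof -
  have "partition_on UNIV {I\<in>D. \<exists>a. I = hcube a (2 powi k)}" by (rule grid_parts(2)[rule_format])
  from partition_onD1[OF this] obtain I where "I \<in> {I\<in>D. \<exists>a. I = hcube a (2 powi k)}" "x \<in> I" by blast
  then show ?thesis using that by auto
qed

lemma same_level:
  fixes k :: int
  assumes "hcube a (2 powi k) \<in> D" "hcube b (2 powi k) \<in> D" "x \<in> hcube a (2 powi k)" "x \<in> hcube b (2 powi k)"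
  shows "hcube a (2 powi k) = hcube b (2 powi k)"
proof -
  have "partition_on UNIV {I\<in>D. \<exists>a. I = hcube a (2 powi k)}" by (rule grid_parts(2)[rule_format])
  from partition_onD2[OF this] have "disjoint {I\<in>D. \<exists>a. I = hcube a (2 powi k)}" .
  moreover have "hcube a (2 powi k) \<in> {I\<in>D. \<exists>a. I = hcube a (2 powi k)}"
    "hcube b (2 powi k) \<in> {I\<in>D. \<exists>a. I = hcube a (2 powi k)}" using assms by auto
  ultimately show ?thesis using disjointD assms(3,4) by blast
qed

lemma lmeasurable_D [simp]: "I \<in> D \<Longrightarrow> I \<in> lmeasurable"
  by (metis cube_ex lmeasurable_hcube)

lemma sets_D [simp]: "I \<in> D \<Longrightarrow> I \<in> sets lebesgue"
  by (metis cube_ex sets_hcube)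

lemma m_hcube: "m (hcube a (2 powi k)) = (2 powi k) ^ CARD('d)"
  by (rule measure_hcube) simp

lemma m_pos: "I \<in> D \<Longrightarrow> 0 < m I"
  by (metis cube_ex m_hcube zero_less_power zero_less_power_int zero_less_numeral)

lemma ne_D: "I \<in> D \<Longrightarrow> I \<noteq> {}"
  using m_pos[of I] by auto

lemma m_mono: "I \<in> D \<Longrightarrow> J \<in> D \<Longrightarrow> I \<subseteq> J \<Longrightarrow> m I \<le> m J"
  by (rule measure_mono_fmeasurable) auto

lemma m_less_level:
  fixes j k :: int
  assumes "m (hcube a (2 powi j)) \<le> m (hcube b (2 powi k))"
  shows "j \<le> k"
proof (rule ccontr)
  assume "\<not> j \<le> k"
  then have "(2 powi k :: real) < 2 powi j" by (intro power_int_strict_increasing) auto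
  then have "(2 powi k :: real) ^ CARD('d) < (2 powi j) ^ CARD('d)" by (intro power_strict_mono) auto
  then show False using assms unfolding m_hcube by linarith
qed

lemma half_power: "(2::real) powi (k - 1) = 2 powi k / 2"
  by (simp add: power_int_diff)

text \<open>A smaller cube J that lies astride the midplane of I in direction i would meet, after moving its corner to the
  face of I, the cube of the same level that starts at this face; two cubes of one level that meet are equal.\<close>

lemma child_corner:
  assumes I: "hcube a (2 powi k) \<in> D" and J: "hcube b (2 powi k / 2) \<in> D"
    and sub: "hcube b (2 powi k / 2) \<subseteq> hcube a (2 powi k)"
  shows "b $ i = a $ i \<or> b $ i = a $ i + 2 powi k / 2"
proof (rule ccontr)
  define s :: real where "s = 2 powi k"
  assume n: "\<not> ?thesis"
  have s: "0 < s" by (simp add: s_def)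
  have bI: "b \<in> hcube a s" using sub hcube_corner[of "s/2" b] s unfolding s_def by auto
  have bi: "a $ i < b $ i" using bI n by (auto simp: mem_hcube s_def order_less_le)
  show False
  proof (cases "b $ i < a $ i + s / 2")
    case True
    (* the corner of J moved to the face of I *)
    define x where "x = (\<chi> j. if j = i then a $ i else b $ j)"
    obtain b' where b': "hcube b' (2 powi (k - 1)) \<in> D" "x \<in> hcube b' (2 powi (k - 1))" by (rule level_ex)
    have b'D: "hcube b' (s / 2) \<in> D" "x \<in> hcube b' (s/2)" using b' by (auto simp: half_power s_def)
    have xI: "x \<in> hcube a s" using bI s by (auto simp: mem_hcube x_def)
    have sub': "hcube b' (s / 2) \<subseteq> hcube a s"
    proof -
      have "\<not> hcube a s \<subseteq> hcube b' (s / 2)"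
      proof
        assume "hcube a s \<subseteq> hcube b' (s / 2)"
        then have "m (hcube a s) \<le> m (hcube b' (s/2))" by (rule m_mono[OF I[folded s_def] b'D(1)])
        then have "m (hcube a (2 powi k)) \<le> m (hcube b' (2 powi (k - 1)))" by (simp add: half_power s_def)
        then show False using m_less_level by fastforce
      qed
      then show ?thesis using nested[OF b'D(1) I[folded s_def]] b'D xI by blast
    qed
    have "b' \<in> hcube a s" using sub' hcube_corner[of "s/2" b'] s by auto
    then have b'i: "b' $ i = a $ i" using b'D(2) by (auto simp: mem_hcube x_def intro: order_antisym dest!: spec[of _ i])
    have "b \<in> hcube b' (s / 2)"
      unfolding mem_hcube
    proof
      fix j show "b' $ j \<le> b $ j \<and> b $ j < b' $ j + s / 2"
        using b'D(2) True bi b'i by (cases "j = i") (auto simp: mem_hcube x_def dest!: spec[of _ j])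
    qed
    then have "hcube b (2 powi (k - 1)) = hcube b' (2 powi (k - 1))"
      using same_level[of b "k - 1" b' b] J b' s by (simp add: half_power s_def hcube_corner)
    then have "b = b'" using hcube_inj[of "2 powi (k - 1)"] by simp
    then show False using bi b'i by simp
  next
    case False
    then have lt: "a $ i + s / 2 < b $ i" using n by (auto simp: s_def)
    define t where "t = a $ i + s - b $ i"
    have t: "0 < t" "t < s / 2" using bI lt by (auto simp: t_def mem_hcube)
    (* a point of J at which the coordinate i reaches the open end of I *)
    define x where "x = (\<chi> j. if j = i then b $ i + t else b $ j)"
    have "x \<in> hcube b (s / 2)" using t s by (auto simp: mem_hcube x_def)
    then have "x \<in> hcube a s" using sub by (auto simp: s_def)
    then have "x $ i < a $ i + s" by (simp add: mem_hcube)
    then show False by (simp add: x_def t_def)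
  qed
qed

lemma child_sub:
  assumes I: "hcube a (2 powi k) \<in> D" and J: "hcube b (2 powi k / 2) \<in> D"
    and x: "x \<in> hcube a (2 powi k)" "x \<in> hcube b (2 powi k / 2)"
  shows "hcube b (2 powi k / 2) \<subseteq> hcube a (2 powi k)"
proof -
  have "\<not> hcube a (2 powi k) \<subseteq> hcube b (2 powi k / 2)"
  proof
    assume "hcube a (2 powi k) \<subseteq> hcube b (2 powi k / 2)"
    then have "m (hcube a (2 powi k)) \<le> m (hcube b (2 powi k / 2))" by (rule m_mono[OF I J])
    then have "m (hcube a (2 powi k)) \<le> m (hcube b (2 powi (k - 1)))" by (simp add: half_power)
    then show False using m_less_level by fastforce
  qed
  then show ?thesis using nested[OF J I] x by blast
qed

lemma m_half: "2 ^ CARD('d) * m (hcube b (2 powi k / 2)) = m (hcube a (2 powi k))"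
proof -
  have "m (hcube b (2 powi k / 2)) = (2 powi k / 2) ^ CARD('d)" by (rule measure_hcube) simp
  then show ?thesis by (simp add: m_hcube power_divide)
qed

lemma children_iff:
  assumes I: "hcube a (2 powi k) \<in> D"
  shows "J \<in> children D (hcube a (2 powi k)) \<longleftrightarrow>
    J \<in> D \<and> J \<subseteq> hcube a (2 powi k) \<and> (\<exists>b. J = hcube b (2 powi k / 2))"
proof
  assume "J \<in> children D (hcube a (2 powi k))"
  then have J: "J \<in> D" "J \<subseteq> hcube a (2 powi k)" "2 ^ CARD('d) * m J = m (hcube a (2 powi k))"
    by (auto simp: children_def)
  obtain b j where b: "J = hcube b (2 powi j)" using J cube_ex by blast
  have "2 ^ CARD('d) * m (hcube b (2 powi j)) = 2 ^ CARD('d) * m (hcube b (2 powi k / 2))"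
    unfolding m_half[of b k a] using J(3) b by simp
  then have "m (hcube b (2 powi j)) = m (hcube b (2 powi (k - 1)))" by (simp add: half_power)
  then have "j = k - 1" using m_less_level[of b j b "k - 1"] m_less_level[of b "k - 1" b j] by simp
  then show "J \<in> D \<and> J \<subseteq> hcube a (2 powi k) \<and> (\<exists>b. J = hcube b (2 powi k / 2))"
    using J b by (auto simp: half_power)
next
  assume "J \<in> D \<and> J \<subseteq> hcube a (2 powi k) \<and> (\<exists>b. J = hcube b (2 powi k / 2))"
  then show "J \<in> children D (hcube a (2 powi k))" using m_half by (auto simp: children_def)
qed

lemma children_eq:
  assumes I: "hcube a (2 powi k) \<in> D"
  shows "children D (hcube a (2 powi k)) = (\<lambda>S. hcube (corner a (2 powi k) S) (2 powi k / 2)) ` UNIV"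
proof (intro set_eqI iffI)
  fix J assume "J \<in> children D (hcube a (2 powi k))"
  from this[unfolded children_iff[OF I]]
  obtain b where b: "J \<in> D" "J \<subseteq> hcube a (2 powi k)" "J = hcube b (2 powi k / 2)"
    by (elim conjE exE)
  have "b $ i = a $ i \<or> b $ i = a $ i + 2 powi k / 2" for i
    by (rule child_corner[OF I]) (use b in auto)
  then have "b $ i = corner a (2 powi k) {i. b $ i \<noteq> a $ i} $ i" for i
    unfolding corner_def by auto
  then have "b = corner a (2 powi k) {i. b $ i \<noteq> a $ i}" unfolding vec_eq_iff by blast
  then have "J = hcube (corner a (2 powi k) {i. b $ i \<noteq> a $ i}) (2 powi k / 2)" using b(3) by (rule subst)
  then show "J \<in> (\<lambda>S. hcube (corner a (2 powi k) S) (2 powi k / 2)) ` UNIV" by (rule image_eqI) simp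
next
  fix J assume "J \<in> (\<lambda>S. hcube (corner a (2 powi k) S) (2 powi k / 2)) ` UNIV"
  then obtain S where J: "J = hcube (corner a (2 powi k) S) (2 powi k / 2)" by blast
  define x where "x = corner a (2 powi k) S"
  obtain b where "hcube b (2 powi (k - 1)) \<in> D" "x \<in> hcube b (2 powi (k - 1))" by (rule level_ex)
  then have b: "hcube b (2 powi k / 2) \<in> D" "x \<in> hcube b (2 powi k / 2)" by (auto simp: half_power)
  have xI: "x \<in> hcube a (2 powi k)" by (auto simp: x_def mem_hcube corner_def)
  have sub: "hcube b (2 powi k / 2) \<subseteq> hcube a (2 powi k)" by (rule child_sub[OF I b(1) xI b(2)])
  have "b $ i = x $ i" for i
    using child_corner[OF I b(1) sub, of i] b(2)
    by (auto simp: mem_hcube x_def corner_def dest!: spec[of _ i] split: if_splits)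
  then have "b = x" by (simp add: vec_eq_iff)
  then show "J \<in> children D (hcube a (2 powi k))" unfolding children_iff[OF I] J using b sub by (auto simp: x_def)
qed

lemma inj_corner: "inj (\<lambda>S. hcube (corner a (2 powi k) S) (2 powi k / 2))"
proof (rule injI)
  fix S T assume "hcube (corner a (2 powi k) S) (2 powi k / 2) = hcube (corner a (2 powi k) T) (2 powi k / 2)"
  then have "corner a (2 powi k) S = corner a (2 powi k) T" by (rule hcube_inj[rotated]) simp
  then have "(if i \<in> S then a $ i + 2 powi k / 2 else a $ i) = (if i \<in> T then a $ i + 2 powi k / 2 else a $ i)" for i
    by (simp add: corner_def vec_eq_iff)
  then have "i \<in> S \<longleftrightarrow> i \<in> T" for i by (smt (verit) half_gt_zero zero_less_power_int)
  then show "S = T" by blast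
qed

lemma sum_children:
  assumes I: "hcube a (2 powi k) \<in> D"
  shows "(\<Sum>c\<in>children D (hcube a (2 powi k)). f c) = (\<Sum>S\<in>UNIV. f (hcube (corner a (2 powi k) S) (2 powi k / 2)))"
  unfolding children_eq[OF I] by (subst sum.reindex[OF inj_corner]) simp

lemma finite_children: "I \<in> D \<Longrightarrow> finite (children D I)"
  by (metis cube_ex children_eq finite finite_imageI)

lemma child_cover:
  assumes I: "I \<in> D" and J: "J \<in> D" "J \<subseteq> I" "J \<noteq> I"
  shows "\<exists>!c. c \<in> children D I \<and> J \<subseteq> c"
proof -
  obtain a k where I': "I = hcube a (2 powi k)" using I cube_ex by blast
  obtain b j where J': "J = hcube b (2 powi j)" using J cube_ex by blast
  have jk: "j \<le> k" using m_mono[OF J(1) I J(2)] m_less_level unfolding I' J' by blast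
  have bJ: "b \<in> J" by (simp add: J' hcube_corner)
  have "j \<noteq> k"
  proof
    assume "j = k"
    then have "J = I" using same_level[of b k a b] I J bJ unfolding I' J' by auto
    then show False using J by blast
  qed
  then have jk: "j \<le> k - 1" using jk by simp
  obtain c where "hcube c (2 powi (k - 1)) \<in> D" "b \<in> hcube c (2 powi (k - 1))" by (rule level_ex)
  then have c: "hcube c (2 powi k / 2) \<in> D" "b \<in> hcube c (2 powi k / 2)" by (auto simp: half_power)
  have "hcube c (2 powi k / 2) \<subseteq> I" unfolding I' by (rule child_sub) (use c bJ I J I' in auto)
  then have cc: "hcube c (2 powi k / 2) \<in> children D I"
    unfolding I' children_iff[OF I[unfolded I']] using c(1) by blast
  have "J \<subseteq> hcube c (2 powi k / 2)"
  proof (rule ccontr)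
    assume n: "\<not> J \<subseteq> hcube c (2 powi k / 2)"
    then have "hcube c (2 powi k / 2) \<subseteq> J" using nested[OF J(1) c(1)] bJ c(2) by blast
    then have "m (hcube c (2 powi (k-1))) \<le> m (hcube b (2 powi j))" using m_mono[OF c(1) J(1)] by (simp add: J' half_power)
    then have "j = k - 1" using m_less_level[of c "k - 1" b j] jk by simp
    then have "J = hcube c (2 powi k / 2)"
      using same_level[of b "k - 1" c b] c J J' bJ by (simp add: half_power)
    then show False using n by blast
  qed
  moreover have "c' = hcube c (2 powi k / 2)" if c': "c' \<in> children D I" "J \<subseteq> c'" for c'
  proof -
    obtain e where e: "c' \<in> D" "c' = hcube e (2 powi k / 2)"
      using c'(1)[unfolded I' children_iff[OF I[unfolded I']]] by (elim conjE exE)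
    then show ?thesis using same_level[of e "k - 1" c b] c c' bJ by (auto simp: half_power)
  qed
  ultimately show ?thesis using cc by blast
qed

lemma m_sum_children:
  assumes "I \<in> D" shows "(\<Sum>c\<in>children D I. m c) = m I"
proof -
  obtain a k where I: "I = hcube a (2 powi k)" using assms cube_ex by blast
  have "m (hcube (corner a (2 powi k) S) (2 powi k / 2)) = m I / 2 ^ CARD('d)" for S
    using m_half[of "corner a (2 powi k) S" k a] by (simp add: I field_simps)
  then have "(\<Sum>c\<in>children D I. m c) = (\<Sum>S\<in>(UNIV::'d set set). m I / 2 ^ CARD('d))"
    using sum_children[of a k m] assms by (simp add: I)
  also have "\<dots> = m I" by (simp add: card_UNIV_set)
  finally show ?thesis .
qed

sublocale tree: cube_tree D "children D" m "2 ^ CARD('d)"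
proof
  show "(1::real) < 2 ^ CARD('d)" by (rule one_less_power) auto
  fix I c J
  show "I \<in> D \<Longrightarrow> finite (children D I)" by (rule finite_children)
  show "c \<in> D" "c \<subseteq> I" "2 ^ CARD('d) * m c = m I" if "c \<in> children D I" using that by (auto simp: children_def)
  show "I \<in> D \<Longrightarrow> 0 < m I" by (rule m_pos)
  show "I \<in> D \<Longrightarrow> J \<in> D \<Longrightarrow> I \<subseteq> J \<Longrightarrow> m I \<le> m J" by (rule m_mono)
  show "I \<in> D \<Longrightarrow> (\<Sum>c\<in>children D I. m c) = m I" by (rule m_sum_children)
  show "I \<in> D \<Longrightarrow> J \<in> D \<Longrightarrow> J \<subseteq> I \<Longrightarrow> J \<noteq> I \<Longrightarrow> \<exists>!c. c \<in> children D I \<and> J \<subseteq> c" by (rule child_cover)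
qed

lemma Union_children:
  assumes I: "I \<in> D" shows "\<Union>(children D I) = I"
proof
  obtain a k where I': "I = hcube a (2 powi k)" using I cube_ex by blast
  show "\<Union>(children D I) \<subseteq> I" by (auto simp: children_def)
  show "I \<subseteq> \<Union>(children D I)"
  proof
    fix x assume x: "x \<in> I"
    obtain c where "hcube c (2 powi (k - 1)) \<in> D" "x \<in> hcube c (2 powi (k - 1))" by (rule level_ex)
    then have c: "hcube c (2 powi k / 2) \<in> D" "x \<in> hcube c (2 powi k / 2)" by (auto simp: half_power)
    have "hcube c (2 powi k / 2) \<subseteq> I" unfolding I' by (rule child_sub) (use c x I I' in auto)
    then have "hcube c (2 powi k / 2) \<in> children D I"
      unfolding I' children_iff[OF I[unfolded I']] using c(1) by blast
    then show "x \<in> \<Union>(children D I)" using c by blast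
  qed
qed

lemma disjoint_children:
  assumes I: "I \<in> D" shows "disjoint_family_on (\<lambda>c. c) (children D I)"
  unfolding disjoint_family_on_def
proof (intro ballI impI)
  fix c c' assume c: "c \<in> children D I" "c' \<in> children D I" "c \<noteq> c'"
  obtain a k where I': "I = hcube a (2 powi k)" using I cube_ex by blast
  obtain e where e: "c \<in> D" "c = hcube e (2 powi (k - 1))"
    using c(1)[unfolded I' children_iff[OF I[unfolded I']]] unfolding half_power by (elim conjE exE)
  obtain e' where e': "c' \<in> D" "c' = hcube e' (2 powi (k - 1))"
    using c(2)[unfolded I' children_iff[OF I[unfolded I']]] unfolding half_power by (elim conjE exE)
  have False if "x \<in> c" "x \<in> c'" for x
    using same_level[of e "k - 1" e' x] e e' c(3) that by simp
  then show "c \<inter> c' = {}" by blast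
qed

lemma integral_children:
  fixes f :: "real^'d \<Rightarrow> 'b::euclidean_space"
  assumes I: "I \<in> D" and f: "set_integrable lebesgue I f"
  shows "(LINT x:I|lebesgue. f x) = (\<Sum>c\<in>children D I. LINT x:c|lebesgue. f x)"
proof -
  have "(LINT x:(\<Union>c\<in>children D I. c)|lebesgue. f x) = (\<Sum>c\<in>children D I. LINT x:c|lebesgue. f x)"
  proof (rule set_integral_finite_Union[OF finite_children[OF I] disjoint_children[OF I]])
    fix c assume c: "c \<in> children D I"
    then show cs: "c \<in> sets lebesgue" by (auto simp: children_def)
    show "set_integrable lebesgue c f" by (rule set_integrable_subset[OF f cs]) (use c in \<open>auto simp: children_def\<close>)
  qed
  then show ?thesis using Union_children[OF I] by simp
qed

lemma avg_children:
  fixes f :: "real^'d \<Rightarrow> 'b::euclidean_space"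
  assumes I: "I \<in> D" and f: "set_integrable lebesgue I f"
  shows "m I *\<^sub>R avg I f = (\<Sum>c\<in>children D I. m c *\<^sub>R avg c f)"
proof -
  have e: "m J *\<^sub>R avg J f = (LINT x:J|lebesgue. f x)" if "J \<in> D" for J using m_pos[OF that] by (simp add: avg_def)
  have "c \<in> children D I \<Longrightarrow> c \<in> D" for c by (simp add: children_def)
  then show ?thesis using e integral_children[OF I f] I by simp
qed

lemma haar_child:
  assumes I: "I \<in> D" and c: "c \<in> children D I" and x: "x \<in> c"
  shows "haar \<epsilon> I x = haar_value \<epsilon> I c"
proof -
  obtain a k where I': "I = hcube a (2 powi k)" using I cube_ex by blast
  obtain S where S: "c = hcube (corner a (2 powi k) S) (2 powi k / 2)"
    using c[unfolded I' children_eq[OF I[unfolded I']]] by (rule imageE)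
  have "(SOME x. x \<in> c) \<in> c" using x by (rule someI)
  then show ?thesis unfolding haar_value_def I' using haar_on_child[of "2 powi k" _ a S] x S by simp
qed

lemma haar_value_corner:
  "haar_value \<epsilon> (hcube a (2 powi k)) (hcube (corner a (2 powi k) S) (2 powi k / 2))
     = (\<Prod>i\<in>UNIV. haar_sign (\<epsilon> i) (i \<in> S) / sqrt (2 powi k))"
proof -
  have "corner a (2 powi k) S \<in> hcube (corner a (2 powi k) S) (2 powi k / 2)" by (rule hcube_corner) simp
  then have "(SOME x. x \<in> hcube (corner a (2 powi k) S) (2 powi k / 2)) \<in> hcube (corner a (2 powi k) S) (2 powi k / 2)"
    by (rule someI)
  then show ?thesis unfolding haar_value_def by (intro haar_on_child) simp_all
qed

lemma haar_value_sq:
  assumes I: "I \<in> D" and c: "c \<in> children D I"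
  shows "(haar_value \<epsilon> I c)^2 * m I = 1"
proof -
  obtain a k where I': "I = hcube a (2 powi k)" using I cube_ex by blast
  obtain S where S: "c = hcube (corner a (2 powi k) S) (2 powi k / 2)"
    using c[unfolded I' children_eq[OF I[unfolded I']]] by (rule imageE)
  have "(haar_value \<epsilon> I c)^2 = (\<Prod>i\<in>UNIV. (haar_sign (\<epsilon> i) (i \<in> S) / sqrt (2 powi k))^2)"
    unfolding I' S haar_value_corner by (simp add: prod_power_distrib)
  also have "\<dots> = (\<Prod>i\<in>(UNIV::'d set). 1 / 2 powi k)"
    by (intro prod.cong refl) (simp add: power_divide haar_sign_def)
  finally show ?thesis by (simp add: I' m_hcube power_divide)
qed

text \<open>The children correspond to the sets of coordinates in which they lie to the right. Summed over these sets, the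
  product of signs factorizes, and a coordinate with \<epsilon> i = 0 contributes the factor 1 - 1.\<close>

lemma haar_value_mean:
  assumes I: "I \<in> D" and e: "\<epsilon> \<in> Sig"
  shows "(\<Sum>c\<in>children D I. haar_value \<epsilon> I c * m c) = 0"
proof -
  obtain a k where I': "I = hcube a (2 powi k)" using I cube_ex by blast
  obtain i where i: "\<not> \<epsilon> i" using e by (auto simp: Sig_def)
  have mc: "m (hcube (corner a (2 powi k) S) (2 powi k / 2)) = m I / 2 ^ CARD('d)" for S
    using m_half[of "corner a (2 powi k) S" k a] by (simp add: I' field_simps)
  have "(\<Sum>c\<in>children D I. haar_value \<epsilon> I c * m c)
      = (\<Sum>S\<in>UNIV. (\<Prod>i\<in>UNIV. haar_sign (\<epsilon> i) (i \<in> S) / sqrt (2 powi k)) * (m I / 2 ^ CARD('d)))"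
    using sum_children[of a k "\<lambda>c. haar_value \<epsilon> I c * m c"] I by (simp add: I' haar_value_corner mc[unfolded I'])
  also have "\<dots> = (\<Sum>S\<in>Pow UNIV. (\<Prod>i\<in>S. haar_sign (\<epsilon> i) True / sqrt (2 powi k)) *
       (\<Prod>i\<in>UNIV - S. haar_sign (\<epsilon> i) False / sqrt (2 powi k))) * (m I / 2 ^ CARD('d))"
  proof -
    have "(\<Prod>i\<in>UNIV. haar_sign (\<epsilon> i) (i \<in> S) / sqrt (2 powi k)) =
      (\<Prod>i\<in>S. haar_sign (\<epsilon> i) True / sqrt (2 powi k)) * (\<Prod>i\<in>UNIV - S. haar_sign (\<epsilon> i) False / sqrt (2 powi k))" for S
    proof -
      have "(\<Prod>i\<in>UNIV. haar_sign (\<epsilon> i) (i \<in> S) / sqrt (2 powi k)) =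
        (\<Prod>i\<in>UNIV - S. haar_sign (\<epsilon> i) (i \<in> S) / sqrt (2 powi k)) * (\<Prod>i\<in>S. haar_sign (\<epsilon> i) (i \<in> S) / sqrt (2 powi k))"
        by (rule prod.subset_diff) auto
      then show ?thesis by (simp add: mult.commute)
    qed
    then show ?thesis unfolding Pow_UNIV sum_distrib_right by (simp only:)
  qed
  also have "\<dots> = (\<Prod>i\<in>UNIV. haar_sign (\<epsilon> i) True / sqrt (2 powi k) + haar_sign (\<epsilon> i) False / sqrt (2 powi k)) * (m I / 2 ^ CARD('d))"
    by (subst prod_add) auto
  also have "(\<Prod>i\<in>UNIV. haar_sign (\<epsilon> i) True / sqrt (2 powi k) + haar_sign (\<epsilon> i) False / sqrt (2 powi k)) = 0"
    by (intro prod_zero bexI[of _ i]) (auto simp: i haar_sign_def)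
  finally show ?thesis by simp
qed

lemma haar_sum:
  assumes I: "I \<in> D"
  shows "haar \<epsilon> I x = (\<Sum>c\<in>children D I. haar_value \<epsilon> I c * indicator c x)"
proof (cases "x \<in> I")
  case True
  then obtain c where c: "c \<in> children D I" "x \<in> c" using Union_children[OF I] by blast
  have "(\<Sum>d\<in>children D I. haar_value \<epsilon> I d * indicator d x) = (\<Sum>d\<in>children D I. if d = c then haar_value \<epsilon> I c else 0)"
    using disjoint_children[OF I] c by (intro sum.cong refl) (auto simp: disjoint_family_on_def indicator_def)
  then show ?thesis using haar_child[OF I c(1) c(2)] c finite_children[OF I] by simp
next
  case False
  obtain a k where I': "I = hcube a (2 powi k)" using I cube_ex by blast
  have "haar \<epsilon> I x = 0" unfolding I' by (rule haar_outside) (use False I' in auto)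
  moreover have "x \<notin> c" if "c \<in> children D I" for c using that False by (auto simp: children_def)
  ultimately show ?thesis by (simp add: indicator_def)
qed

lemma haar_measurable:
  assumes I: "I \<in> D" shows "haar \<epsilon> I \<in> borel_measurable lebesgue"
proof -
  have "(\<lambda>x. \<Sum>c\<in>children D I. haar_value \<epsilon> I c * indicator c x) \<in> borel_measurable lebesgue"
    by (intro borel_measurable_sum borel_measurable_times borel_measurable_const borel_measurable_indicator)
      (auto simp: children_def)
  then show ?thesis using haar_sum[OF I, of \<epsilon>] by (simp add: fun_eq_iff[symmetric] cong: measurable_cong)
qed

lemma integral_haar:
  fixes f :: "real^'d \<Rightarrow> 'b::euclidean_space"
  assumes I: "I \<in> D" and f: "set_integrable lebesgue I f"
  shows "(LINT x|lebesgue. haar \<epsilon> I x *\<^sub>R f x) = (\<Sum>c\<in>children D I. (haar_value \<epsilon> I c * m c) *\<^sub>R avg c f)"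
    and "integrable lebesgue (\<lambda>x. haar \<epsilon> I x *\<^sub>R f x)"
proof -
  have fc: "set_integrable lebesgue c f" if "c \<in> children D I" for c
    by (rule set_integrable_subset[OF f]) (use that in \<open>auto simp: children_def\<close>)
  have e: "(\<lambda>x. haar \<epsilon> I x *\<^sub>R f x) = (\<lambda>x. \<Sum>c\<in>children D I. haar_value \<epsilon> I c *\<^sub>R (indicator c x *\<^sub>R f x))"
    by (simp add: haar_sum[OF I] scaleR_sum_left fun_eq_iff)
  show "integrable lebesgue (\<lambda>x. haar \<epsilon> I x *\<^sub>R f x)"
    unfolding e by (intro Bochner_Integration.integrable_sum integrable_scaleR_right) (use fc in \<open>simp add: set_integrable_def\<close>)
  have "(LINT x|lebesgue. haar \<epsilon> I x *\<^sub>R f x) = (\<Sum>c\<in>children D I. haar_value \<epsilon> I c *\<^sub>R (LINT x:c|lebesgue. f x))"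
    unfolding e by (subst Bochner_Integration.integral_sum) (use fc in \<open>auto simp: set_integrable_def set_lebesgue_integral_def simp del: scaleR_scaleR intro!: integrable_scaleR_right\<close>)
  also have "\<dots> = (\<Sum>c\<in>children D I. (haar_value \<epsilon> I c * m c) *\<^sub>R avg c f)"
  proof (rule sum.cong[OF refl])
    fix c assume "c \<in> children D I"
    then have "c \<in> D" by (simp add: children_def)
    from m_pos[OF this] show "haar_value \<epsilon> I c *\<^sub>R (LINT x:c|lebesgue. f x) = (haar_value \<epsilon> I c * m c) *\<^sub>R avg c f"
      by (simp add: avg_def)
  qed
  finally show "(LINT x|lebesgue. haar \<epsilon> I x *\<^sub>R f x) = (\<Sum>c\<in>children D I. (haar_value \<epsilon> I c * m c) *\<^sub>R avg c f)" .
qed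

text \<open>The maximal members of F are disjoint and every member of F lies below one of them.\<close>

lemma sum_le_integral:
  fixes w :: "real^'d \<Rightarrow> real"
  assumes F: "finite F" "F \<subseteq> D" and w: "integrable lebesgue w" and w0: "AE x in lebesgue. 0 \<le> w x" and C: "0 \<le> C"
    and le: "\<And>I. I \<in> D \<Longrightarrow> tree.below F f I \<le> C * (LINT x:I|lebesgue. w x)"
  shows "(\<Sum>I\<in>F. f I) \<le> C * (LINT x|lebesgue. w x)"
proof -
  define T where "T = {I\<in>F. \<forall>J\<in>F. I \<subseteq> J \<longrightarrow> I = J}"
  have T: "finite T" "T \<subseteq> F" using F by (auto simp: T_def)
  have disj: "I \<inter> J = {}" if "I \<in> T" "J \<in> T" "I \<noteq> J" for I J
    using nested[of I J] that F by (auto simp: T_def)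
  have cover: "\<exists>I\<in>T. J \<subseteq> I" if J: "J \<in> F" for J
  proof -
    obtain I where "I \<in> F" "J \<subseteq> I" "\<forall>b\<in>F. I \<subseteq> b \<longrightarrow> I = b" using finite_has_maximal2[OF F(1) J] by blast
    then show ?thesis by (auto simp: T_def)
  qed
  have FU: "F = (\<Union>I\<in>T. {J\<in>F. J \<subseteq> I})" using cover by blast
  have "(\<Sum>I\<in>F. f I) = (\<Sum>I\<in>(\<Union>I\<in>T. {J\<in>F. J \<subseteq> I}). f I)" using FU by simp
  also have "\<dots> = (\<Sum>I\<in>T. tree.below F f I)"
    unfolding tree.below_def
  proof (rule sum.UNION_disjoint)
    show "\<forall>I\<in>T. \<forall>I'\<in>T. I \<noteq> I' \<longrightarrow> {J \<in> F. J \<subseteq> I} \<inter> {J \<in> F. J \<subseteq> I'} = {}"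
    proof (intro ballI impI, rule ccontr)
      fix I I' assume a: "I \<in> T" "I' \<in> T" "I \<noteq> I'" "{J \<in> F. J \<subseteq> I} \<inter> {J \<in> F. J \<subseteq> I'} \<noteq> {}"
      then obtain J where "J \<in> F" "J \<subseteq> I \<inter> I'" by blast
      then show False using disj[OF a(1-3)] ne_D[of J] F by blast
    qed
  qed (use T F in auto)
  also have "\<dots> \<le> (\<Sum>I\<in>T. C * (LINT x:I|lebesgue. w x))" using T F by (intro sum_mono le) auto
  also have "\<dots> = C * (\<Sum>I\<in>T. (LINT x:I|lebesgue. w x))" by (simp add: sum_distrib_left)
  also have "(\<Sum>I\<in>T. (LINT x:I|lebesgue. w x)) = (LINT x:(\<Union>I\<in>T. I)|lebesgue. w x)"
  proof (rule set_integral_finite_Union[symmetric])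
    show "disjoint_family_on (\<lambda>I. I) T" using disj by (auto simp: disjoint_family_on_def)
    fix I assume "I \<in> T"
    then have "I \<in> D" using T F by blast
    then show "I \<in> sets lebesgue" by simp
    then show "set_integrable lebesgue I w" using w unfolding set_integrable_def by (intro integrable_mult_indicator)
  qed (use T in simp)
  also have "\<dots> \<le> (LINT x|lebesgue. w x)"
    unfolding set_lebesgue_integral_def
  proof (rule integral_mono_AE[OF _ w])
    have "(\<Union>I\<in>T. I) \<in> sets lebesgue" using T F by (intro sets.finite_UN) auto
    then show "integrable lebesgue (\<lambda>x. indicator (\<Union>I\<in>T. I) x *\<^sub>R w x)" using w by (intro integrable_mult_indicator)
    show "AE x in lebesgue. indicator (\<Union>I\<in>T. I) x *\<^sub>R w x \<le> w x"
      using w0 by eventually_elim (auto simp: indicator_def)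
  qed
  finally show ?thesis using C by (simp add: mult_left_mono)
qed

end

section \<open>Averages of a weight, embedding and square function\<close>

lemma borel_measurable_vec_nth [measurable (raw)]:
  fixes f :: "'a \<Rightarrow> ('b::euclidean_space)^'n"
  assumes "f \<in> borel_measurable M" shows "(\<lambda>x. f x $ i) \<in> borel_measurable M"
  by (rule borel_measurable_continuous_on[OF _ assms]) (intro continuous_intros)

lemma borel_measurable_vec_lambda:
  fixes f :: "'a \<Rightarrow> ('b::euclidean_space)^'n"
  assumes "\<And>i. (\<lambda>x. f x $ i) \<in> borel_measurable M" shows "f \<in> borel_measurable M"
proof (rule borel_measurable_euclidean_space[THEN iffD2], rule ballI)
  fix b :: "'b^'n" assume "b \<in> Basis"
  have "(\<lambda>x. \<Sum>i\<in>UNIV. f x $ i \<bullet> b $ i) \<in> borel_measurable M"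
    using assms by (intro borel_measurable_sum borel_measurable_inner) auto
  then show "(\<lambda>x. f x \<bullet> b) \<in> borel_measurable M" by (simp add: inner_vec_def)
qed

lemma borel_measurable_matrix_vector [measurable (raw)]:
  fixes F :: "'a \<Rightarrow> complex^'n^'n"
  assumes F: "F \<in> borel_measurable M" and f: "f \<in> borel_measurable M"
  shows "(\<lambda>x. F x *v f x) \<in> borel_measurable M"
proof (rule borel_measurable_vec_lambda)
  fix i
  have "(\<lambda>x. \<Sum>j\<in>UNIV. F x $ i $ j * f x $ j) \<in> borel_measurable M"
    by (intro borel_measurable_sum borel_measurable_times borel_measurable_vec_nth F f)
  then show "(\<lambda>x. (F x *v f x) $ i) \<in> borel_measurable M" by (simp add: matrix_vector_mult_def)
qed

lemma borel_measurable_quad [measurable (raw)]: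
  "F \<in> borel_measurable M \<Longrightarrow> f \<in> borel_measurable M \<Longrightarrow> (\<lambda>x. quad (F x) (f x)) \<in> borel_measurable M"
  unfolding quad_def by (intro borel_measurable_inner borel_measurable_matrix_vector)

lemma borel_measurable_det:
  fixes F :: "'a \<Rightarrow> complex^'n^'n"
  assumes "F \<in> borel_measurable M"
  shows "(\<lambda>x. det (F x)) \<in> borel_measurable M"
  unfolding det_def
  by (intro borel_measurable_sum borel_measurable_times borel_measurable_const borel_measurable_prod
      borel_measurable_vec_nth assms)

text \<open>Cramer's rule expresses the entries of the inverse as quotients of polynomials in the
  entries of the matrix; this is what makes the inverse of a weight measurable.\<close>

definition cramer_inv :: "complex^'n^'n \<Rightarrow> complex^'n^'n" where
  "cramer_inv A = (\<chi> k j. det (\<chi> i l. if l = k then axis j 1 $ i else A $ i $ l) / det A)"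

lemma cramer_inv_eq:
  assumes "invertible A" shows "cramer_inv A = matrix_inv A"
proof -
  have d: "det A \<noteq> 0" using assms by (simp add: invertible_det_nz)
  have "cramer_inv A $ k $ j = matrix_inv A $ k $ j" for k j
  proof -
    have "A *v (matrix_inv A *v axis j 1) = axis j 1"
      using matrix_inv_works[OF assms] by (simp add: matrix_vector_mul_assoc)
    from this[unfolded cramer[OF d]]
    have "matrix_inv A *v axis j 1 = (\<chi> k. det (\<chi> i l. if l = k then axis j 1 $ i else A $ i $ l) / det A)" .
    from arg_cong[OF this, of "\<lambda>x. x $ k"] show ?thesis
      by (simp add: cramer_inv_def mv_axis_nth)
  qed
  then show ?thesis by (simp add: vec_eq_iff)
qed

lemma borel_measurable_cramer_inv:
  fixes F :: "'a \<Rightarrow> complex^'n^'n"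
  assumes F: "F \<in> borel_measurable M"
  shows "(\<lambda>x. cramer_inv (F x)) \<in> borel_measurable M"
proof (intro borel_measurable_vec_lambda)
  fix k j
  have "(\<lambda>x. \<chi> i l. if l = k then axis j 1 $ i else F x $ i $ l) \<in> borel_measurable M"
  proof (intro borel_measurable_vec_lambda)
    fix i l
    show "(\<lambda>x. (\<chi> i l. if l = k then axis j 1 $ i else F x $ i $ l) $ i $ l) \<in> borel_measurable M"
      by (cases "l = k") (simp_all add: borel_measurable_vec_nth F)
  qed
  then show "(\<lambda>x. cramer_inv (F x) $ k $ j) \<in> borel_measurable M"
    unfolding cramer_inv_def vec_lambda_beta
    by (rule borel_measurable_divide[OF borel_measurable_det borel_measurable_det[OF F]])
qed

lemma set_integral_linear:
  fixes f :: "real^'d \<Rightarrow> 'b::euclidean_space" and T :: "'b \<Rightarrow> 'c::euclidean_space"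
  assumes T: "linear T" and f: "set_integrable lebesgue I f"
  shows "set_integrable lebesgue I (\<lambda>x. T (f x))"
    and "(LINT x:I|lebesgue. T (f x)) = T (LINT x:I|lebesgue. f x)"
proof -
  have b: "bounded_linear T" using T by (rule linear_linear[THEN iffD2])
  have e: "(\<lambda>x. indicator I x *\<^sub>R T (f x)) = (\<lambda>x. T (indicator I x *\<^sub>R f x))"
    by (simp add: linear_scale[OF T])
  show "set_integrable lebesgue I (\<lambda>x. T (f x))"
    using f unfolding set_integrable_def e by (rule integrable_bounded_linear[OF b])
  show "(LINT x:I|lebesgue. T (f x)) = T (LINT x:I|lebesgue. f x)"
    using f unfolding set_integrable_def set_lebesgue_integral_def e by (rule integral_bounded_linear[OF b])
qed

lemma avg_linear:
  fixes f :: "real^'d \<Rightarrow> 'b::euclidean_space" and T :: "'b \<Rightarrow> 'c::euclidean_space"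
  assumes T: "linear T" and f: "set_integrable lebesgue I f"
  shows "T (avg I f) = avg I (\<lambda>x. T (f x))"
  by (simp add: avg_def linear_scale[OF T] set_integral_linear(2)[OF T f])

lemma linear_quad: "linear (\<lambda>M. quad M v)"
  by (rule linearI) (simp_all add: quad_add quad_scaleR)

lemma linear_adj: "linear (adj :: complex^'n^'n \<Rightarrow> _)"
  by (rule linearI) (auto simp: vec_eq_iff)

lemma linear_trace_mult: "linear (\<lambda>M. Re (trace (M ** P)))" for P :: "complex^'n^'n"
  by (rule linearI) (simp_all add: trace_def matrix_matrix_mult_def sum.distrib distrib_right
      sum_distrib_left scaleR_sum_right)

lemma trace_pos:
  fixes W U :: "complex^'n^'n"
  assumes W: "pos_def W" and U: "pos_def U"
  shows "0 < Re (trace (W ** U))"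
proof -
  obtain R :: "complex^'n^'n" and l :: "'n \<Rightarrow> real" where "\<And>i. 0 < l i" "Re (trace (matrix_inv (matrix_inv W) ** U)) = (\<Sum>i\<in>UNIV. l i)"
    by (rule relative_eigenvalues[OF pos_def_matrix_inv[OF W] U]) blast
  then show ?thesis by (simp add: matrix_inv_inv[OF W] sum_pos)
qed

lemma quad_le_trace:
  fixes W U :: "complex^'n^'n"
  assumes W: "pos_def W" and U: "pos_def U"
  shows "quad W z \<le> Re (trace (W ** U)) * quad (matrix_inv U) z"
  using trace_bounds(2)[OF W U, of "Re (trace (W ** U)) / real CARD('n)" z] trace_pos[OF W U] by simp

lemma pos_def_cross_le:
  assumes V: "pos_def V" shows "\<bar>x \<bullet> (V *v y)\<bar> \<le> quad V x + quad V y"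
proof -
  have "0 \<le> quad V (x + y)" "0 \<le> quad V (x - y)" "0 \<le> quad V x" "0 \<le> quad V y" by (auto intro: quad_nonneg[OF V])
  moreover have "quad V (x + y) = quad V x + quad V y + 2 * (x \<bullet> (V *v y))"
    "quad V (x - y) = quad V x + quad V y - 2 * (x \<bullet> (V *v y))"
    using pos_def_inner[OF V, of y x]
    by (simp_all add: quad_def matrix_vector_mult_diff_distrib matrix_vector_right_distrib
        inner_add_left inner_add_right inner_diff_left inner_diff_right inner_commute)
  ultimately show ?thesis by linarith
qed

text \<open>The diagonal of a positive definite form controls its off-diagonal entries; the vectors with entry \<i> serve to
  recover the imaginary parts.\<close>

lemma norm_pos_def_le:
  fixes V :: "complex^'n^'n"
  assumes V: "pos_def V"
  shows "norm V \<le> (\<Sum>i\<in>UNIV. \<Sum>j\<in>UNIV. quad V (axis i 1) + quad V (axis i \<i>) + 2 * quad V (axis j 1))"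
proof -
  have "norm V \<le> (\<Sum>i\<in>UNIV. norm (V $ i))" unfolding norm_vec_def by (rule L2_set_le_sum) simp
  also have "\<dots> \<le> (\<Sum>i\<in>UNIV. \<Sum>j\<in>UNIV. norm (V $ i $ j))"
    by (intro sum_mono) (simp add: norm_vec_def[where 'a = complex] L2_set_le_sum)
  also have "\<dots> \<le> (\<Sum>i\<in>UNIV. \<Sum>j\<in>UNIV. quad V (axis i 1) + quad V (axis i \<i>) + 2 * quad V (axis j 1))"
  proof (intro sum_mono)
    fix i j :: 'n
    have "Re (V $ i $ j) = axis i 1 \<bullet> (V *v axis j 1)" "Im (V $ i $ j) = axis i \<i> \<bullet> (V *v axis j 1)"
      by (simp_all add: inner_axis' mv_axis_nth inner_complex_def)
    then have "\<bar>Re (V $ i $ j)\<bar> \<le> quad V (axis i 1) + quad V (axis j 1)"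
      "\<bar>Im (V $ i $ j)\<bar> \<le> quad V (axis i \<i>) + quad V (axis j 1)"
      using pos_def_cross_le[OF V] by metis+
    then show "norm (V $ i $ j) \<le> quad V (axis i 1) + quad V (axis i \<i>) + 2 * quad V (axis j 1)"
      using cmod_le[of "V $ i $ j"] by linarith
  qed
  finally show ?thesis .
qed

lemma set_integrable_weightI:
  fixes V :: "real^'d \<Rightarrow> complex^'n^'n"
  assumes V: "V \<in> borel_measurable lebesgue" and I: "I \<in> sets lebesgue"
    and p: "AE x in lebesgue. x \<in> I \<longrightarrow> pos_def (V x)"
    and q: "\<And>z. set_integrable lebesgue I (\<lambda>x. quad (V x) z)"
  shows "set_integrable lebesgue I V"
proof (rule set_integrable_bound)
  show "set_integrable lebesgue I (\<lambda>x. \<Sum>i\<in>UNIV. \<Sum>j\<in>UNIV. quad (V x) (axis i 1) + quad (V x) (axis i \<i>) + 2 * quad (V x) (axis j 1))"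
  proof -
    have q': "integrable lebesgue (\<lambda>x. indicator I x * quad (V x) z)" for z
      using q[of z] by (simp add: set_integrable_def)
    have "integrable lebesgue (\<lambda>x. \<Sum>i\<in>UNIV. \<Sum>j\<in>UNIV. indicator I x * quad (V x) (axis i 1)
        + indicator I x * quad (V x) (axis i \<i>) + 2 * (indicator I x * quad (V x) (axis j 1)))"
      by (intro Bochner_Integration.integrable_sum Bochner_Integration.integrable_add integrable_mult_right q')
    then show ?thesis by (simp add: set_integrable_def sum_distrib_left distrib_left mult.left_commute)
  qed
  show "set_borel_measurable lebesgue I V" unfolding set_borel_measurable_def
    using V I by (intro borel_measurable_scaleR borel_measurable_indicator)
  show "AE x in lebesgue. x \<in> I \<longrightarrow> norm (V x) \<le> norm (\<Sum>i\<in>UNIV. \<Sum>j\<in>UNIV. quad (V x) (axis i 1) + quad (V x) (axis i \<i>) + 2 * quad (V x) (axis j 1))"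
    using p
  proof eventually_elim
    case (elim x)
    then show ?case using norm_pos_def_le[of "V x"] by (auto intro: order_trans)
  qed
qed

text \<open>A weight together with its pointwise inverse, which is carried along as U so that the two enter symmetrically.
  The A2 condition is used only in its averaged form.\<close>

locale weight_pair = dyadic D for D :: "(real^'d) set set" +
  fixes W U :: "real^'d \<Rightarrow> complex^'n^'n" and A :: real
  assumes W_meas: "W \<in> borel_measurable lebesgue" and U_meas: "U \<in> borel_measurable lebesgue"
    and good: "AE x in lebesgue. pos_def (W x) \<and> pos_def (U x) \<and> matrix_inv (W x) = U x \<and> matrix_inv (U x) = W x"
    and W_int: "I \<in> D \<Longrightarrow> set_integrable lebesgue I W" and U_int: "I \<in> D \<Longrightarrow> set_integrable lebesgue I U"
    and A_pos: "0 < A" and A2: "I \<in> D \<Longrightarrow> Re (trace (avg I W ** avg I U)) \<le> real CARD('n) * A"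
begin

lemma pair_swap: "weight_pair D U W A"
proof unfold_locales
  show "AE x in lebesgue. pos_def (U x) \<and> pos_def (W x) \<and> matrix_inv (U x) = W x \<and> matrix_inv (W x) = U x"
    using good by (rule eventually_mono) blast
  show "Re (trace (avg I U ** avg I W)) \<le> real CARD('n) * A" if "I \<in> D" for I
    by (subst trace_mul_sym) (rule A2[OF that])
  show "U \<in> borel_measurable lebesgue" "W \<in> borel_measurable lebesgue" "0 < A" by (rule U_meas W_meas A_pos)+
  show "set_integrable lebesgue I U" "set_integrable lebesgue I W" if "I \<in> D" for I
    using U_int[OF that] W_int[OF that] .
qed

end

lemma pos_def_avg:
  fixes W :: "real^'d \<Rightarrow> complex^'n^'n"
  assumes m: "I \<in> sets lebesgue" "0 < measure lebesgue I" and W: "set_integrable lebesgue I W"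
    and p: "AE x in lebesgue. x \<in> I \<longrightarrow> pos_def (W x)"
  shows "pos_def (avg I W)"
proof -
  have "adj (avg I W) = avg I (\<lambda>x. adj (W x))" by (rule avg_linear[OF linear_adj W])
  also have "\<dots> = avg I W"
  proof -
    have "(LINT x:I|lebesgue. adj (W x)) = (LINT x:I|lebesgue. W x)"
      unfolding set_lebesgue_integral_def
    proof (rule integral_cong_AE)
      show "(\<lambda>x. indicator I x *\<^sub>R adj (W x)) \<in> borel_measurable lebesgue"
        using set_integral_linear(1)[OF linear_adj W] unfolding set_integrable_def by (rule borel_measurable_integrable)
      show "(\<lambda>x. indicator I x *\<^sub>R W x) \<in> borel_measurable lebesgue"
        using W unfolding set_integrable_def by (rule borel_measurable_integrable)
      show "AE x in lebesgue. indicator I x *\<^sub>R adj (W x) = indicator I x *\<^sub>R W x"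
        using p by eventually_elim (auto simp: indicator_def pos_def_def hermitian_adj)
    qed
    then show ?thesis by (simp add: avg_def)
  qed
  finally have h: "hermitian (avg I W)" by (simp add: hermitian_adj)
  have "0 < v \<bullet> (avg I W *v v)" if v: "v \<noteq> 0" for v
  proof -
    have int: "integrable lebesgue (\<lambda>x. indicator I x *\<^sub>R quad (W x) v)"
      using set_integral_linear(1)[OF linear_quad W] by (simp add: set_integrable_def)
    have nn: "AE x in lebesgue. 0 \<le> indicator I x *\<^sub>R quad (W x) v"
      using p by eventually_elim (auto simp: indicator_def intro: quad_nonneg)
    have "(LINT x|lebesgue. indicator I x *\<^sub>R quad (W x) v) \<noteq> 0"
    proof
      assume "(LINT x|lebesgue. indicator I x *\<^sub>R quad (W x) v) = 0"
      then have "AE x in lebesgue. indicator I x *\<^sub>R quad (W x) v = 0"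
        using integral_nonneg_eq_0_iff_AE[OF int nn] by simp
      then have "AE x in lebesgue. x \<notin> I" using p
      proof eventually_elim
        case (elim x)
        then show ?case using quad_pos[OF _ v, of "W x"] by (auto simp: indicator_def split: if_splits)
      qed
      then have "emeasure lebesgue I = 0" using m(1) by (simp add: AE_iff_measurable[OF m(1)])
      then show False using m(2) by (simp add: measure_def)
    qed
    then have "0 < (LINT x:I|lebesgue. quad (W x) v)"
      using integral_nonneg_AE[OF nn] by (simp add: set_lebesgue_integral_def)
    moreover have "quad (avg I W) v = avg I (\<lambda>x. quad (W x) v)" by (rule avg_linear[OF linear_quad W])
    ultimately have "0 < quad (avg I W) v" using m(2) by (simp add: avg_def)
    then show ?thesis by (simp add: quad_def)
  qed
  then show ?thesis using h by (simp add: pos_def_def)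
qed

context weight_pair begin

lemma W_avg_pos: "I \<in> D \<Longrightarrow> pos_def (avg I W)"
  by (rule pos_def_avg[OF sets_D m_pos W_int]) (use good in \<open>auto elim: eventually_mono\<close>)

text \<open>Jensen's inequality for the convex function taking a vector and a form to the value of the
  inverse form at the vector.\<close>

lemma jensen_quad_inv:
  assumes I: "I \<in> D" and X: "set_integrable lebesgue I X" and q: "set_integrable lebesgue I (\<lambda>x. quad (U x) (X x))"
  shows "m I * quad (matrix_inv (avg I W)) (avg I X) \<le> (LINT x:I|lebesgue. quad (U x) (X x))"
proof -
  define y where "y = matrix_inv (avg I W) *v avg I X"
  have e: "m I * t = (LINT x:I|lebesgue. g x)" if "t = avg I g" for t :: real and g
    using m_pos[OF I] by (simp add: that avg_def)
  have li: "linear (\<lambda>x. x \<bullet> y)" by (rule linearI) (simp_all add: inner_add_left)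
  note X1 = set_integral_linear[OF li X]
  note W1 = set_integral_linear[OF linear_quad W_int[OF I], of y]
  have "m I * quad (matrix_inv (avg I W)) (avg I X) = 2 * (m I * (avg I X \<bullet> y)) - m I * quad (avg I W) y"
    using quad_inv_self[OF W_avg_pos[OF I], of "avg I X"] by (simp add: y_def quad_def)
  also have "m I * (avg I X \<bullet> y) = (LINT x:I|lebesgue. X x \<bullet> y)" by (rule e[OF avg_linear[OF li X]])
  also have "m I * quad (avg I W) y = (LINT x:I|lebesgue. quad (W x) y)" by (rule e[OF avg_linear[OF linear_quad W_int[OF I]]])
  also have "2 * (LINT x:I|lebesgue. X x \<bullet> y) - (LINT x:I|lebesgue. quad (W x) y) = (LINT x:I|lebesgue. 2 * (X x \<bullet> y) - quad (W x) y)"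
    using X1 W1 by (subst set_integral_diff(2)) auto
  also have "\<dots> \<le> (LINT x:I|lebesgue. quad (U x) (X x))"
  proof (rule set_integral_mono_AE[OF _ q])
    show "set_integrable lebesgue I (\<lambda>x. 2 * (X x \<bullet> y) - quad (W x) y)" using X1 W1 by (intro set_integral_diff) auto
    show "AE x\<in>I in lebesgue. 2 * (X x \<bullet> y) - quad (W x) y \<le> quad (U x) (X x)"
      using good by eventually_elim (metis quad_inv_ge)
  qed
  finally show ?thesis .
qed

lemma quad_inv_U_le:
  assumes I: "I \<in> D" shows "quad (matrix_inv (avg I U)) v \<le> quad (avg I W) v"
proof -
  interpret sw: weight_pair D U W A by (rule pair_swap)
  have c: "set_integrable lebesgue I (\<lambda>x. v)"
    unfolding set_integrable_def using lmeasurable_D[OF I]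
    by (intro integrable_scaleR_left integrable_real_indicator) (auto simp: fmeasurable_def)
  have "avg I (\<lambda>x. v) = v"
  proof -
    have "(LINT x|lebesgue. indicat_real I x *\<^sub>R v) = m I *\<^sub>R v"
      using lmeasurable_D[OF I]
      by (subst integral_scaleR_left) (auto simp: fmeasurable_def intro!: integrable_real_indicator)
    then show ?thesis using m_pos[OF I] by (simp add: avg_def set_lebesgue_integral_def)
  qed
  moreover have "m I * quad (avg I W) v = (LINT x:I|lebesgue. quad (W x) v)"
    using m_pos[OF I] unfolding avg_linear[OF linear_quad W_int[OF I]] by (simp add: avg_def)
  ultimately have "m I * quad (matrix_inv (avg I U)) v \<le> m I * quad (avg I W) v"
    using sw.jensen_quad_inv[OF I c set_integral_linear(1)[OF linear_quad W_int[OF I]]] by simp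
  then show ?thesis using m_pos[OF I] by simp
qed

sublocale wt: matrix_weight_tree D "children D" m "2 ^ CARD('d)" "\<lambda>I. avg I W" "\<lambda>I. avg I U" "real CARD('n) * A"
proof
  interpret sw: weight_pair D U W A by (rule pair_swap)
  show "0 < real CARD('n) * A" using A_pos by simp
  fix I v assume I: "I \<in> D"
  show "pos_def (avg I W)" "pos_def (avg I U)" using W_avg_pos[OF I] sw.W_avg_pos[OF I] .
  then show "quad (avg I W) v \<le> real CARD('n) * A * quad (matrix_inv (avg I U)) v"
    by (rule trace_bounds(2)) (use A_pos A2[OF I] in auto)
  show "quad (matrix_inv (avg I U)) v \<le> quad (avg I W) v" by (rule quad_inv_U_le[OF I])
  show "m I *\<^sub>R avg I W = (\<Sum>c\<in>children D I. m c *\<^sub>R avg c W)" by (rule avg_children[OF I W_int[OF I]])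
  show "m I *\<^sub>R avg I U = (\<Sum>c\<in>children D I. m c *\<^sub>R avg c U)" by (rule avg_children[OF I U_int[OF I]])
qed

text \<open>Local integrability of a field follows from |2 <X,b>| \<le> <U X,X> + <W b,b>, applied to the vectors b of a basis.\<close>

lemma field_integrable:
  assumes X: "X \<in> borel_measurable lebesgue" and q: "integrable lebesgue (\<lambda>x. quad (U x) (X x))" and I: "I \<in> D"
  shows "set_integrable lebesgue I X"
proof (rule set_integrable_bound)
  show "set_integrable lebesgue I (\<lambda>x. \<Sum>b\<in>Basis. quad (U x) (X x) + quad (W x) b)"
  proof -
    have "set_integrable lebesgue I (\<lambda>x. quad (U x) (X x))"
      using q sets_D[OF I] unfolding set_integrable_def by (intro integrable_mult_indicator)
    moreover have "set_integrable lebesgue I (\<lambda>x. quad (W x) b)" for b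
      by (rule set_integral_linear(1)[OF linear_quad W_int[OF I]])
    ultimately have "integrable lebesgue (\<lambda>x. \<Sum>b\<in>Basis. indicator I x * quad (U x) (X x) + indicator I x * quad (W x) b)"
      unfolding set_integrable_def by (intro Bochner_Integration.integrable_sum Bochner_Integration.integrable_add) auto
    then show ?thesis by (simp only: set_integrable_def real_scaleR_def sum_distrib_left distrib_left)
  qed
  show "set_borel_measurable lebesgue I X" unfolding set_borel_measurable_def
    using X sets_D[OF I] by (intro borel_measurable_scaleR borel_measurable_indicator)
  show "AE x in lebesgue. x \<in> I \<longrightarrow> norm (X x) \<le> norm (\<Sum>b\<in>Basis. quad (U x) (X x) + quad (W x) b)"
    using good
  proof eventually_elim
    case (elim x)
    have "\<bar>X x \<bullet> b\<bar> \<le> quad (U x) (X x) + quad (W x) b" for b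
    proof -
      have "2 * (X x \<bullet> b) - quad (W x) b \<le> quad (U x) (X x)" "2 * (X x \<bullet> (- b)) - quad (W x) (- b) \<le> quad (U x) (X x)"
        using elim quad_inv_ge by metis+
      moreover have "quad (W x) (- b) = quad (W x) b" using quad_mult_scaleR[of "W x" "-1" b] by simp
      moreover have "0 \<le> quad (W x) b" "0 \<le> quad (U x) (X x)" using elim quad_nonneg by auto
      ultimately show ?thesis by simp
    qed
    then have "(\<Sum>b\<in>Basis. \<bar>X x \<bullet> b\<bar>) \<le> (\<Sum>b\<in>Basis. quad (U x) (X x) + quad (W x) b)" by (intro sum_mono)
    then show ?case using norm_le_l1[of "X x"] by (simp add: order_trans)
  qed
qed

lemma field_bounds:
  assumes X: "X \<in> borel_measurable lebesgue" and q: "integrable lebesgue (\<lambda>x. quad (U x) (X x))" and I: "I \<in> D"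
  shows "m I *\<^sub>R avg I X = (\<Sum>c\<in>children D I. m c *\<^sub>R avg c X)"
    and "m I * quad (matrix_inv (avg I W)) (avg I X) \<le> (LINT x:I|lebesgue. quad (U x) (X x))"
    and "(\<Sum>c\<in>children D I. (LINT x:c|lebesgue. quad (U x) (X x))) \<le> (LINT x:I|lebesgue. quad (U x) (X x))"
proof -
  have qI: "set_integrable lebesgue I (\<lambda>x. quad (U x) (X x))"
    using q sets_D[OF I] unfolding set_integrable_def by (intro integrable_mult_indicator)
  note XI = field_integrable[OF X q I]
  show "m I *\<^sub>R avg I X = (\<Sum>c\<in>children D I. m c *\<^sub>R avg c X)" by (rule avg_children[OF I XI])
  show "m I * quad (matrix_inv (avg I W)) (avg I X) \<le> (LINT x:I|lebesgue. quad (U x) (X x))"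
    by (rule jensen_quad_inv[OF I XI qI])
  show "(\<Sum>c\<in>children D I. (LINT x:c|lebesgue. quad (U x) (X x))) \<le> (LINT x:I|lebesgue. quad (U x) (X x))"
    using integral_children[OF I qI] by simp
qed

lemma quad_U_nonneg: "AE x in lebesgue. 0 \<le> quad (U x) (X x)"
  using good by eventually_elim (auto intro: quad_nonneg)

lemma weighted_embedding:
  assumes X: "X \<in> borel_measurable lebesgue" and q: "integrable lebesgue (\<lambda>x. quad (U x) (X x))"
    and F: "finite F" "F \<subseteq> D" and Q: "0 < Q"
    and l0: "\<And>J. J \<in> D \<Longrightarrow> 0 \<le> l J" and car: "\<And>J. J \<in> D \<Longrightarrow> tree.below F l J \<le> Q * m J"
  shows "(\<Sum>I\<in>F. l I * quad (matrix_inv (avg I W)) (avg I X))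
    \<le> 16 * (real CARD('n) * A) * Q * (LINT x|lebesgue. quad (U x) (X x))"
proof (rule sum_le_integral[OF F q quad_U_nonneg])
  show "0 \<le> 16 * (real CARD('n) * A) * Q" using A_pos Q by simp
  fix I assume I: "I \<in> D"
  show "tree.below F (\<lambda>I. l I * quad (matrix_inv (avg I W)) (avg I X)) I
     \<le> 16 * (real CARD('n) * A) * Q * (LINT x:I|lebesgue. quad (U x) (X x))"
    by (rule wt.carleson_embedding[OF F I Q l0 car field_bounds[OF X q]])
qed

lemma A_ge_1: "1 \<le> A"
proof -
  obtain b where I: "hcube b (2 powi 0) \<in> D" by (rule level_ex)
  have "real CARD('n) \<le> Re (trace (avg (hcube b (2 powi 0)) W ** avg (hcube b (2 powi 0)) U))"
    by (rule ldet_inv_le(2)[OF wt.W_pos[OF I] wt.U_pos[OF I] wt.inv_W_le[OF I]])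
  also have "\<dots> \<le> real CARD('n) * A" by (rule A2[OF I])
  finally show ?thesis by simp
qed

text \<open>The leading power of 2 bounds the number of signatures; the rest is the constant for a single signature.\<close>

definition square_const :: real where
  "square_const = 2 ^ CARD('d) * ((2 * 2 ^ CARD('d) + 32 * (real CARD('n))^2 * (sqrt (2 ^ CARD('d)) + 1)^2) * (A * log_ge1 A))"

lemma weighted_square_function:
  assumes X: "X \<in> borel_measurable lebesgue" and q: "integrable lebesgue (\<lambda>x. quad (U x) (X x))"
    and G: "finite G" "G \<subseteq> Sig \<times> D"
  shows "(\<Sum>(\<epsilon>, I)\<in>G. quad (matrix_inv (avg I W)) (LINT x|lebesgue. haar \<epsilon> I x *\<^sub>R X x))
    \<le> square_const * (LINT x|lebesgue. quad (U x) (X x))"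
proof -
  define L where "L = log_ge1 A"
  have L: "1 \<le> L" "ln A \<le> L" by (auto simp: L_def log_ge1_def)
  define R where "R = (sqrt (2 ^ CARD('d)) + 1)^2"
  have R: "0 \<le> R" by (simp add: R_def)
  define N where "N = (LINT x|lebesgue. quad (U x) (X x))"
  have N0: "0 \<le> N" unfolding N_def by (rule integral_nonneg_AE[OF quad_U_nonneg])
  define C where "C = 2 * 2 ^ CARD('d) + 32 * (real CARD('n) * A) * (R * (real CARD('n) * L))"
  have C0: "0 \<le> C" unfolding C_def using A_pos L R by (intro add_nonneg_nonneg mult_nonneg_nonneg) auto
  define c where "c \<epsilon> I = quad (matrix_inv (avg I W)) (LINT x|lebesgue. haar \<epsilon> I x *\<^sub>R X x)" for \<epsilon> I
  define F where "F \<epsilon> = {I. (\<epsilon>, I) \<in> G}" for \<epsilon>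
  have F: "finite (F \<epsilon>)" "F \<epsilon> \<subseteq> D" for \<epsilon>
  proof -
    have "F \<epsilon> \<subseteq> snd ` G" by (force simp: F_def)
    then show "finite (F \<epsilon>)" using G finite_subset by blast
    show "F \<epsilon> \<subseteq> D" using G by (auto simp: F_def)
  qed
  have one: "(\<Sum>I\<in>F \<epsilon>. c \<epsilon> I) \<le> C * N" if e: "\<epsilon> \<in> Sig" for \<epsilon>
    unfolding N_def
  proof (rule sum_le_integral[OF F q quad_U_nonneg C0])
    fix I assume I: "I \<in> D"
    have "tree.below (F \<epsilon>) (\<lambda>I. quad (matrix_inv (avg I W)) (\<Sum>c\<in>children D I. (haar_value \<epsilon> I c * m c) *\<^sub>R avg c X)) I
       \<le> C * (LINT x:I|lebesgue. quad (U x) (X x))"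
      unfolding C_def R_def
    proof (rule wt.square_function_le[OF F I _ _ field_bounds[OF X q]])
      show "0 < real CARD('n) * L" using L by simp
      fix J assume J: "J \<in> D"
      have "ldet (avg J W) + ldet (avg J U) \<le> real CARD('n) * ln A"
        by (rule trace_bounds(1)[OF wt.W_pos[OF J] wt.U_pos[OF J] A_pos A2[OF J]])
      also have "\<dots> \<le> real CARD('n) * L" using L by (intro mult_left_mono) auto
      finally show "ldet (avg J W) + ldet (avg J U) \<le> real CARD('n) * L" .
      show "(\<Sum>c\<in>children D J. haar_value \<epsilon> J c * m c) = 0" by (rule haar_value_mean[OF J e])
      show "(haar_value \<epsilon> J c)^2 * m J \<le> 1" if "c \<in> children D J" for c using haar_value_sq[OF J that] by simp
    qed
    moreover have "tree.below (F \<epsilon>) (c \<epsilon>) I = tree.below (F \<epsilon>) (\<lambda>I. quad (matrix_inv (avg I W)) (\<Sum>c\<in>children D I. (haar_value \<epsilon> I c * m c) *\<^sub>R avg c X)) I"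
      unfolding tree.below_def
    proof (rule sum.cong[OF refl])
      fix J assume "J \<in> {J \<in> F \<epsilon>. J \<subseteq> I}"
      then have J: "J \<in> D" using F by blast
      show "c \<epsilon> J = quad (matrix_inv (avg J W)) (\<Sum>c\<in>children D J. (haar_value \<epsilon> J c * m c) *\<^sub>R avg c X)"
        unfolding c_def integral_haar(1)[OF J field_integrable[OF X q J]] ..
    qed
    ultimately show "tree.below (F \<epsilon>) (c \<epsilon>) I \<le> C * (LINT x:I|lebesgue. quad (U x) (X x))" by simp
  qed
  have GS: "G = (SIGMA \<epsilon>:Sig. F \<epsilon>)" using G by (auto simp: F_def)
  have fS: "finite (Sig :: ('d \<Rightarrow> bool) set)" by simp
  have "(\<Sum>(\<epsilon>, I)\<in>G. c \<epsilon> I) = (\<Sum>\<epsilon>\<in>Sig. \<Sum>I\<in>F \<epsilon>. c \<epsilon> I)"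
    unfolding GS using F by (intro sum.Sigma[symmetric]) auto
  also have "\<dots> \<le> (\<Sum>\<epsilon>\<in>(Sig :: ('d \<Rightarrow> bool) set). C * N)" by (intro sum_mono one)
  also have "\<dots> = real (card (Sig :: ('d \<Rightarrow> bool) set)) * (C * N)" by simp
  also have "\<dots> \<le> 2 ^ CARD('d) * (C * N)"
  proof (rule mult_right_mono)
    have "card (Sig :: ('d \<Rightarrow> bool) set) \<le> card (UNIV :: ('d \<Rightarrow> bool) set)" by (intro card_mono) auto
    also have "\<dots> = 2 ^ CARD('d)" by (simp add: card_fun)
    finally have "real (card (Sig :: ('d \<Rightarrow> bool) set)) \<le> real (2 ^ CARD('d))" by (simp only: of_nat_le_iff)
    then show "real (card (Sig :: ('d \<Rightarrow> bool) set)) \<le> 2 ^ CARD('d)" by simp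
    show "0 \<le> C * N" using C0 N0 by simp
  qed
  also have "\<dots> \<le> square_const * N"
  proof -
    have "1 * 1 \<le> A * L" using A_ge_1 L by (intro mult_mono) auto
    then have "2 * 2 ^ CARD('d) * 1 \<le> 2 * 2 ^ CARD('d) * (A * L)" by (intro mult_left_mono) auto
    then have "C \<le> (2 * 2 ^ CARD('d) + 32 * (real CARD('n))^2 * R) * (A * L)"
      by (simp add: C_def power2_eq_square algebra_simps)
    then have "2 ^ CARD('d) * C \<le> square_const"
      unfolding square_const_def R_def L_def by (rule mult_left_mono) simp
    then show ?thesis using N0 by (simp add: mult.assoc[symmetric] mult_right_mono)
  qed
  finally show ?thesis unfolding c_def N_def .
qed

lemma square_const_pos: "0 < square_const"
proof -
  have "0 < log_ge1 A" by (simp add: log_ge1_def)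
  then show ?thesis unfolding square_const_def using A_pos by (intro mult_pos_pos add_pos_nonneg) auto
qed

definition haar_poly :: "(('d \<Rightarrow> bool) \<times> (real^'d) set) set \<Rightarrow> (('d \<Rightarrow> bool) \<times> (real^'d) set \<Rightarrow> complex^'n) \<Rightarrow> real^'d \<Rightarrow> complex^'n" where
  "haar_poly G a x = (\<Sum>p\<in>G. haar (fst p) (snd p) x *\<^sub>R a p)"

lemma haar_poly_measurable:
  assumes G: "G \<subseteq> Sig \<times> D" shows "haar_poly G a \<in> borel_measurable lebesgue"
proof -
  have "(\<lambda>x. haar (fst p) (snd p) x *\<^sub>R a p) \<in> borel_measurable lebesgue" if "p \<in> G" for p
    using haar_measurable[of "snd p" "fst p"] G that by (intro borel_measurable_scaleR borel_measurable_const) auto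
  then show ?thesis unfolding haar_poly_def[abs_def] by (rule borel_measurable_sum)
qed

lemma integrable_haar_mult:
  fixes f :: "real^'d \<Rightarrow> real"
  assumes I: "I \<in> D" and f: "integrable lebesgue f"
  shows "integrable lebesgue (\<lambda>x. haar \<epsilon> I x * f x)"
proof -
  have "set_integrable lebesgue I f" using f sets_D[OF I] unfolding set_integrable_def by (intro integrable_mult_indicator)
  from integral_haar(2)[OF I this, of \<epsilon>] show ?thesis by simp
qed

lemma integrable_quad_haar_poly:
  assumes G: "finite G" "G \<subseteq> Sig \<times> D"
  shows "integrable lebesgue (\<lambda>x. quad (W x) (haar_poly G a x))"
proof -
  have e: "quad (W x) (haar_poly G a x) = (\<Sum>p\<in>G. \<Sum>r\<in>G. haar (fst p) (snd p) x * (haar (fst r) (snd r) x * (a r \<bullet> (W x *v a p))))" for x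
    unfolding quad_def haar_poly_def linear_sum[OF matrix_vector_mul_linear]
    by (simp add: inner_sum_left inner_sum_right sum_distrib_left)
  show ?thesis unfolding e
  proof (intro Bochner_Integration.integrable_sum)
    fix p r assume "p \<in> G" "r \<in> G"
    then have p: "snd p \<in> D" and r: "snd r \<in> D" using G by auto
    have "linear (\<lambda>M::complex^'n^'n. a r \<bullet> (M *v a p))"
      by (rule linearI) (simp_all add: matrix_vector_mult_add_rdistrib inner_add_right)
    from integral_haar(2)[OF r set_integral_linear(1)[OF this W_int[OF r]], of "fst r"]
    have "integrable lebesgue (\<lambda>x. haar (fst r) (snd r) x * (a r \<bullet> (W x *v a p)))" by simp
    then show "integrable lebesgue (\<lambda>x. haar (fst p) (snd p) x * (haar (fst r) (snd r) x * (a r \<bullet> (W x *v a p))))"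
      by (rule integrable_haar_mult[OF p])
  qed
qed

text \<open>The norm of the Haar polynomial s is the pairing of its coefficients with those of g = W s, and the norm of
  g in L^2(U) equals that of s in L^2(W). The square function estimate for g therefore bounds s.\<close>

lemma haar_poly_norm_le:
  assumes G: "finite G" "G \<subseteq> Sig \<times> D"
  shows "(LINT x|lebesgue. quad (W x) (haar_poly G a x)) \<le> square_const * (\<Sum>p\<in>G. quad (avg (snd p) W) (a p))"
proof -
  define s where "s = haar_poly G a"
  define g where "g x = W x *v s x" for x
  define N where "N = (LINT x|lebesgue. quad (W x) (s x))"
  define C where "C = square_const"
  have C: "0 < C" unfolding C_def by (rule square_const_pos)
  have s: "s \<in> borel_measurable lebesgue" unfolding s_def by (rule haar_poly_measurable[OF G(2)])
  have g: "g \<in> borel_measurable lebesgue" unfolding g_def[abs_def] by (intro borel_measurable_matrix_vector W_meas s)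
  have int: "integrable lebesgue (\<lambda>x. quad (W x) (s x))" unfolding s_def by (rule integrable_quad_haar_poly[OF G])
  have eq: "AE x in lebesgue. quad (U x) (g x) = quad (W x) (s x)"
    using good by eventually_elim (metis g_def quad_inv_mv)
  have ms: "(\<lambda>x. quad (W x) (s x)) \<in> borel_measurable lebesgue" "(\<lambda>x. quad (U x) (g x)) \<in> borel_measurable lebesgue"
    by (intro borel_measurable_quad W_meas U_meas s g)+
  have intg: "integrable lebesgue (\<lambda>x. quad (U x) (g x))"
    using integrable_cong_AE[OF ms(2) ms(1) eq] int by simp
  have Ng: "(LINT x|lebesgue. quad (U x) (g x)) = N" unfolding N_def by (rule integral_cong_AE[OF ms(2) ms(1) eq])
  define b where "b p = (LINT x|lebesgue. haar (fst p) (snd p) x *\<^sub>R g x)" for p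
  have ib: "integrable lebesgue (\<lambda>x. haar (fst p) (snd p) x *\<^sub>R g x)" if "p \<in> G" for p
    by (rule integral_haar(2)[OF _ field_integrable[OF g intg]]) (use G that in auto)
  have "N = (LINT x|lebesgue. (\<Sum>p\<in>G. a p \<bullet> (haar (fst p) (snd p) x *\<^sub>R g x)))"
    unfolding N_def by (simp add: quad_def g_def s_def haar_poly_def inner_sum_left)
  also have "\<dots> = (\<Sum>p\<in>G. a p \<bullet> b p)"
    using ib by (subst Bochner_Integration.integral_sum) (auto simp: b_def simp del: inner_scaleR_right)
  finally have N: "N = (\<Sum>p\<in>G. a p \<bullet> b p)" .
  (* duality in the form 2 C <a,b> \<le> C^2 <W a,a> + <W^{-1} b,b>; half of the right hand side is absorbed *)
  have "2 * C * N \<le> (\<Sum>p\<in>G. C^2 * quad (avg (snd p) W) (a p) + quad (matrix_inv (avg (snd p) W)) (b p))"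
    unfolding N sum_distrib_left
  proof (rule sum_mono)
    fix p assume "p \<in> G"
    then have p: "snd p \<in> D" using G by auto
    have "2 * (b p \<bullet> (C *\<^sub>R a p)) - quad (avg (snd p) W) (C *\<^sub>R a p) \<le> quad (matrix_inv (avg (snd p) W)) (b p)"
      by (rule quad_inv_ge[OF wt.W_pos[OF p]])
    then show "2 * C * (a p \<bullet> b p) \<le> C^2 * quad (avg (snd p) W) (a p) + quad (matrix_inv (avg (snd p) W)) (b p)"
      by (simp add: quad_mult_scaleR inner_commute algebra_simps)
  qed
  also have "\<dots> = C^2 * (\<Sum>p\<in>G. quad (avg (snd p) W) (a p)) + (\<Sum>p\<in>G. quad (matrix_inv (avg (snd p) W)) (b p))"
    by (simp add: sum.distrib sum_distrib_left)
  also have "(\<Sum>p\<in>G. quad (matrix_inv (avg (snd p) W)) (b p)) \<le> C * N"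
    using weighted_square_function[OF g intg G] by (simp add: Ng C_def b_def case_prod_unfold)
  finally have "C * N \<le> C * (C * (\<Sum>p\<in>G. quad (avg (snd p) W) (a p)))"
    by (simp add: power2_eq_square algebra_simps)
  then show ?thesis using C by (simp add: N_def s_def C_def)
qed

end

section \<open>From the A2 condition to averages\<close>

lemma norm_mv_le_op_norm: "norm (M *v x) \<le> op_norm M * norm x"
  unfolding op_norm_def by (rule onorm[OF matrix_vector_mul_bounded_linear])

lemma op_norm_nonneg: "0 \<le> op_norm M"
  unfolding op_norm_def by (rule onorm_pos_le[OF matrix_vector_mul_bounded_linear])

text \<open>The trace is the squared Hilbert-Schmidt norm of W^{1/2} V^{-1/2}. As a minorant of the squared operator norm
  it has the advantage of being bilinear in W and V^{-1}, so that averaging in both variables yields the trace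
  of the product of the averages.\<close>

lemma trace_le_op_norm:
  fixes W V :: "complex^'n^'n"
  assumes W: "pos_def W" and V: "pos_def V"
  shows "Re (trace (W ** matrix_inv V)) \<le> real CARD('n) * (op_norm (msqrt W ** matrix_inv (msqrt V)))^2"
proof -
  define S where "S = msqrt W"
  define R where "R = msqrt V"
  define T where "T = matrix_inv R"
  have RT: "R ** T = mat 1" "T ** R = mat 1"
    unfolding T_def R_def using matrix_inv_works[OF invertible_msqrt[OF V]] by auto
  have SS: "S ** S = W" and RR: "R ** R = V" by (simp_all add: S_def R_def msqrt_works W V)
  have aS: "adj S = S" and aR: "adj R = R" by (simp_all add: S_def R_def adj_msqrt W V)
  have a1: "adj (mat 1) = (mat 1 :: complex^'n^'n)" by (auto simp: vec_eq_iff mat_def)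
  have "adj T ** R = mat 1" using arg_cong[OF RT(1), of adj] by (simp add: adj_mult aR a1)
  then have aT: "adj T = T" by (metis RT(1) matrix_mul_assoc matrix_mul_lid matrix_mul_rid)
  have "V ** (T ** T) = R ** (R ** T) ** T" by (simp add: RR[symmetric] matrix_mul_assoc)
  then have Vi: "matrix_inv V = T ** T" by (intro matrix_inv_eqI) (simp add: RT)
  define M where "M = S ** T"
  have aM: "adj M = T ** S" by (simp add: M_def adj_mult aS aT)
  have "trace (W ** matrix_inv V) = trace ((S ** S ** T) ** T)" by (simp only: Vi SS matrix_mul_assoc)
  also have "\<dots> = trace (T ** (S ** S ** T))" by (rule trace_mul_sym)
  also have "T ** (S ** S ** T) = adj M ** M" unfolding aM unfolding M_def by (simp only: matrix_mul_assoc)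
  finally have "Re (trace (W ** matrix_inv V)) = Re (trace (adj M ** M))" by simp
  also have "\<dots> = (\<Sum>i\<in>UNIV. (norm (M *v axis i 1))^2)"
  proof -
    have "Re ((adj M ** M) $ i $ i) = (norm (M *v axis i 1))^2" for i
    proof -
      have "(adj M ** M) $ i $ i = ((adj M ** M) *v axis i 1) $ i" by (simp add: mv_axis_nth)
      then have "Re ((adj M ** M) $ i $ i) = axis i 1 \<bullet> (adj M *v (M *v axis i 1))"
        by (simp add: inner_axis' inner_complex_def matrix_vector_mul_assoc)
      then show ?thesis by (simp add: adj_inner[symmetric] power2_norm_eq_inner)
    qed
    then show ?thesis by (simp add: trace_def)
  qed
  also have "\<dots> \<le> (\<Sum>i\<in>(UNIV::'n set). (op_norm M)^2)"
  proof (rule sum_mono)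
    fix i :: 'n
    have "norm (M *v axis i 1) \<le> op_norm M" using norm_mv_le_op_norm[of M "axis i 1"] by simp
    then show "(norm (M *v axis i 1))^2 \<le> (op_norm M)^2" by (intro power_mono) auto
  qed
  finally show ?thesis by (simp add: M_def S_def T_def R_def)
qed

text \<open>Against a fixed positive definite P, the trace dominates the form V, hence also its norm.\<close>

lemma set_integrable_quad_of_trace:
  fixes V :: "real^'d \<Rightarrow> complex^'n^'n"
  assumes V: "V \<in> borel_measurable lebesgue" and I: "I \<in> sets lebesgue" and m: "0 < measure lebesgue I"
    and p: "AE x in lebesgue. pos_def (V x)" and P: "pos_def P"
    and t: "(\<integral>\<^sup>+x\<in>I. ennreal (Re (trace (V x ** P)) / real CARD('n)) \<partial>lebesgue) < \<infinity>"
  shows "set_integrable lebesgue I V"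
    and "(\<integral>\<^sup>+x\<in>I. ennreal (Re (trace (V x ** P)) / real CARD('n)) \<partial>lebesgue)
       = ennreal (measure lebesgue I * (Re (trace (avg I V ** P)) / real CARD('n)))"
proof -
  define f where "f x = Re (trace (V x ** P)) / real CARD('n)" for x
  have lin: "linear (\<lambda>M::complex^'n^'n. Re (trace (M ** P)) / real CARD('n))"
    using linear_trace_mult[of P] by (simp add: linear_iff add_divide_distrib)
  have fm: "f \<in> borel_measurable lebesgue"
  proof -
    have "(\<lambda>M::complex^'n^'n. Re (trace (M ** P)) / real CARD('n)) \<in> borel_measurable borel"
      by (intro borel_measurable_continuous_onI linear_continuous_on linear_linear[THEN iffD2] lin)
    from measurable_compose[OF V this] show ?thesis by (simp add: f_def[abs_def])
  qed
  have f0: "AE x in lebesgue. 0 \<le> f x"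
    using p
  proof eventually_elim
    case (elim x)
    show ?case using trace_pos[OF elim P] by (simp add: f_def)
  qed
  have nn: "AE x in lebesgue. 0 \<le> indicator I x *\<^sub>R f x"
    using f0 by eventually_elim (auto simp: indicator_def)
  have e: "(\<integral>\<^sup>+x\<in>I. ennreal (f x) \<partial>lebesgue) = (\<integral>\<^sup>+x. ennreal (indicator I x *\<^sub>R f x) \<partial>lebesgue)"
    by (intro nn_integral_cong) (auto simp: indicator_def)
  have fi: "integrable lebesgue (\<lambda>x. indicator I x *\<^sub>R f x)"
  proof (rule integrableI_nonneg[OF _ nn])
    show "(\<lambda>x. indicator I x *\<^sub>R f x) \<in> borel_measurable lebesgue" using fm I by (intro borel_measurable_scaleR borel_measurable_indicator)
    show "(\<integral>\<^sup>+x. ennreal (indicator I x *\<^sub>R f x) \<partial>lebesgue) < \<infinity>" using t e by (simp add: f_def)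
  qed
  show Vi: "set_integrable lebesgue I V"
  proof (rule set_integrable_weightI[OF V I])
    show "AE x in lebesgue. x \<in> I \<longrightarrow> pos_def (V x)" using p by (rule eventually_mono) simp
    fix z
    show "set_integrable lebesgue I (\<lambda>x. quad (V x) z)"
    proof (rule set_integrable_bound)
      show "set_integrable lebesgue I (\<lambda>x. f x * (real CARD('n) * quad (matrix_inv P) z))"
        using fi by (intro set_integrable_mult_left) (simp add: set_integrable_def)
      show "set_borel_measurable lebesgue I (\<lambda>x. quad (V x) z)" unfolding set_borel_measurable_def
        using I by (intro borel_measurable_scaleR borel_measurable_indicator borel_measurable_quad V borel_measurable_const)
      show "AE x in lebesgue. x \<in> I \<longrightarrow> norm (quad (V x) z) \<le> norm (f x * (real CARD('n) * quad (matrix_inv P) z))"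
        using p
      proof eventually_elim
        case (elim x)
        have "quad (V x) z \<le> Re (trace (V x ** P)) * quad (matrix_inv P) z" by (rule quad_le_trace[OF elim P])
        also have "\<dots> = f x * (real CARD('n) * quad (matrix_inv P) z)" by (simp add: f_def)
        finally show ?case using quad_nonneg[OF elim, of z] by simp
      qed
    qed
  qed
  have "(\<integral>\<^sup>+x\<in>I. ennreal (f x) \<partial>lebesgue) = ennreal (LINT x:I|lebesgue. f x)"
    unfolding e set_lebesgue_integral_def by (rule nn_integral_eq_integral[OF fi nn])
  also have "(LINT x:I|lebesgue. f x) = measure lebesgue I * (Re (trace (avg I V ** P)) / real CARD('n))"
    unfolding avg_linear[OF lin Vi] using m by (simp add: avg_def f_def)
  finally show "(\<integral>\<^sup>+x\<in>I. ennreal (Re (trace (V x ** P)) / real CARD('n)) \<partial>lebesgue)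
       = ennreal (measure lebesgue I * (Re (trace (avg I V ** P)) / real CARD('n)))" by (simp add: f_def)
qed

text \<open>If the inner integral in the A2 condition is finite at a single point x at which W(x) is positive definite, then
  the inverse weight is integrable on I. Now the inner integral is known to be a multiple of the trace of
  W(x) U_I, and its integrability in x gives that of W.\<close>

lemma A2_averages:
  fixes W :: "real^'d \<Rightarrow> complex^'n^'n"
  assumes A2: "matrix_A2_weight W" and I: "I = hcube a l" "0 < l"
  defines "U \<equiv> \<lambda>x. cramer_inv (W x)"
  shows "set_integrable lebesgue I W" "set_integrable lebesgue I U"
    "Re (trace (avg I W ** avg I U)) \<le> real CARD('n) * enn2real (A2_const W)"
proof -
  define A where "A = enn2real (A2_const W)"
  have Wm: "W \<in> borel_measurable lebesgue" and p: "AE x in lebesgue. pos_def (W x)" and fin: "A2_const W < \<infinity>"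
    using A2 by (auto simp: matrix_A2_weight_def)
  have Um: "U \<in> borel_measurable lebesgue" unfolding U_def by (rule borel_measurable_cramer_inv[OF Wm])
  have Ui: "U x = matrix_inv (W x)" if "pos_def (W x)" for x
    unfolding U_def by (rule cramer_inv_eq[OF pos_def_invertible[OF that]])
  have Up: "AE x in lebesgue. pos_def (U x)"
    using p by eventually_elim (simp add: Ui pos_def_matrix_inv)
  have IS: "I \<in> sets lebesgue" by (simp add: I)
  define r where "r = measure lebesgue I"
  have r: "0 < r" using I by (simp add: r_def measure_hcube)
  have E: "emeasure lebesgue I = ennreal r"
    unfolding r_def using lmeasurable_hcube[of a l] I by (simp add: emeasure_eq_measure2)
  define n where "n = real CARD('n)"
  have n: "0 < n" by (simp add: n_def)
  define K where "K x = (\<integral>\<^sup>+t\<in>I. ennreal ((op_norm (msqrt (W x) ** matrix_inv (msqrt (W t))))\<^sup>2) \<partial>lebesgue)" for x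
  define \<tau> where "\<tau> x t = Re (trace (W x ** U t)) / n" for x t
  define g where "g x = (\<integral>\<^sup>+t\<in>I. ennreal (\<tau> x t) \<partial>lebesgue)" for x
  have bnd: "(\<integral>\<^sup>+x\<in>I. K x / ennreal r \<partial>lebesgue) \<le> ennreal (A * r)"
  proof -
    have "I \<in> cubes" using I by (auto simp: cubes_def)
    then have "(\<integral>\<^sup>+x\<in>I. K x / emeasure lebesgue I \<partial>lebesgue) / emeasure lebesgue I \<le> A2_const W"
      unfolding A2_const_def K_def by (rule SUP_upper)
    also have "\<dots> = ennreal A" using fin by (simp add: A_def)
    finally have "(\<integral>\<^sup>+x\<in>I. K x / ennreal r \<partial>lebesgue) / ennreal r * ennreal r \<le> ennreal A * ennreal r"
      unfolding E by (intro mult_right_mono) auto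
    moreover have "z / ennreal r * ennreal r = z" for z
      using r by (simp add: ennreal_divide_times)
    ultimately show ?thesis using r by (simp add: ennreal_mult' A_def)
  qed
  have gK: "g x \<le> K x" if x: "pos_def (W x)" for x
    unfolding g_def K_def
  proof (rule nn_integral_mono_AE)
    show "AE t in lebesgue. ennreal (\<tau> x t) * indicator I t
       \<le> ennreal ((op_norm (msqrt (W x) ** matrix_inv (msqrt (W t))))\<^sup>2) * indicator I t"
      using p
    proof eventually_elim
      case (elim t)
      have "\<tau> x t \<le> (op_norm (msqrt (W x) ** matrix_inv (msqrt (W t))))\<^sup>2"
        using trace_le_op_norm[OF x elim] n by (simp add: \<tau>_def Ui[OF elim] n_def field_simps)
      then show ?case by (intro mult_right_mono ennreal_leI) auto
    qed
  qed
  have gb: "(\<integral>\<^sup>+x\<in>I. g x / ennreal r \<partial>lebesgue) \<le> ennreal (A * r)"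
  proof (rule order_trans[OF _ bnd], rule nn_integral_mono_AE)
    show "AE x in lebesgue. g x / ennreal r * indicator I x \<le> K x / ennreal r * indicator I x"
      using p by eventually_elim (intro mult_right_mono divide_right_mono_ennreal gK, auto)
  qed
  have "\<exists>x. pos_def (W x) \<and> g x < \<infinity>"
  proof (rule ccontr)
    assume "\<not> ?thesis"
    then have top: "g x = \<infinity>" if "pos_def (W x)" for x using that by (metis infinity_ennreal_def top.not_eq_extremum)
    have "(\<integral>\<^sup>+x\<in>I. g x / ennreal r \<partial>lebesgue) = (\<integral>\<^sup>+x\<in>I. \<infinity> \<partial>lebesgue)"
      using p by (intro nn_integral_cong_AE) (auto elim!: eventually_mono simp: top ennreal_top_divide)
    also have "\<dots> = \<infinity> * emeasure lebesgue I" by (rule nn_integral_cmult_indicator[OF IS])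
    also have "\<dots> = \<infinity>" using r by (simp add: E ennreal_top_mult)
    finally show False using gb by (simp add: top_unique)
  qed
  (* a point at which the inner integral is finite *)
  then obtain x0 where x0: "pos_def (W x0)" "g x0 < \<infinity>" by blast
  have gx: "g x = (\<integral>\<^sup>+t\<in>I. ennreal (Re (trace (U t ** W x)) / real CARD('n)) \<partial>lebesgue)" for x
    unfolding g_def \<tau>_def n_def by (subst trace_mul_sym) (rule refl)
  show UI: "set_integrable lebesgue I U"
    by (rule set_integrable_quad_of_trace(1)[OF Um IS r[unfolded r_def] Up x0(1)]) (use x0(2) gx in simp)
  define P where "P = avg I U"
  have P: "pos_def P" unfolding P_def
    by (rule pos_def_avg[OF IS _ UI]) (use r Up in \<open>auto simp: r_def elim: eventually_mono\<close>)
  have ge: "g x / ennreal r = ennreal (Re (trace (W x ** P)) / n)" if "pos_def (W x)" "g x < \<infinity>" for x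
  proof -
    have "g x = ennreal (r * (Re (trace (P ** W x)) / n))"
      unfolding r_def P_def n_def gx
      by (rule set_integrable_quad_of_trace(2)[OF Um IS r[unfolded r_def] Up that(1)]) (use that(2) gx in simp)
    moreover have "Re (trace (P ** W x)) = Re (trace (W x ** P))" by (subst trace_mul_sym) (rule refl)
    moreover have "0 < Re (trace (W x ** P))" by (rule trace_pos[OF that(1) P])
    ultimately have "g x = ennreal (r * (Re (trace (W x ** P)) / n))" "0 \<le> r * (Re (trace (W x ** P)) / n)"
      using r n by auto
    then have "g x / ennreal r = ennreal (r * (Re (trace (W x ** P)) / n) / r)" using r by (simp only: divide_ennreal)
    then show ?thesis using r by simp
  qed
  have gle: "ennreal (Re (trace (W x ** P)) / n) \<le> g x / ennreal r" if "pos_def (W x)" for x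
  proof (cases "g x < \<infinity>")
    case True
    then show ?thesis using ge[OF that] by simp
  next
    case False
    then have "g x = \<infinity>" by (metis infinity_ennreal_def top.not_eq_extremum)
    then show ?thesis by (simp add: ennreal_top_divide)
  qed
  have tb: "(\<integral>\<^sup>+x\<in>I. ennreal (Re (trace (W x ** P)) / real CARD('n)) \<partial>lebesgue) \<le> ennreal (A * r)"
  proof (rule order_trans[OF _ gb], rule nn_integral_mono_AE)
    show "AE x in lebesgue. ennreal (Re (trace (W x ** P)) / real CARD('n)) * indicator I x \<le> g x / ennreal r * indicator I x"
      using p by eventually_elim (intro mult_right_mono gle[unfolded n_def], auto)
  qed
  have tf: "(\<integral>\<^sup>+x\<in>I. ennreal (Re (trace (W x ** P)) / real CARD('n)) \<partial>lebesgue) < \<infinity>"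
    using tb by (rule order_le_less_trans) simp
  note fin = set_integrable_quad_of_trace[OF Wm IS r[unfolded r_def] p P tf]
  show WI: "set_integrable lebesgue I W" by (rule fin(1))
  have "ennreal (r * (Re (trace (avg I W ** P)) / n)) \<le> ennreal (A * r)"
    using tb unfolding fin(2) by (simp add: r_def n_def)
  moreover have "0 \<le> A * r" using r by (simp add: A_def)
  ultimately have "r * (Re (trace (avg I W ** P)) / n) \<le> A * r" by (simp add: ennreal_le_iff)
  then have "r * (Re (trace (avg I W ** P)) / n) \<le> r * A" by (simp only: mult.commute)
  then have "Re (trace (avg I W ** P)) / n \<le> A" using r by (rule mult_left_le_imp_le)
  then show "Re (trace (avg I W ** avg I U)) \<le> real CARD('n) * enn2real (A2_const W)"
    using n by (simp add: n_def P_def A_def field_simps)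
qed

lemma weight_pair_of_A2:
  fixes W :: "real^'d \<Rightarrow> complex^'n^'n"
  assumes D: "dyadic_grid D" and A2: "matrix_A2_weight W"
  shows "weight_pair D W (\<lambda>x. cramer_inv (W x)) (enn2real (A2_const W))"
proof -
  interpret dyadic D by (rule dyadic.intro[OF D])
  define U where "U = (\<lambda>x. cramer_inv (W x))"
  have Wm: "W \<in> borel_measurable lebesgue" and p: "AE x in lebesgue. pos_def (W x)"
    using A2 by (auto simp: matrix_A2_weight_def)
  have good: "AE x in lebesgue. pos_def (W x) \<and> pos_def (U x) \<and> matrix_inv (W x) = U x \<and> matrix_inv (U x) = W x"
    using p
  proof eventually_elim
    case (elim x)
    then show ?case
      unfolding U_def cramer_inv_eq[OF pos_def_invertible[OF elim]]
      using pos_def_matrix_inv matrix_inv_inv by blast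
  qed
  have av: "set_integrable lebesgue I W" "set_integrable lebesgue I U"
    "Re (trace (avg I W ** avg I U)) \<le> real CARD('n) * enn2real (A2_const W)" if I: "I \<in> D" for I
  proof -
    obtain a k where "I = hcube a (2 powi k)" by (rule cube_ex[OF I])
    from A2_averages[OF A2 this, folded U_def] show "set_integrable lebesgue I W" "set_integrable lebesgue I U"
      "Re (trace (avg I W ** avg I U)) \<le> real CARD('n) * enn2real (A2_const W)" by simp_all
  qed
  have A: "0 < enn2real (A2_const W)"
  proof -
    obtain b where I: "hcube b (2 powi 0) \<in> D" by (rule level_ex)
    have "pos_def (avg (hcube b (2 powi 0)) W)"
      by (rule pos_def_avg[OF sets_D[OF I] m_pos[OF I] av(1)[OF I]]) (rule eventually_mono[OF good], simp)
    moreover have "pos_def (avg (hcube b (2 powi 0)) U)"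
      by (rule pos_def_avg[OF sets_D[OF I] m_pos[OF I] av(2)[OF I]]) (rule eventually_mono[OF good], simp)
    ultimately have "0 < Re (trace (avg (hcube b (2 powi 0)) W ** avg (hcube b (2 powi 0)) U))"
      by (rule trace_pos)
    with av(3)[OF I] have "0 < real CARD('n) * enn2real (A2_const W)" by linarith
    then show ?thesis by (simp add: zero_less_mult_iff)
  qed
  show ?thesis unfolding U_def[symmetric]
  proof unfold_locales
    show "U \<in> borel_measurable lebesgue" unfolding U_def by (rule borel_measurable_cramer_inv[OF Wm])
  qed (fact Wm good av A)+
qed

section \<open>Convergence of Haar series and the paraproduct\<close>

lemma esqrt_ennreal: "0 \<le> r \<Longrightarrow> esqrt (ennreal r) = ennreal (sqrt r)"
  by (simp add: esqrt_def)

lemma esqrt_mono: "x \<le> y \<Longrightarrow> esqrt x \<le> esqrt y"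
  by (cases x; cases y) (auto simp: esqrt_def top_unique intro!: ennreal_leI)

lemma esqrt_less_top: "esqrt x < top \<longleftrightarrow> x < top"
  by (auto simp: esqrt_def less_top)

lemma wL2_norm_quad:
  assumes "AE x in lebesgue. pos_def (W x)"
  shows "wL2_norm W f = esqrt (\<integral>\<^sup>+x. ennreal (quad (W x) (f x)) \<partial>lebesgue)"
proof -
  have "(\<integral>\<^sup>+x. ennreal ((norm (msqrt (W x) *v f x))\<^sup>2) \<partial>lebesgue) = (\<integral>\<^sup>+x. ennreal (quad (W x) (f x)) \<partial>lebesgue)"
    using assms by (intro nn_integral_cong_AE) (auto elim!: eventually_mono simp: norm_msqrt quad_def)
  then show ?thesis by (simp add: wL2_norm_def)
qed

text \<open>Fatou's lemma.\<close>

lemma nn_integral_limit_le: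
  fixes u :: "nat \<Rightarrow> 'a \<Rightarrow> real"
  assumes u: "\<And>k. u k \<in> borel_measurable M" and lim: "AE x in M. (\<lambda>k. u k x) \<longlonglongrightarrow> v x"
    and le: "\<And>k. k \<ge> N \<Longrightarrow> (\<integral>\<^sup>+x. ennreal (u k x) \<partial>M) \<le> r"
  shows "(\<integral>\<^sup>+x. ennreal (v x) \<partial>M) \<le> r"
proof -
  have "(\<integral>\<^sup>+x. ennreal (v x) \<partial>M) = (\<integral>\<^sup>+x. liminf (\<lambda>k. ennreal (u k x)) \<partial>M)"
  proof (rule nn_integral_cong_AE)
    show "AE x in M. ennreal (v x) = liminf (\<lambda>k. ennreal (u k x))"
      using lim
    proof eventually_elim
      case (elim x)
      then have "(\<lambda>k. ennreal (u k x)) \<longlonglongrightarrow> ennreal (v x)" by (rule tendsto_ennrealI)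
      then show ?case by (simp add: lim_imp_Liminf)
    qed
  qed
  also have "\<dots> \<le> liminf (\<lambda>k. \<integral>\<^sup>+x. ennreal (u k x) \<partial>M)"
    using u by (intro nn_integral_liminf) simp
  also have "\<dots> \<le> limsup (\<lambda>k. \<integral>\<^sup>+x. ennreal (u k x) \<partial>M)" by (rule Liminf_le_Limsup) simp
  also have "\<dots> \<le> r" by (rule Limsup_bounded) (use le in \<open>auto simp: eventually_sequentially\<close>)
  finally show ?thesis .
qed

lemma pos_def_norm_le:
  assumes "pos_def P" obtains c where "0 \<le> c" "\<And>x. norm x \<le> c * sqrt (quad P x)"
proof
  define T where "T = matrix_inv (msqrt P)"
  show "0 \<le> op_norm T" by (rule op_norm_nonneg)
  fix x
  have "x = T *v (msqrt P *v x)"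
    using matrix_inv_works(2)[OF invertible_msqrt[OF assms]] by (simp add: T_def matrix_vector_mul_assoc)
  then have "norm x \<le> op_norm T * norm (msqrt P *v x)" by (metis norm_mv_le_op_norm)
  also have "norm (msqrt P *v x) = sqrt (quad P x)"
    using norm_msqrt[OF assms, of x] by (simp add: quad_def real_sqrt_unique)
  finally show "norm x \<le> op_norm T * sqrt (quad P x)" .
qed

text \<open>Cauchy's criterion for unconditional summability.\<close>

lemma finite_tail:
  fixes T :: "'a \<Rightarrow> real"
  assumes T0: "\<And>p. p \<in> X \<Longrightarrow> 0 \<le> T p" and bd: "\<And>G. finite G \<Longrightarrow> G \<subseteq> X \<Longrightarrow> sum T G \<le> S" and e: "0 < e"
  shows "\<exists>F. finite F \<and> F \<subseteq> X \<and> (\<forall>G. finite G \<and> G \<subseteq> X - F \<longrightarrow> sum T G \<le> e)"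
proof -
  have sm: "T summable_on X"
    using T0 bd by (intro nonneg_bdd_above_summable_on bdd_aboveI[of _ S]) auto
  define L where "L = infsum T X"
  have "(sum T \<longlongrightarrow> L) (finite_subsets_at_top X)" unfolding L_def by (rule infsum_tendsto[OF sm])
  then have "\<forall>\<^sub>F F in finite_subsets_at_top X. L - e < sum T F"
    by (rule order_tendstoD(1)) (use e in simp)
  then obtain F where F: "finite F" "F \<subseteq> X" "L - e < sum T F"
    unfolding eventually_finite_subsets_at_top by blast
  have "sum T G \<le> e" if G: "finite G" "G \<subseteq> X - F" for G
  proof -
    have "sum T (F \<union> G) \<le> L"
      unfolding L_def using F G T0 by (intro finite_sum_le_infsum sm) auto
    moreover have "sum T (F \<union> G) = sum T F + sum T G" using F G by (intro sum.union_disjoint) auto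
    ultimately show ?thesis using F by linarith
  qed
  then show ?thesis using F by blast
qed

context weight_pair begin

lemma haar_poly_nn_integral_le:
  assumes G: "finite G" "G \<subseteq> Sig \<times> D" and le: "(\<Sum>p\<in>G. quad (avg (snd p) W) (a p)) \<le> e"
  shows "(\<integral>\<^sup>+x. ennreal (quad (W x) (haar_poly G a x)) \<partial>lebesgue) \<le> ennreal (square_const * e)"
proof -
  have "AE x in lebesgue. 0 \<le> quad (W x) (haar_poly G a x)"
    using good by eventually_elim (auto intro: quad_nonneg)
  then have "(\<integral>\<^sup>+x. ennreal (quad (W x) (haar_poly G a x)) \<partial>lebesgue) = ennreal (LINT x|lebesgue. quad (W x) (haar_poly G a x))"
    by (rule nn_integral_eq_integral[OF integrable_quad_haar_poly[OF G]])
  also have "\<dots> \<le> ennreal (square_const * e)"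
    using haar_poly_norm_le[OF G, of a] mult_left_mono[OF le less_imp_le[OF square_const_pos]]
    by (intro ennreal_leI) linarith
  finally show ?thesis .
qed

lemma haar_poly_diff:
  assumes "finite F" "finite G"
  shows "haar_poly F a x - haar_poly G a x
    = haar_poly ((F - G) \<union> (G - F)) (\<lambda>p. if p \<in> F then a p else - a p) x"
proof -
  define h where "h p = haar (fst p) (snd p) x *\<^sub>R a p" for p
  have "haar_poly ((F - G) \<union> (G - F)) (\<lambda>p. if p \<in> F then a p else - a p) x
    = (\<Sum>p\<in>F - G. h p) + (\<Sum>p\<in>G - F. - h p)"
    unfolding haar_poly_def using assms
    by (subst sum.union_disjoint) (auto intro!: arg_cong2[where f = "(+)"] sum.cong simp: h_def)
  also have "\<dots> = (sum h (F - G) + sum h (F \<inter> G)) - (sum h (G - F) + sum h (F \<inter> G))"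
    by (simp add: sum_negf)
  also have "sum h (F - G) + sum h (F \<inter> G) = sum h F"
    using sum.Int_Diff[OF assms(1), of h G] by simp
  also have "sum h (G - F) + sum h (F \<inter> G) = sum h G"
    using sum.Int_Diff[OF assms(2), of h F] by (simp add: Int_commute)
  finally show ?thesis by (simp add: haar_poly_def h_def)
qed

lemma haar_poly_diff_le:
  assumes F: "finite F" "F \<subseteq> Sig \<times> D" and G: "finite G" "G \<subseteq> Sig \<times> D"
    and le: "(\<Sum>p\<in>(F - G) \<union> (G - F). quad (avg (snd p) W) (a p)) \<le> e"
  shows "(\<integral>\<^sup>+x. ennreal (quad (W x) (haar_poly F a x - haar_poly G a x)) \<partial>lebesgue) \<le> ennreal (square_const * e)"
  unfolding haar_poly_diff[OF F(1) G(1)]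
proof (rule haar_poly_nn_integral_le)
  have "(\<Sum>p\<in>(F - G) \<union> (G - F). quad (avg (snd p) W) (if p \<in> F then a p else - a p))
      = (\<Sum>p\<in>(F - G) \<union> (G - F). quad (avg (snd p) W) (a p))"
    by (intro sum.cong refl) (simp add: quad_minus)
  then show "(\<Sum>p\<in>(F - G) \<union> (G - F). quad (avg (snd p) W) (if p \<in> F then a p else - a p)) \<le> e" using le by simp
qed (use F G in auto)

text \<open>Finite subfamilies with geometrically decreasing tails give a sequence of partial sums that converges almost
  everywhere. Its limit g is the sum of the series in L^2(W): by Fatou's lemma, the distance from g to a
  partial sum inherits the bound for the distances between partial sums.\<close>

lemma haar_series_converges:
  assumes bd: "\<And>G. finite G \<Longrightarrow> G \<subseteq> Sig \<times> D \<Longrightarrow> (\<Sum>p\<in>G. quad (avg (snd p) W) (a p)) \<le> S"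
  obtains g where "g \<in> borel_measurable lebesgue"
    "(\<integral>\<^sup>+x. ennreal (quad (W x) (g x)) \<partial>lebesgue) \<le> ennreal (square_const * S)"
    "((\<lambda>F. wL2_norm W (\<lambda>x. g x - haar_poly F a x)) \<longlongrightarrow> 0) (finite_subsets_at_top (Sig \<times> D))"
proof -
  define X where "X = (Sig :: ('d \<Rightarrow> bool) set) \<times> D"
  define T where "T p = quad (avg (snd p) W) (a p)" for p
  have T0: "0 \<le> T p" if "p \<in> X" for p unfolding T_def by (rule quad_nonneg[OF W_avg_pos]) (use that X_def in auto)
  (* tails of size 4^{-k} leave a factor 2^{-k} after the weighting with 2^k used for pointwise convergence *)
  define \<delta> :: "nat \<Rightarrow> real" where "\<delta> k = (1/4)^k" for k
  have "\<forall>k. \<exists>F. finite F \<and> F \<subseteq> X \<and> (\<forall>G. finite G \<and> G \<subseteq> X - F \<longrightarrow> sum T G \<le> \<delta> k)"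
    by (intro allI finite_tail[where X = X and T = T and S = S] T0)
      (use bd in \<open>auto simp: X_def T_def[abs_def] \<delta>_def\<close>)
  then obtain E where E: "\<And>k. finite (E k)" "\<And>k. E k \<subseteq> X" "\<And>k G. finite G \<Longrightarrow> G \<subseteq> X - E k \<Longrightarrow> sum T G \<le> \<delta> k"
    by metis
  define F where "F k = (\<Union>i\<le>k. E i)" for k
  have F: "finite (F k)" "F k \<subseteq> X" for k using E by (auto simp: F_def)
  have Fm: "F k \<subseteq> F l" if "k \<le> l" for k l
    unfolding F_def by (intro UN_mono) (use that in auto)
  have tail: "sum T G \<le> \<delta> k" if "finite G" "G \<subseteq> X - F k" for G k
    using that by (intro E(3)) (auto simp: F_def)
  define s where "s k = haar_poly (F k) a" for k
  have s: "s k \<in> borel_measurable lebesgue" for k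
    unfolding s_def by (rule haar_poly_measurable) (use F X_def in auto)
  define C where "C = square_const"
  have C: "0 < C" unfolding C_def by (rule square_const_pos)
  have near: "(\<integral>\<^sup>+x. ennreal (quad (W x) (s l x - haar_poly G a x)) \<partial>lebesgue) \<le> ennreal (C * \<delta> k)"
    if "k \<le> l" "finite G" "G \<subseteq> X" "F k \<subseteq> G" for k l G
    unfolding s_def C_def
    by (rule haar_poly_diff_le) (use F X_def that Fm[OF that(1)] in \<open>auto intro!: tail[unfolded T_def]\<close>)
  define d where "d k x = s (Suc k) x - s k x" for k x
  have dm: "d k \<in> borel_measurable lebesgue" for k unfolding d_def[abs_def] by (intro borel_measurable_diff s)
  have dk: "(\<integral>\<^sup>+x. ennreal (2^k * quad (W x) (d k x)) \<partial>lebesgue) \<le> ennreal (C * (1/2)^k)" for k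
  proof -
    have "(\<integral>\<^sup>+x. ennreal (2^k * quad (W x) (d k x)) \<partial>lebesgue) = ennreal (2^k) * (\<integral>\<^sup>+x. ennreal (quad (W x) (d k x)) \<partial>lebesgue)"
      by (subst nn_integral_cmult[symmetric])
        (auto simp: ennreal_mult' intro!: borel_measurable_quad W_meas dm measurable_compose[OF _ measurable_ennreal])
    also have "\<dots> \<le> ennreal (2^k) * ennreal (C * \<delta> k)"
      unfolding d_def using near[of k "Suc k" "F k"] F by (intro mult_left_mono) (auto simp: s_def)
    also have "\<dots> = ennreal (C * (1/2)^k)"
      using C by (simp add: \<delta>_def ennreal_mult'[symmetric] power_mult_distrib[symmetric] mult.left_commute[of "2^k"])
    finally show ?thesis .
  qed
  have conv: "AE x in lebesgue. convergent (\<lambda>k. s k x)"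
  proof -
    have m: "(\<lambda>x. ennreal (2^k * quad (W x) (d k x))) \<in> borel_measurable lebesgue" for k
      by (intro measurable_compose[OF _ measurable_ennreal] borel_measurable_times borel_measurable_const borel_measurable_quad W_meas dm)
    have "(\<integral>\<^sup>+x. (\<Sum>k. ennreal (2^k * quad (W x) (d k x))) \<partial>lebesgue) = (\<Sum>k. \<integral>\<^sup>+x. ennreal (2^k * quad (W x) (d k x)) \<partial>lebesgue)"
      by (rule nn_integral_suminf[OF m])
    also have "\<dots> \<le> (\<Sum>k. ennreal (C * (1/2)^k))" by (intro suminf_le dk) auto
    also have "\<dots> = ennreal (\<Sum>k. C * (1/2)^k)"
      using C by (intro suminf_ennreal2 summable_mult summable_geometric) auto
    also have "\<dots> < \<infinity>" by simp
    finally have "AE x in lebesgue. (\<Sum>k. ennreal (2^k * quad (W x) (d k x))) \<noteq> \<infinity>"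
      by (intro nn_integral_noteq_infinite borel_measurable_suminf_order m) auto
    then show ?thesis using good
    proof eventually_elim
      case (elim x)
      define B where "B = enn2real (\<Sum>k. ennreal (2^k * quad (W x) (d k x)))"
      have W: "pos_def (W x)" using elim by blast
      have q: "quad (W x) (d k x) \<le> B * (1/2)^k" for k
      proof -
        have "ennreal (2^k * quad (W x) (d k x)) \<le> (\<Sum>k. ennreal (2^k * quad (W x) (d k x)))"
          using sum_le_suminf[OF summableI, of "{k}" "\<lambda>k. ennreal (2^k * quad (W x) (d k x))"] by simp
        also have "\<dots> = ennreal B" using elim by (simp add: B_def less_top)
        finally have "2^k * quad (W x) (d k x) \<le> B" by (simp add: B_def ennreal_le_iff)
        then show ?thesis by (simp add: field_simps power_divide)
      qed
      obtain c where c: "0 \<le> c" "\<And>z. norm z \<le> c * sqrt (quad (W x) z)" using pos_def_norm_le[OF W] by blast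
      have nd: "norm (d k x) \<le> c * sqrt B * (sqrt (1/2))^k" for k
      proof -
        have "sqrt (quad (W x) (d k x)) \<le> sqrt (B * (1/2)^k)" using q by simp
        also have "\<dots> = sqrt B * (sqrt (1/2))^k" by (simp add: real_sqrt_mult real_sqrt_power)
        finally have "c * sqrt (quad (W x) (d k x)) \<le> c * (sqrt B * (sqrt (1/2))^k)" by (rule mult_left_mono[OF _ c(1)])
        then show ?thesis using c(2)[of "d k x"] by (simp only: mult.assoc)
      qed
      have sm: "summable (\<lambda>k. c * sqrt B * (sqrt (1/2))^k)"
        by (intro summable_mult summable_geometric) (simp add: real_sqrt_lt_1_iff)
      have "summable (\<lambda>k. d k x)" by (rule summable_comparison_test'[OF sm nd])
      then have "(\<lambda>k. (\<Sum>i<k. d i x)) \<longlonglongrightarrow> (\<Sum>i. d i x)" by (rule summable_LIMSEQ)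
      then have "(\<lambda>k. s k x - s 0 x) \<longlonglongrightarrow> (\<Sum>i. d i x)"
      proof -
        have "(\<Sum>i<k. d i x) = s k x - s 0 x" for k
          unfolding d_def by (rule sum_lessThan_telescope[of "\<lambda>i. s i x"])
        then show "(\<lambda>k. \<Sum>i<k. d i x) \<longlonglongrightarrow> (\<Sum>i. d i x) \<Longrightarrow> (\<lambda>k. s k x - s 0 x) \<longlonglongrightarrow> (\<Sum>i. d i x)"
          by (simp only:)
      qed
      then have "(\<lambda>k. s k x - s 0 x + s 0 x) \<longlonglongrightarrow> (\<Sum>i. d i x) + s 0 x" by (intro tendsto_add tendsto_const)
      then show ?case by (auto simp: convergent_def)
    qed
  qed
  define g where "g x = lim (\<lambda>k. s k x)" for x
  have gm: "g \<in> borel_measurable lebesgue" unfolding g_def[abs_def] by (rule borel_measurable_lim_metric[OF s])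
  have glim: "AE x in lebesgue. (\<lambda>k. s k x) \<longlonglongrightarrow> g x"
    using conv by eventually_elim (simp add: g_def convergent_LIMSEQ_iff)
  have fatou: "(\<integral>\<^sup>+x. ennreal (quad (W x) (g x - h x)) \<partial>lebesgue) \<le> r"
    if h: "h \<in> borel_measurable lebesgue" and r: "\<And>k. k \<ge> N \<Longrightarrow> (\<integral>\<^sup>+x. ennreal (quad (W x) (s k x - h x)) \<partial>lebesgue) \<le> r" for h r N
  proof (rule nn_integral_limit_le[OF _ _ r])
    show "(\<lambda>x. quad (W x) (s k x - h x)) \<in> borel_measurable lebesgue" for k
      by (intro borel_measurable_quad W_meas borel_measurable_diff s h)
    show "AE x in lebesgue. (\<lambda>k. quad (W x) (s k x - h x)) \<longlonglongrightarrow> quad (W x) (g x - h x)"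
      using glim
    proof eventually_elim
      case (elim x)
      have "(\<lambda>k. s k x - h x) \<longlonglongrightarrow> g x - h x" using elim by (intro tendsto_diff tendsto_const)
      then show ?case unfolding quad_def
        by (intro tendsto_inner bounded_linear.tendsto[OF matrix_vector_mul_bounded_linear])
    qed
  qed
  have p: "AE x in lebesgue. pos_def (W x)" using good by (rule eventually_mono) simp
  show ?thesis
  proof (rule that[OF gm])
    have "(\<integral>\<^sup>+x. ennreal (quad (W x) (g x - 0)) \<partial>lebesgue) \<le> ennreal (square_const * S)"
    proof (rule fatou[of _ 0])
      fix k
      have "(\<integral>\<^sup>+x. ennreal (quad (W x) (s k x)) \<partial>lebesgue) \<le> ennreal (square_const * S)"
        unfolding s_def by (rule haar_poly_nn_integral_le) (use F X_def bd in auto)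
      then show "(\<integral>\<^sup>+x. ennreal (quad (W x) (s k x - 0)) \<partial>lebesgue) \<le> ennreal (square_const * S)" by simp
    qed simp
    then show "(\<integral>\<^sup>+x. ennreal (quad (W x) (g x)) \<partial>lebesgue) \<le> ennreal (square_const * S)" by simp
    show "((\<lambda>F. wL2_norm W (\<lambda>x. g x - haar_poly F a x)) \<longlongrightarrow> 0) (finite_subsets_at_top (Sig \<times> D))"
    proof (rule order_tendstoI)
      fix b :: ennreal assume b: "0 < b"
      have "(\<lambda>k. sqrt (C * (1/4)^k)) \<longlonglongrightarrow> sqrt (C * 0)"
        by (intro tendsto_intros LIMSEQ_power_zero) auto
      then have "(\<lambda>k. ennreal (sqrt (C * \<delta> k))) \<longlonglongrightarrow> ennreal 0" unfolding \<delta>_def by (intro tendsto_ennrealI) simp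
      then have "\<forall>\<^sub>F k in sequentially. ennreal (sqrt (C * \<delta> k)) < b" by (rule order_tendstoD(2)) (use b in simp)
      then obtain k where k: "ennreal (sqrt (C * \<delta> k)) < b" by (auto simp: eventually_sequentially)
      have "wL2_norm W (\<lambda>x. g x - haar_poly G a x) < b" if G: "finite G" "F k \<subseteq> G" "G \<subseteq> X" for G
      proof -
        have "(\<integral>\<^sup>+x. ennreal (quad (W x) (g x - haar_poly G a x)) \<partial>lebesgue) \<le> ennreal (C * \<delta> k)"
          by (rule fatou[of _ k]) (use G X_def near in \<open>auto intro!: haar_poly_measurable\<close>)
        from esqrt_mono[OF this] have "wL2_norm W (\<lambda>x. g x - haar_poly G a x) \<le> ennreal (sqrt (C * \<delta> k))"
          using C by (simp add: wL2_norm_quad[OF p] esqrt_ennreal \<delta>_def)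
        then show ?thesis using k by (rule order_le_less_trans)
      qed
      then show "\<forall>\<^sub>F F in finite_subsets_at_top (Sig \<times> D). wL2_norm W (\<lambda>x. g x - haar_poly F a x) < b"
        unfolding eventually_finite_subsets_at_top X_def[symmetric] using F by (intro exI[of _ "F k"]) auto
    qed simp
  qed
qed

text \<open>The numbers b_I = ||V_I B_I V_I^{-1}||^2 form a Carleson sequence by the definition of the norm of B.
  The embedding theorem for the inverse weight applies to them once W_I has been replaced by U_I^{-1}, which
  costs one more factor A.\<close>

lemma paraproduct_coefficients_le:
  fixes B :: "real^'d \<Rightarrow> complex^'n^'n"
  assumes f: "f \<in> borel_measurable lebesgue" and q: "integrable lebesgue (\<lambda>x. quad (W x) (f x))"
    and star: "star_norm D W B \<le> ennreal Q" and Q0: "0 \<le> Q"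
    and G: "finite G" "G \<subseteq> Sig \<times> D"
  shows "(\<Sum>p\<in>G. quad (avg (snd p) W) (haar_coeff B (fst p) (snd p) *v avg (snd p) f))
    \<le> 16 * (real CARD('n) * A)^2 * Q * (LINT x|lebesgue. quad (W x) (f x))"
proof -
  interpret sw: weight_pair D U W A by (rule pair_swap)
  define b where "b \<epsilon> I = (op_norm (msqrt (avg I W) ** haar_coeff B \<epsilon> I ** matrix_inv (msqrt (avg I W))))\<^sup>2" for \<epsilon> I
  have b0: "0 \<le> b \<epsilon> I" for \<epsilon> I by (simp add: b_def)
  define l where "l I = (\<Sum>\<epsilon>\<in>Sig. b \<epsilon> I)" for I
  have l0: "0 \<le> l I" for I unfolding l_def by (intro sum_nonneg b0)
  have nA: "0 \<le> real CARD('n) * A" using A_pos by simp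
  define N where "N = (LINT x|lebesgue. quad (W x) (f x))"
  define F where "F = snd ` G"
  have F: "finite F" "F \<subseteq> D" using G by (auto simp: F_def)
  have car: "tree.below F l J \<le> Q * m J" if J: "J \<in> D" for J
  proof -
    define FJ where "FJ = {I\<in>F. I \<subseteq> J}"
    have FJ: "finite FJ" "FJ \<subseteq> {I\<in>D. I \<subseteq> J}" using F by (auto simp: FJ_def)
    have "ennreal (\<Sum>I\<in>FJ. l I) = (\<Sum>\<epsilon>\<in>Sig. \<Sum>I\<in>FJ. ennreal (b \<epsilon> I))"
      unfolding l_def by (subst sum.swap) (simp add: sum_ennreal b0 sum_nonneg)
    also have "\<dots> \<le> (\<Sum>\<epsilon>\<in>Sig. \<Sum>\<^sub>\<infinity>I\<in>{I\<in>D. I \<subseteq> J}. ennreal (b \<epsilon> I))"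
    proof (rule sum_mono)
      fix \<epsilon> :: "'d \<Rightarrow> bool"
      show "(\<Sum>I\<in>FJ. ennreal (b \<epsilon> I)) \<le> (\<Sum>\<^sub>\<infinity>I\<in>{I\<in>D. I \<subseteq> J}. ennreal (b \<epsilon> I))"
        unfolding infsum_finite[OF FJ(1), symmetric]
        by (rule infsum_mono_neutral) (use FJ(2) in \<open>auto intro: nonneg_summable_on_complete\<close>)
    qed
    finally have 1: "ennreal (\<Sum>I\<in>FJ. l I) / emeasure lebesgue J \<le> (\<Sum>\<epsilon>\<in>Sig. \<Sum>\<^sub>\<infinity>I\<in>{I\<in>D. I \<subseteq> J}. ennreal (b \<epsilon> I)) / emeasure lebesgue J"
      by (rule divide_right_mono_ennreal)
    also have "\<dots> \<le> star_norm D W B" unfolding star_norm_def b_def by (rule SUP_upper[OF J])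
    also have "\<dots> \<le> ennreal Q" by (rule star)
    finally have "ennreal (\<Sum>I\<in>FJ. l I) / ennreal (m J) \<le> ennreal Q"
      using lmeasurable_D[OF J] by (simp add: emeasure_eq_measure2)
    then have "(\<Sum>I\<in>FJ. l I) / m J \<le> Q"
      using m_pos[OF J] Q0 by (simp add: divide_ennreal sum_nonneg l0 ennreal_le_iff)
    then show ?thesis using m_pos[OF J] by (simp add: tree.below_def FJ_def field_simps)
  qed
  have step: "quad (avg I W) (haar_coeff B \<epsilon> I *v y) \<le> b \<epsilon> I * quad (avg I W) y" if I: "I \<in> D" for \<epsilon> I y
  proof -
    note P = W_avg_pos[OF I]
    define V where "V = msqrt (avg I W)"
    have qV: "quad (avg I W) z = (norm (V *v z))^2" for z by (simp add: V_def norm_msqrt[OF P] quad_def)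
    have "matrix_inv V ** V = mat 1" unfolding V_def by (rule matrix_inv_works(2)[OF invertible_msqrt[OF P]])
    then have "V *v (haar_coeff B \<epsilon> I *v y) = (V ** haar_coeff B \<epsilon> I ** matrix_inv V) *v (V *v y)"
      by (metis matrix_mul_assoc matrix_mul_rid matrix_vector_mul_assoc)
    then have "norm (V *v (haar_coeff B \<epsilon> I *v y)) \<le> op_norm (V ** haar_coeff B \<epsilon> I ** matrix_inv V) * norm (V *v y)"
      using norm_mv_le_op_norm by metis
    from power_mono[OF this, of 2] show ?thesis by (simp add: qV b_def V_def power_mult_distrib)
  qed
  define y where "y I = avg I f" for I
  have "(\<Sum>p\<in>G. quad (avg (snd p) W) (haar_coeff B (fst p) (snd p) *v y (snd p))) \<le> (\<Sum>p\<in>G. b (fst p) (snd p) * quad (avg (snd p) W) (y (snd p)))"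
    by (intro sum_mono step) (use G in auto)
  also have "\<dots> \<le> (\<Sum>p\<in>Sig \<times> F. b (fst p) (snd p) * quad (avg (snd p) W) (y (snd p)))"
  proof (rule sum_mono2)
    show "G \<subseteq> Sig \<times> F" using G by (force simp: F_def)
    show "0 \<le> b (fst p) (snd p) * quad (avg (snd p) W) (y (snd p))" if "p \<in> Sig \<times> F - G" for p
      using that F by (intro mult_nonneg_nonneg b0 quad_nonneg W_avg_pos) auto
  qed (use F in simp)
  also have "\<dots> = (\<Sum>\<epsilon>\<in>Sig. \<Sum>I\<in>F. b \<epsilon> I * quad (avg I W) (y I))"
    by (simp add: sum.cartesian_product case_prod_unfold)
  also have "\<dots> = (\<Sum>I\<in>F. \<Sum>\<epsilon>\<in>Sig. b \<epsilon> I * quad (avg I W) (y I))" by (rule sum.swap)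
  also have "\<dots> = (\<Sum>I\<in>F. l I * quad (avg I W) (y I))" by (simp add: l_def sum_distrib_right)
  also have "\<dots> \<le> (\<Sum>I\<in>F. (real CARD('n) * A) * (l I * quad (matrix_inv (avg I U)) (y I)))"
  proof (rule sum_mono)
    fix I assume "I \<in> F"
    then have I: "I \<in> D" using F by blast
    have "l I * quad (avg I W) (y I) \<le> l I * ((real CARD('n) * A) * quad (matrix_inv (avg I U)) (y I))"
      by (intro mult_left_mono wt.W_le l0 I)
    then show "l I * quad (avg I W) (y I) \<le> (real CARD('n) * A) * (l I * quad (matrix_inv (avg I U)) (y I))"
      by (simp only: mult_ac)
  qed
  also have "\<dots> = (real CARD('n) * A) * (\<Sum>I\<in>F. l I * quad (matrix_inv (avg I U)) (y I))" by (simp add: sum_distrib_left)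
  also have "\<dots> \<le> (real CARD('n) * A) * (16 * (real CARD('n) * A) * Q * N)"
  (* the embedding theorem is stated for a positive Carleson constant; for Q = 0 all l vanish *)
  proof (rule mult_left_mono[OF _ nA], cases "Q = 0")
    case True
    have l00: "l I = 0" if "I \<in> F" for I
    proof -
      have I: "I \<in> D" using F that by blast
      have "l I \<le> tree.below F l I" unfolding tree.below_def using F that by (intro member_le_sum l0) auto
      then show ?thesis using car[OF I] l0[of I] True by simp
    qed
    show "(\<Sum>I\<in>F. l I * quad (matrix_inv (avg I U)) (y I)) \<le> 16 * (real CARD('n) * A) * Q * N"
      by (simp add: True l00)
  next
    case False
    then show "(\<Sum>I\<in>F. l I * quad (matrix_inv (avg I U)) (y I)) \<le> 16 * (real CARD('n) * A) * Q * N" unfolding N_def y_def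
      by (intro sw.weighted_embedding[OF f q F _ l0 car]) (use Q0 in auto)
  qed
  finally show ?thesis by (simp add: y_def N_def power2_eq_square mult_ac)
qed

end

theorem mainTheorem8:
  fixes D :: "(real^'d) set set"
  assumes "dyadic_grid D"
  shows "\<exists>c>0. \<forall>(W :: real^'d \<Rightarrow> complex^'n^'n) (B :: real^'d \<Rightarrow> complex^'n^'n).
           matrix_A2_weight W \<longrightarrow> locally_integrable B \<longrightarrow>
           paraproduct_norm D W B
             \<le> ennreal (c * (log_ge1 (enn2real (A2_const W))) powr (1/2)
                          * (enn2real (A2_const W)) powr (3/2))
               * esqrt (star_norm D W B)"
proof -
  define n where "n = real CARD('n)"
  (* the factor 16 * n^2 comes from the embedding, the others from square_const *)
  define k where "k = 2 ^ CARD('d) * (2 * 2 ^ CARD('d) + 32 * n^2 * (sqrt (2 ^ CARD('d)) + 1)^2) * (16 * n^2)"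
  have k: "0 < k" unfolding k_def by (intro mult_pos_pos add_pos_nonneg) (auto simp: n_def)
  show ?thesis
  proof (intro exI[of _ "sqrt k"] conjI allI impI)
    show "0 < sqrt k" using k by simp
    fix W B :: "real^'d \<Rightarrow> complex^'n^'n"
    assume A2: "matrix_A2_weight W"
    define A where "A = enn2real (A2_const W)"
    define U where "U = (\<lambda>x. cramer_inv (W x))"
    interpret weight_pair D W U A
      unfolding U_def A_def by (rule weight_pair_of_A2[OF assms A2])
    define L where "L = log_ge1 A"
    have L: "1 \<le> L" by (simp add: L_def log_ge1_def)
    define c where "c = sqrt k * L powr (1/2) * A powr (3/2)"
    have c: "0 < c" using k L A_pos by (simp add: c_def)
    have c2: "c = sqrt (k * L * A^3)"
    proof -
      have "A powr (3/2) = sqrt (A^3)" using A_pos by (simp add: powr_half_sqrt[symmetric] powr_powr flip: powr_numeral)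
      moreover have "L powr (1/2) = sqrt L" using L by (simp add: powr_half_sqrt)
      ultimately show ?thesis by (simp add: c_def real_sqrt_mult)
    qed
    have p: "AE x in lebesgue. pos_def (W x)" using good by (rule eventually_mono) simp
    have "paraproduct_norm D W B \<le> ennreal c * esqrt (star_norm D W B)"
    proof (cases "star_norm D W B = \<infinity>")
      case True
      then show ?thesis using c by (simp add: esqrt_def ennreal_mult_top)
    next
      case False
      define Q where "Q = enn2real (star_norm D W B)"
      have Q: "0 \<le> Q" "star_norm D W B = ennreal Q" using False by (auto simp: Q_def less_top)
      have es: "esqrt (star_norm D W B) = ennreal (sqrt Q)" by (simp add: Q esqrt_ennreal)
      show ?thesis unfolding paraproduct_norm_def
      proof (rule Inf_lower, rule CollectI, intro conjI ballI)
        show "ennreal c * esqrt (star_norm D W B) < \<infinity>" unfolding es by (simp add: ennreal_mult_less_top)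
        fix f assume "f \<in> wL2 W"
        then have f: "f \<in> borel_measurable lebesgue" and fn: "wL2_norm W f < \<infinity>" by (auto simp: wL2_def)
        define a where "a p = haar_coeff B (fst p) (snd p) *v avg (snd p) f" for p
        have ps: "paraproduct_sum F B f = haar_poly F a" for F
          by (simp add: fun_eq_iff paraproduct_sum_def haar_poly_def a_def case_prod_unfold)
        have fin: "(\<integral>\<^sup>+x. ennreal (quad (W x) (f x)) \<partial>lebesgue) < \<infinity>"
          using fn by (simp add: wL2_norm_quad[OF p] esqrt_less_top)
        have nn: "AE x in lebesgue. 0 \<le> quad (W x) (f x)" using p by eventually_elim (rule quad_nonneg)
        have fi: "integrable lebesgue (\<lambda>x. quad (W x) (f x))"
          by (intro integrableI_nonneg borel_measurable_quad W_meas f nn fin)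
        define N where "N = (LINT x|lebesgue. quad (W x) (f x))"
        have N: "0 \<le> N" unfolding N_def by (rule integral_nonneg_AE[OF nn])
        have nf: "wL2_norm W f = ennreal (sqrt N)"
          unfolding wL2_norm_quad[OF p] nn_integral_eq_integral[OF fi nn] N_def[symmetric] by (rule esqrt_ennreal[OF N])
        define S where "S = 16 * (n * A)^2 * Q * N"
        obtain g where g: "g \<in> borel_measurable lebesgue"
          "(\<integral>\<^sup>+x. ennreal (quad (W x) (g x)) \<partial>lebesgue) \<le> ennreal (square_const * S)"
          "((\<lambda>F. wL2_norm W (\<lambda>x. g x - haar_poly F a x)) \<longlongrightarrow> 0) (finite_subsets_at_top (Sig \<times> D))"
        proof (rule haar_series_converges[of a S])
          fix G :: "(('d \<Rightarrow> bool) \<times> (real^'d) set) set" assume "finite G" "G \<subseteq> Sig \<times> D"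
          then show "(\<Sum>p\<in>G. quad (avg (snd p) W) (a p)) \<le> S"
            unfolding a_def S_def n_def N_def using Q by (intro paraproduct_coefficients_le[OF f fi]) auto
        qed blast
        have SC: "square_const * S = (k * L * A^3) * Q * N"
          unfolding square_const_def S_def k_def L_def n_def by (simp add: power2_eq_square power3_eq_cube mult_ac)
        have S0: "0 \<le> square_const * S" unfolding SC using k L A_pos Q N by simp
        have "wL2_norm W g \<le> ennreal (sqrt (square_const * S))"
          unfolding wL2_norm_quad[OF p] using esqrt_mono[OF g(2)] S0 by (simp add: esqrt_ennreal)
        also have "sqrt (square_const * S) = c * sqrt Q * sqrt N" unfolding SC c2 by (simp add: real_sqrt_mult)
        also have "ennreal (c * sqrt Q * sqrt N) = ennreal c * esqrt (star_norm D W B) * wL2_norm W f"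
          unfolding es nf using c Q N by (simp add: ennreal_mult')
        finally have gn: "wL2_norm W g \<le> ennreal c * esqrt (star_norm D W B) * wL2_norm W f" .
        also have "\<dots> < \<infinity>" unfolding es nf by (simp add: ennreal_mult_less_top)
        finally have "g \<in> wL2 W" using g(1) by (simp add: wL2_def)
        then have "is_paraproduct D W B f g" using g(3) by (simp add: is_paraproduct_def ps)
        then show "\<exists>g. is_paraproduct D W B f g \<and> wL2_norm W g \<le> ennreal c * esqrt (star_norm D W B) * wL2_norm W f"
          using gn by blast
      qed
    qed
    then show "paraproduct_norm D W B \<le> ennreal (sqrt k * (log_ge1 (enn2real (A2_const W))) powr (1/2)
                          * (enn2real (A2_const W)) powr (3/2)) * esqrt (star_norm D W B)"
      by (simp add: c_def L_def A_def)
  qed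
qed

end
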